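(* Let $\lambda\subseteq\nu$ and $\mu$ be partitions. Write the skew reverse plane partition generating function $g_{\nu/\lambda}$ in the basis $\{g_\eta\}$ as $g_{\nu/\lambda}=\sum_{\eta} a^{\nu}_{\lambda\eta}\, g_\eta$. Then $a^{\nu}_{\lambda\mu}$ equals $(-1)^{|\nu|-|\lambda|-|\mu|}$ times the number of column $\lambda$-Yamanouchi set-valued tableaux of shape $\mu$ and weight $\nu-\lambda$.
   Context: Diagrams are drawn in French notation (row 1 at the bottom). A reverse plane partition of skew shape $\nu/\lambda$ is a filling of the cells of $\nu/\lambda$ with positive integers weakly increasing along rows (left to right) and up columns; its weight $\mathrm{wt}(R)$ is the vector whose $i$-th entry is the number of columns of $R$ containing the letter $i$. Set $g_{\nu/\lambda}=\sum_{R} x^{\mathrm{wt}(R)}$ summed over all reverse plane partitions of shape $\nu/\lambda$, and $g_\mu=g_{\mu/\emptyset}$; the $g_\mu$ (over all partitions $\mu$) form a basis in which $g_{\nu/\lambda}$ has a unique finite expansion. A set-valued tableau of shape $\mu$ is a filling of each cell of $\mu$ with a nonempty finite set of positive integers such that every choice of one element from each cell yields a semistandard tableau (rows weakly increasing left to right, columns strictly increasing bottom to top). Its weight counts the total number of occurrences of each $i$. Its column word is obtained by reading columns from left to right, each column from top to bottom, and the letters within a cell from smallest to largest. A word $w$ is $\lambda$-Yamanouchi if for every factorization $w=uv$ and every $i\ge1$, $\mathrm{wt}_i(v)+\lambda_i\ge \mathrm{wt}_{i+1}(v)+\lambda_{i+1}$, where $\mathrm{wt}_i(v)$ is the number of occurrences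 of $i$ in $v$. A set-valued tableau is column $\lambda$-Yamanouchi if its column word is $\lambda$-Yamanouchi. The weight $\nu-\lambda$ is the componentwise difference. *)

theory Defs
  imports Main
begin

text \<open>
  A partition is a function \<open>p\<close> whose value \<open>p i\<close> is the \<open>i\<close>-th part for \<open>i \<ge> 1\<close>.
  The unused index 0 is pinned to 0, so that each partition has exactly one representation
  and weights of fillings by positive integers can be compared with partitions as functions.
\<close>

definition is_partition :: "(nat \<Rightarrow> nat) \<Rightarrow> bool" where
  "is_partition p \<longleftrightarrow>
     p 0 = 0 \<and> (\<forall>i\<ge>1. p (i + 1) \<le> p i) \<and> finite {i. p i \<noteq> 0}"

definition psize :: "(nat \<Rightarrow> nat) \<Rightarrow> nat" where
  "psize p = (\<Sum>i | p i \<noteq> 0. p i)"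

definition empty_partition :: "nat \<Rightarrow> nat" where
  "empty_partition = (\<lambda>_. 0)"

text \<open>Cells are pairs (row, column), both counted from 1; row 1 is the bottom row.\<close>

definition diagram :: "(nat \<Rightarrow> nat) \<Rightarrow> (nat \<times> nat) set" where
  "diagram p = {(r, c). 1 \<le> r \<and> 1 \<le> c \<and> c \<le> p r}"

definition skew_diagram :: "(nat \<Rightarrow> nat) \<Rightarrow> (nat \<Rightarrow> nat) \<Rightarrow> (nat \<times> nat) set" where
  "skew_diagram \<nu> lam = diagram \<nu> - diagram lam"

text \<open>Fillings are normalised outside their shape, so that cardinalities count fillings.\<close>

definition is_rpp :: "(nat \<Rightarrow> nat) \<Rightarrow> (nat \<Rightarrow> nat) \<Rightarrow> (nat \<times> nat \<Rightarrow> nat) \<Rightarrow> bool" where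
  "is_rpp \<nu> lam R \<longleftrightarrow>
     (\<forall>x \<in> skew_diagram \<nu> lam. 1 \<le> R x) \<and>
     (\<forall>x. x \<notin> skew_diagram \<nu> lam \<longrightarrow> R x = 0) \<and>
     (\<forall>r c c'. (r, c) \<in> skew_diagram \<nu> lam \<and> (r, c') \<in> skew_diagram \<nu> lam \<and> c < c'
        \<longrightarrow> R (r, c) \<le> R (r, c')) \<and>
     (\<forall>r r' c. (r, c) \<in> skew_diagram \<nu> lam \<and> (r', c) \<in> skew_diagram \<nu> lam \<and> r < r'
        \<longrightarrow> R (r, c) \<le> R (r', c))"

definition rpp_weight ::
    "(nat \<Rightarrow> nat) \<Rightarrow> (nat \<Rightarrow> nat) \<Rightarrow> (nat \<times> nat \<Rightarrow> nat) \<Rightarrow> nat \<Rightarrow> nat" where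
  "rpp_weight \<nu> lam R i = card {c. \<exists>r. (r, c) \<in> skew_diagram \<nu> lam \<and> R (r, c) = i}"

text \<open>
  A formal power series in \<open>x\<^sub>1, x\<^sub>2, \<dots>\<close> with integer coefficients is represented by its
  coefficient function: \<open>F \<alpha>\<close> is the coefficient of the monomial with exponent vector \<open>\<alpha>\<close>.
\<close>

type_synonym series = "(nat \<Rightarrow> nat) \<Rightarrow> int"

definition g_skew :: "(nat \<Rightarrow> nat) \<Rightarrow> (nat \<Rightarrow> nat) \<Rightarrow> series" where
  "g_skew \<nu> lam = (\<lambda>\<alpha>. int (card {R. is_rpp \<nu> lam R \<and> rpp_weight \<nu> lam R = \<alpha>}))"

definition g :: "(nat \<Rightarrow> nat) \<Rightarrow> series" where
  "g \<mu> = g_skew \<mu> empty_partition"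

definition is_g_expansion :: "series \<Rightarrow> ((nat \<Rightarrow> nat) \<Rightarrow> int) \<Rightarrow> bool" where
  "is_g_expansion F a \<longleftrightarrow>
     finite {\<eta>. a \<eta> \<noteq> 0} \<and> (\<forall>\<eta>. a \<eta> \<noteq> 0 \<longrightarrow> is_partition \<eta>) \<and>
     F = (\<lambda>\<alpha>. \<Sum>\<eta> | a \<eta> \<noteq> 0. a \<eta> * g \<eta> \<alpha>)"

text \<open>Only the values of the filling on the cells of the shape matter here.\<close>

definition is_semistandard :: "(nat \<Rightarrow> nat) \<Rightarrow> (nat \<times> nat \<Rightarrow> nat) \<Rightarrow> bool" where
  "is_semistandard \<mu> f \<longleftrightarrow>
     (\<forall>x \<in> diagram \<mu>. 1 \<le> f x) \<and>
     (\<forall>r c c'. (r, c) \<in> diagram \<mu> \<and> (r, c') \<in> diagram \<mu> \<and> c < c'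
        \<longrightarrow> f (r, c) \<le> f (r, c')) \<and>
     (\<forall>r r' c. (r, c) \<in> diagram \<mu> \<and> (r', c) \<in> diagram \<mu> \<and> r < r'
        \<longrightarrow> f (r, c) < f (r', c))"

definition is_set_valued_tableau :: "(nat \<Rightarrow> nat) \<Rightarrow> (nat \<times> nat \<Rightarrow> nat set) \<Rightarrow> bool" where
  "is_set_valued_tableau \<mu> T \<longleftrightarrow>
     (\<forall>x \<in> diagram \<mu>. finite (T x) \<and> T x \<noteq> {} \<and> (\<forall>i \<in> T x. 1 \<le> i)) \<and>
     (\<forall>x. x \<notin> diagram \<mu> \<longrightarrow> T x = {}) \<and>
     (\<forall>f. (\<forall>x \<in> diagram \<mu>. f x \<in> T x) \<longrightarrow> is_semistandard \<mu> f)"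

definition svt_weight :: "(nat \<Rightarrow> nat) \<Rightarrow> (nat \<times> nat \<Rightarrow> nat set) \<Rightarrow> nat \<Rightarrow> nat" where
  "svt_weight \<mu> T i = card {x \<in> diagram \<mu>. i \<in> T x}"

definition column_height :: "(nat \<Rightarrow> nat) \<Rightarrow> nat \<Rightarrow> nat" where
  "column_height \<mu> c = card {r. (r, c) \<in> diagram \<mu>}"

definition column_word :: "(nat \<Rightarrow> nat) \<Rightarrow> (nat \<times> nat \<Rightarrow> nat set) \<Rightarrow> nat list" where
  "column_word \<mu> T =
     concat (map (\<lambda>c. concat (map (\<lambda>r. sorted_list_of_set (T (r, c)))
                                  (rev [1..<Suc (column_height \<mu> c)])))
                 [1..<Suc (\<mu> 1)])"

definition yamanouchi :: "(nat \<Rightarrow> nat) \<Rightarrow> nat list \<Rightarrow> bool" where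
  "yamanouchi lam w \<longleftrightarrow>
     (\<forall>u v. w = u @ v \<longrightarrow>
        (\<forall>i\<ge>1. count_list v i + lam i \<ge> count_list v (i + 1) + lam (i + 1)))"

definition column_yamanouchi ::
    "(nat \<Rightarrow> nat) \<Rightarrow> (nat \<Rightarrow> nat) \<Rightarrow> (nat \<times> nat \<Rightarrow> nat set) \<Rightarrow> bool" where
  "column_yamanouchi lam \<mu> T \<longleftrightarrow> yamanouchi lam (column_word \<mu> T)"

end

theory Submission
  imports Defs "HOL-Combinatorics.Permutations" "HOL-Computational_Algebra.Polynomial"
    "HOL-Computational_Algebra.Formal_Power_Series" "HOL-Library.FuncSet"
begin

text \<open>
  Let $n$ bound the number of rows of $\nu$ and let $K_\alpha = \det(z_i^{\alpha_j+n-j}(1-z_i)^{j-1})$ in variables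
  $z_1, \ldots, z_n$. For partitions $\alpha$ these alternants are linearly independent, and multiplication by the
  complete symmetric polynomial $h_k$ maps $K_\lambda$ to the sum of the $K_\nu$ such that $\nu/\lambda$ meets exactly
  $k$ columns. Removing the largest letter of a reverse plane partition step by step therefore gives
  $h_\alpha K_\lambda = \sum_\nu g_{\nu/\lambda}[x^\alpha]\, K_\nu$.

  Let $G_\mu$ be the generating polynomial of the set-valued tableaux of shape $\mu$ with sign
  $(-1)^{|T|-|\mu|}$. It is symmetric, and in $G_\mu K_\lambda = \sum_T \pm K_{\lambda + wt(T)}$ the tableaux that are not
  $\lambda$-Yamanouchi cancel: grouped by the first violation, at letters $i, i+1$, their contributions are symmetric
  in $z_i, z_{i+1}$ and vanish under antisymmetrization. For $\lambda = \emptyset$ this says $G_\mu K_\emptyset = K_\mu$.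
  Multiplying $h_\alpha K_\emptyset = \sum_\mu g_\mu[x^\alpha]\, G_\mu K_\emptyset$ by $G_\lambda$ yields
  $h_\alpha K_\lambda = \sum_\mu g_\mu[x^\alpha]\, G_\mu K_\lambda$, and comparing the coefficients of $K_\nu$ gives the expansion.
\<close>

section \<open>Alternating sums and determinants\<close>

text \<open>The Pieri rule is reached through prod (1-z_i)/(1-x z_i) and not through prod 1/(1-x
  z_i): the additional factor raises (1-z_i)^(j-1) to (1-z_i)^j, and then the remainder of the
  geometric expansion of row j is a multiple of row j-1, so that row operations remove it. The
  coefficients obtained are weights of horizontal strips, and Moebius inversion over containment of
  shapes, with signed rook strips as Moebius function, turns them into the count of columns. No
  involution on tableaux is constructed, neither for the symmetry of G nor for the cancellation.
  With all shapes but the i-th frozen, the signed sum over a class of tableaux is a product over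
  rows of explicit polynomials in z_i, z_{i+1}. For this the Yamanouchi condition must concern one
  row at a time, although it is defined by reading columns; hence the row form of the condition. The
  number n depends on \<lambda> and \<nu> only: a tableau of weight \<nu> - \<lambda> has letters at
  most n, and a shape \<mu> with more than n rows admits none.\<close>

declare One_nat_def [simp del]

text \<open>Unlike \<open>PiE\<close>, the value off \<open>A\<close> is a prescribed
  \<open>d\<close>: the members have to serve as partitions, which vanish off \<open>{1..n}\<close>,
  and as families of bundles.\<close>

definition funs_default :: "'d \<Rightarrow> 'i set \<Rightarrow> ('i \<Rightarrow> 'd set) \<Rightarrow> ('i \<Rightarrow> 'd) set" where
  "funs_default d A I = {h. (\<forall>i\<in>A. h i \<in> I i) \<and> (\<forall>i. i \<notin> A \<longrightarrow> h i = d)}"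

lemma bij_betw_PiE_funs_default:
  "bij_betw (\<lambda>h i. if i \<in> A then h i else d) (PiE A I) (funs_default d A I)"
  by (rule bij_betw_byWitness[where f' = "\<lambda>h. restrict h A"])
     (auto simp: funs_default_def PiE_def extensional_def fun_eq_iff)

lemma prod_sum_funs_default:
  fixes f :: "'i \<Rightarrow> 'd \<Rightarrow> 'a :: comm_semiring_1"
  assumes "finite A" "\<And>i. i \<in> A \<Longrightarrow> finite (I i)"
  shows "(\<Prod>i\<in>A. \<Sum>x\<in>I i. f i x) = (\<Sum>h\<in>funs_default d A I. \<Prod>i\<in>A. f i (h i))"
proof -
  have "(\<Prod>i\<in>A. \<Sum>x\<in>I i. f i x) = (\<Sum>h\<in>PiE A I. \<Prod>i\<in>A. f i (h i))"
    by (rule prod_sum_PiE) (use assms in auto)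
  also have "\<dots> = (\<Sum>h\<in>PiE A I. \<Prod>i\<in>A. f i (if i \<in> A then h i else d))"
    by (intro sum.cong prod.cong) auto
  also have "\<dots> = (\<Sum>h\<in>funs_default d A I. \<Prod>i\<in>A. f i (h i))"
    by (rule sum.reindex_bij_betw[OF bij_betw_PiE_funs_default])
  finally show ?thesis .
qed

definition altsum :: "nat \<Rightarrow> ((nat \<Rightarrow> nat) \<Rightarrow> 'a) \<Rightarrow> 'a::comm_ring_1" where
  "altsum n F = (\<Sum>p | p permutes {1..n}. of_int (sign p) * F p)"

lemma altsum_cong:
  "(\<And>p. p permutes {1..n} \<Longrightarrow> F p = G p) \<Longrightarrow> altsum n F = altsum n G"
  unfolding altsum_def by (intro sum.cong) auto

lemma altsum_add: "altsum n (\<lambda>p. F p + G p) = altsum n F + altsum n G"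
  unfolding altsum_def by (simp add: algebra_simps sum.distrib)

lemma altsum_mult: "altsum n (\<lambda>p. c * F p) = c * altsum n F"
  unfolding altsum_def by (simp add: algebra_simps sum_distrib_left)

lemma altsum_sum: "altsum n (\<lambda>p. \<Sum>x\<in>X. F x p) = (\<Sum>x\<in>X. altsum n (F x))"
  unfolding altsum_def by (subst sum.swap) (simp add: sum_distrib_left)

text \<open>Pairing even and odd permutations, instead of deducing that the sum equals its own negative,
avoids excluding characteristic 2.\<close>

lemma altsum_eq_0:
  assumes ij: "i \<in> {1..n}" "j \<in> {1..n}" "i \<noteq> j"
    and F: "\<And>p. p permutes {1..n} \<Longrightarrow> F (p \<circ> transpose i j) = F p"
  shows "altsum n F = 0"
proof -
  let ?s = "transpose i j" and ?S = "{p. p permutes {1..n}}"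
  let ?E = "{p\<in>?S. evenperm p}" and ?O = "{p\<in>?S. \<not> evenperm p}"
  have fin: "finite ?S" by (simp add: finite_permutations)
  have sp: "?s permutes {1..n}" using ij by (intro permutes_swap_id) auto
  have ev: "evenperm (p \<circ> ?s) \<longleftrightarrow> \<not> evenperm p" if "p permutes {1..n}" for p
    using that ij sp
    by (subst evenperm_comp) (auto simp: evenperm_swap intro: permutation_permutes[THEN iffD2])
  have inv: "p \<circ> ?s \<circ> ?s = p" for p :: "nat \<Rightarrow> nat" by (simp add: comp_assoc)
  have bij: "bij_betw (\<lambda>p. p \<circ> ?s) ?E ?O"
    by (rule bij_betw_byWitness[where f' = "\<lambda>p. p \<circ> ?s"])
       (auto simp: inv ev permutes_compose[OF sp])
  have "(\<Sum>p\<in>?O. of_int (sign p) * F p) = (\<Sum>p\<in>?E. of_int (sign (p \<circ> ?s)) * F (p \<circ> ?s))"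
    by (rule sum.reindex_bij_betw[OF bij, symmetric])
  also have "\<dots> = (\<Sum>p\<in>?E. - (of_int (sign p) * F p))"
    by (intro sum.cong) (auto simp: sign_def ev F)
  finally have O: "(\<Sum>p\<in>?O. of_int (sign p) * F p) = - (\<Sum>p\<in>?E. of_int (sign p) * F p)"
    by (simp add: sum_negf)
  have "altsum n F = (\<Sum>p\<in>?E \<union> ?O. of_int (sign p) * F p)"
    unfolding altsum_def by (intro sum.cong) auto
  also have "\<dots> = (\<Sum>p\<in>?E. of_int (sign p) * F p) + (\<Sum>p\<in>?O. of_int (sign p) * F p)"
    by (intro sum.union_disjoint) (use fin in auto)
  finally show ?thesis using O by simp
qed

definition rows_det :: "nat \<Rightarrow> (nat \<Rightarrow> nat \<Rightarrow> 'a) \<Rightarrow> 'a::comm_ring_1" where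
  "rows_det n \<phi> = altsum n (\<lambda>p. \<Prod>j=1..n. \<phi> j (p j))"

lemma rows_det_cong:
  assumes "\<And>j i. j \<in> {1..n} \<Longrightarrow> i \<in> {1..n} \<Longrightarrow> \<phi> j i = \<psi> j i"
  shows "rows_det n \<phi> = rows_det n \<psi>"
  unfolding rows_det_def by (intro altsum_cong prod.cong assms) (auto dest: permutes_in_image)

lemma rows_det_equal_rows:
  assumes ij: "i \<in> {1..n}" "j \<in> {1..n}" "i \<noteq> j" and eq: "\<phi> i = \<phi> j"
  shows "rows_det n \<phi> = 0"
  unfolding rows_det_def
proof (rule altsum_eq_0[OF ij])
  fix p :: "nat \<Rightarrow> nat" assume "p permutes {1..n}"
  let ?s = "transpose i j"
  have sp: "?s permutes {1..n}" using ij by (intro permutes_swap_id) auto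
  have row: "\<phi> (?s k) = \<phi> k" for k by (auto simp: transpose_def eq)
  have "(\<Prod>k=1..n. \<phi> k ((p \<circ> ?s) k)) = (\<Prod>k=1..n. \<phi> (?s k) (p (?s k)))"
    by (simp add: row)
  also have "\<dots> = (\<Prod>k=1..n. \<phi> k (p k))"
    using prod.permute[OF sp, of "\<lambda>k. \<phi> k (p k)"] by (simp add: o_def)
  finally show "(\<Prod>k=1..n. \<phi> k ((p \<circ> ?s) k)) = (\<Prod>k=1..n. \<phi> k (p k))" .
qed

lemma rows_det_row_linear:
  assumes k: "k \<in> {1..n}" and eq: "\<And>i. i \<in> {1..n} \<Longrightarrow> \<phi> k i = A i + c * B i"
  shows "rows_det n \<phi> = rows_det n (\<phi>(k := A)) + c * rows_det n (\<phi>(k := B))"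
proof -
  have split: "(\<Prod>j=1..n. \<psi> j (p j)) = \<psi> k (p k) * (\<Prod>j\<in>{1..n}-{k}. \<psi> j (p j))"
    for \<psi> :: "nat \<Rightarrow> nat \<Rightarrow> 'a" and p
    by (rule prod.remove) (use k in auto)
  have other: "(\<Prod>j\<in>{1..n}-{k}. (\<phi>(k := X)) j (p j)) = (\<Prod>j\<in>{1..n}-{k}. \<phi> j (p j))" for X p
    by (intro prod.cong) auto
  show ?thesis
    unfolding rows_det_def altsum_mult[symmetric] altsum_add[symmetric]
  proof (rule altsum_cong)
    fix p assume "p permutes {1..n}"
    then have "p k \<in> {1..n}" using k permutes_in_image[of p "{1..n}" k] by simp
    then show "(\<Prod>j=1..n. \<phi> j (p j)) =
        (\<Prod>j=1..n. (\<phi>(k := A)) j (p j)) + c * (\<Prod>j=1..n. (\<phi>(k := B)) j (p j))"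
      unfolding split other by (simp add: eq algebra_simps)
  qed
qed

lemma rows_det_row_add:
  assumes k: "k \<in> {1..n}" "l \<in> {1..n}" "k \<noteq> l"
    and eq: "\<And>i. i \<in> {1..n} \<Longrightarrow> \<phi> k i = A i + c * \<phi> l i"
  shows "rows_det n \<phi> = rows_det n (\<phi>(k := A))"
proof -
  have "rows_det n (\<phi>(k := \<phi> l)) = 0"
    by (rule rows_det_equal_rows[OF k]) (use k in auto)
  then show ?thesis using rows_det_row_linear[OF k(1), of \<phi> A c "\<phi> l"] eq by simp
qed

text \<open>Multilinearity in all rows at once; \<open>h\<close> records which summand is taken in
  each row.\<close>

lemma rows_det_expand:
  assumes "\<And>j. j \<in> {1..n} \<Longrightarrow> finite (I j)"
  shows "rows_det n (\<lambda>j i. \<Sum>m\<in>I j. c j m * f j m i) =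
    (\<Sum>h\<in>funs_default d {1..n} I. (\<Prod>j=1..n. c j (h j)) * rows_det n (\<lambda>j. f j (h j)))"
  unfolding rows_det_def
  by (subst prod_sum_funs_default[where d = d]) (use assms in \<open>auto simp: altsum_sum altsum_mult prod.distrib\<close>)

lemma prod_permutes:
  assumes "p permutes {1..n}"
  shows "(\<Prod>j=1..n. h (p j)) = (\<Prod>j=1..n. (h j :: 'a :: comm_monoid_mult))"
  using prod.permute[OF assms, of h] by (simp add: o_def)

lemma rows_det_mult_columns:
  "(\<Prod>j=1..n. h j) * rows_det n \<phi> = rows_det n (\<lambda>j i. h i * \<phi> j i)"
  unfolding rows_det_def altsum_mult[symmetric]
  by (intro altsum_cong) (simp add: prod.distrib prod_permutes)

section \<open>A Pieri rule for K-theoretic alternants\<close>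

definition par :: "nat \<Rightarrow> (nat \<Rightarrow> nat) set" where
  "par n = {p. p 0 = 0 \<and> (\<forall>i\<ge>1. p (Suc i) \<le> p i) \<and> (\<forall>i>n. p i = 0)}"

lemma parD:
  assumes "p \<in> par n"
  shows "p 0 = 0" "i \<ge> 1 \<Longrightarrow> p (Suc i) \<le> p i" "i > n \<Longrightarrow> p i = 0"
  using assms by (auto simp: par_def)

lemma par_antimono:
  assumes "p \<in> par n" "1 \<le> i" "i \<le> j"
  shows "p j \<le> p i"
  using assms(3)
proof (induction j rule: dec_induct)
  case (step k)
  then have "p (Suc k) \<le> p k" using assms(2) parD(2)[OF assms(1)] by simp
  then show ?case using step.IH by simp
qed simp

lemma finite_par_bounded: "finite {p \<in> par n. \<forall>i. p i \<le> M}"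
proof (rule finite_subset)
  show "{p \<in> par n. \<forall>i. p i \<le> M} \<subseteq>
      {f. \<forall>x. (x \<in> {..n} \<longrightarrow> f x \<in> {..M}) \<and> (x \<notin> {..n} \<longrightarrow> f x = 0)}"
    by (auto simp: par_def)
qed (rule finite_set_of_finite_funs; simp)

text \<open>Partitions in an \<open>n\<close> by \<open>M\<close> rectangle. Expansions without a
  bound in row 1 are cut off to these finite sets.\<close>

definition box :: "nat \<Rightarrow> nat \<Rightarrow> (nat \<Rightarrow> nat) set" where
  "box n M = {p \<in> par n. p 1 \<le> M}"

lemma box_bounded: "p \<in> box n M \<Longrightarrow> p i \<le> M"
  using par_antimono[of p n 1 i] by (cases "i = 0") (auto simp: box_def par_def)

lemma finite_box [simp]: "finite (box n M)"
  by (rule finite_subset[OF _ finite_par_bounded[of n M]])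
     (auto intro: box_bounded simp: box_def)

definition interval :: "nat \<Rightarrow> (nat \<Rightarrow> nat) \<Rightarrow> (nat \<Rightarrow> nat) \<Rightarrow> (nat \<Rightarrow> nat) set" where
  "interval n p q = {\<kappa> \<in> par n. p \<le> \<kappa> \<and> \<kappa> \<le> q}"

lemma finite_interval: "q \<in> par n \<Longrightarrow> finite (interval n p q)"
  by (rule finite_subset[OF _ finite_box[of n "q 1"]])
     (auto simp: interval_def box_def le_fun_def)

text \<open>The coefficients of $(1-z)/(1-xz)$ as a power series in $z$.\<close>

definition strip_wt :: "'a \<Rightarrow> nat \<Rightarrow> 'a :: comm_ring_1" where
  "strip_wt x m = (if m = 0 then 1 else x ^ (m - 1) * (x - 1))"

lemma strip_wt_0 [simp]: "strip_wt x 0 = 1" and strip_wt_Suc: "strip_wt x (Suc m) = x ^ m * (x - 1)"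
  by (simp_all add: strip_wt_def)

lemma strip_wt_Suc_Suc: "strip_wt x (Suc (Suc m)) = x * strip_wt x (Suc m)"
  by (simp add: strip_wt_Suc mult_ac)

text \<open>Dividing (1-z)/(1-xz) by 1-z gives 1/(1-xz), so the partial sums of the coefficients are
  the powers of \<open>x\<close>. At \<open>x = 0\<close> the sum vanishes unless
  \<open>M = 0\<close>, which is the source of the Moebius inversion below.\<close>

lemma sum_strip_wt: "(\<Sum>m=0..M. strip_wt x m) = x ^ M"
  by (induction M) (auto simp: strip_wt_Suc algebra_simps)

lemma sum_shift_diff:
  fixes a b :: nat
  assumes "a \<le> b"
  shows "(\<Sum>m=a..b. f (m - a)) = (\<Sum>m=0..b-a. f m)"
  by (rule sum.reindex_bij_witness[of _ "\<lambda>m. m + a" "\<lambda>m. m - a"]) (use assms in auto)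

lemma sum_shift_diff_up:
  fixes a b :: nat
  assumes "a \<le> b"
  shows "(\<Sum>m=a..b. f (b - m)) = (\<Sum>m=0..b-a. f m)"
  by (rule sum.reindex_bij_witness[of _ "\<lambda>m. b - m" "\<lambda>m. b - m"]) (use assms in auto)

text \<open>\<open>\<gamma>\<close> stands for 1/(1-xz). The expansion is kept finite with an exact
  remainder, so that it makes sense in every commutative ring and the remainder can take part in row
  operations.\<close>

lemma strip_wt_geometric:
  assumes "(1 - x * z) * \<gamma> = 1"
  shows "(1 - z) * \<gamma> = (\<Sum>m=0..d. strip_wt x m * z ^ m) + strip_wt x (Suc d) * z ^ Suc d * \<gamma>"
proof -
  have g: "\<gamma> = 1 + x * z * \<gamma>" using assms by (simp add: algebra_simps)
  show ?thesis
  proof (induction d)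
    case 0
    have "(1 - z) * \<gamma> = \<gamma> - z * \<gamma>" by (simp add: algebra_simps)
    also have "\<gamma> - z * \<gamma> = 1 + x * z * \<gamma> - z * \<gamma>" using g by simp
    finally show ?case by (simp add: strip_wt_Suc algebra_simps)
  next
    case (Suc d)
    have "strip_wt x (Suc d) * z ^ Suc d * \<gamma> = strip_wt x (Suc d) * z ^ Suc d * (1 + x * z * \<gamma>)"
      using g by simp
    then show ?case unfolding Suc by (simp add: strip_wt_Suc_Suc algebra_simps)
  qed
qed

definition alt_entry :: "nat \<Rightarrow> (nat \<Rightarrow> 'a) \<Rightarrow> nat \<Rightarrow> nat \<Rightarrow> nat \<Rightarrow> 'a :: comm_ring_1" where
  "alt_entry n z j m i = z i ^ (m + n - j) * (1 - z i) ^ (j - 1)"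

text \<open>The alternants in the numerator of the bialternant formula for Grothendieck polynomials,
with $j$ indexing rows and $i$ columns.\<close>

definition Kdet :: "nat \<Rightarrow> (nat \<Rightarrow> 'a) \<Rightarrow> (nat \<Rightarrow> nat) \<Rightarrow> 'a :: comm_ring_1" where
  "Kdet n z \<alpha> = rows_det n (\<lambda>j. alt_entry n z j (\<alpha> j))"

text \<open>The remainder is the left side for row j-1 with \<open>l\<close> replaced by
  \<open>u\<close>, because u+1+n-j = u+n-(j-1). With \<open>u\<close> the part in row j-1 it is a
  multiple of a row of the same matrix.\<close>

lemma alt_entry_geometric:
  assumes j: "1 \<le> j" "j \<le> n" and u: "l \<le> u" and g: "(1 - x * z i) * \<gamma> = 1"
  shows "z i ^ (l + n - j) * (1 - z i) ^ j * \<gamma> =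
    (\<Sum>m=l..u. strip_wt x (m - l) * alt_entry n z j m i) +
    strip_wt x (Suc (u - l)) * (z i ^ (u + 1 + n - j) * (1 - z i) ^ (j - 1) * \<gamma>)"
proof -
  let ?c = "z i ^ (l + n - j) * (1 - z i) ^ (j - 1)"
  have p: "(1 - z i) ^ j = (1 - z i) ^ (j - 1) * (1 - z i)"
    using j by (cases j) auto
  have s: "(\<Sum>m=l..u. strip_wt x (m - l) * alt_entry n z j m i) =
      (\<Sum>m=l..u. ?c * (strip_wt x (m - l) * z i ^ (m - l)))"
  proof (intro sum.cong refl)
    fix m assume "m \<in> {l..u}"
    then have "m + n - j = (l + n - j) + (m - l)" using j by auto
    then show "strip_wt x (m - l) * alt_entry n z j m i = ?c * (strip_wt x (m - l) * z i ^ (m - l))"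
      by (simp add: alt_entry_def power_add mult_ac)
  qed
  have e: "u + 1 + n - j = (l + n - j) + Suc (u - l)" using j u by auto
  have "z i ^ (l + n - j) * (1 - z i) ^ j * \<gamma> = ?c * ((1 - z i) * \<gamma>)"
    by (simp add: p mult_ac)
  also have "\<dots> = ?c * ((\<Sum>m=0..u-l. strip_wt x m * z i ^ m) + strip_wt x (Suc (u-l)) * z i ^ Suc (u-l) * \<gamma>)"
    by (simp only: strip_wt_geometric[OF g, of "u - l"])
  also have "\<dots> = (\<Sum>m=l..u. strip_wt x (m - l) * alt_entry n z j m i) +
    strip_wt x (Suc (u - l)) * (z i ^ (u + 1 + n - j) * (1 - z i) ^ (j - 1) * \<gamma>)"
    unfolding s sum_distrib_left[symmetric] e power_add
      sum_shift_diff[OF u, of "\<lambda>m. strip_wt x m * z i ^ m"]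
    by (simp only: distrib_left mult_ac)
  finally show ?thesis .
qed

text \<open>For j > 1 the bound is the horizontal strip condition. Row 1 has no such bound, and
  \<open>d\<close> is an artificial cutoff.\<close>

definition strip_bound :: "nat \<Rightarrow> (nat \<Rightarrow> nat) \<Rightarrow> nat \<Rightarrow> nat" where
  "strip_bound d l j = (if j = 1 then l 1 + d else l (j - 1))"

lemma strip_bound_ge: "l \<in> par n \<Longrightarrow> 1 \<le> j \<Longrightarrow> l j \<le> strip_bound d l j"
  using parD(2)[of l n "j - 1"] by (auto simp: strip_bound_def)

text \<open>After division by $1 - xz$, row $j$ is its horizontal strip part plus a multiple of row $j-1$
of the same matrix, so row operations from the bottom up leave the strip parts only. Row 1 has no
predecessor and keeps a tail, divisible by a power of $x$ that can be made arbitrarily high.\<close>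

lemma Kdet_strip_expansion:
  fixes z :: "nat \<Rightarrow> 'a :: comm_ring_1"
  assumes n: "n \<ge> 1" and l: "l \<in> par n"
    and g: "\<And>i. i \<in> {1..n} \<Longrightarrow> (1 - x * z i) * \<gamma> i = 1"
  shows "\<exists>R. (\<Prod>i=1..n. (1 - z i) * \<gamma> i) * Kdet n z l =
    (\<Sum>\<nu>\<in>funs_default 0 {1..n} (\<lambda>j. {l j..strip_bound d l j}).
       (\<Prod>j=1..n. strip_wt x (\<nu> j - l j)) * Kdet n z \<nu>) + strip_wt x (Suc d) * R"
proof -
  define \<rho> where "\<rho> = (\<lambda>j i. z i ^ (l j + n - j) * (1 - z i) ^ j * \<gamma> i)"
  define P where "P = (\<lambda>j i. \<Sum>m\<in>{l j..strip_bound d l j}. strip_wt x (m - l j) * alt_entry n z j m i)"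
  \<comment> \<open>In \<open>\<phi> k\<close> the rows up to \<open>k\<close> are still unreduced.
    Rows are reduced from \<open>n\<close> downwards, so row k-1, a multiple of which is removed
    from row k, is still intact.\<close>
  define \<phi> where "\<phi> = (\<lambda>k j. if j \<le> k then \<rho> j else P j)"
  have step: "rows_det n (\<phi> k) = rows_det n (\<phi> (k - 1))" if k: "2 \<le> k" "k \<le> n" for k
  proof -
    have "rows_det n (\<phi> k) = rows_det n ((\<phi> k)(k := P k))"
    proof (rule rows_det_row_add[where l = "k - 1" and c = "strip_wt x (Suc (l (k-1) - l k))"])
      fix i assume i: "i \<in> {1..n}"
      have e: "l (k - 1) + 1 + n - k = l (k - 1) + n - (k - 1)" using k by auto
      have "\<rho> k i = P k i + strip_wt x (Suc (l (k-1) - l k)) * \<rho> (k - 1) i"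
        unfolding \<rho>_def P_def
        using alt_entry_geometric[of k n "l k" "strip_bound d l k" x z i "\<gamma> i"] strip_bound_ge[OF l, of k d] k g[OF i] e
        by (simp add: strip_bound_def)
      then show "\<phi> k k i = P k i + strip_wt x (Suc (l (k-1) - l k)) * \<phi> k (k - 1) i"
        by (simp add: \<phi>_def)
    qed (use k in auto)
    also have "(\<phi> k)(k := P k) = \<phi> (k - 1)"
      using k by (auto simp: \<phi>_def fun_eq_iff)
    finally show ?thesis .
  qed
  have "rows_det n (\<phi> k) = rows_det n (\<phi> 1)" if "1 \<le> k" "k \<le> n" for k
    using that by (induction k rule: dec_induct) (use step in auto)
  from this[of n] have "rows_det n (\<phi> n) = rows_det n (\<phi> 1)" using n by simp
  also have "\<dots> = rows_det n ((\<phi> 1)(1 := P 1)) + strip_wt x (Suc d) *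
      rows_det n ((\<phi> 1)(1 := \<lambda>i. z i ^ (l 1 + d + 1 + n - 1) * (1 - z i) ^ (1 - 1) * \<gamma> i))"
    (is "_ = _ + _ * ?R")
  proof (rule rows_det_row_linear)
    fix i assume i: "i \<in> {1..n}"
    show "\<phi> 1 1 i = P 1 i + strip_wt x (Suc d) *
        (z i ^ (l 1 + d + 1 + n - 1) * (1 - z i) ^ (1 - 1) * \<gamma> i)"
      using alt_entry_geometric[of 1 n "l 1" "strip_bound d l 1" x z i "\<gamma> i"] n g[OF i]
      by (simp add: \<phi>_def \<rho>_def P_def strip_bound_def)
  qed (use n in auto)
  also have "rows_det n ((\<phi> 1)(1 := P 1)) = rows_det n P"
    by (rule rows_det_cong) (auto simp: \<phi>_def)
  also have "rows_det n P = (\<Sum>\<nu>\<in>funs_default 0 {1..n} (\<lambda>j. {l j..strip_bound d l j}).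
       (\<Prod>j=1..n. strip_wt x (\<nu> j - l j)) * Kdet n z \<nu>)"
    unfolding P_def Kdet_def by (rule rows_det_expand) auto
  also have "rows_det n (\<phi> n) = (\<Prod>i=1..n. (1 - z i) * \<gamma> i) * Kdet n z l"
    unfolding Kdet_def rows_det_mult_columns
  proof (rule rows_det_cong)
    fix j i assume j: "j \<in> {1..n}"
    have "(1 - z i) ^ j = (1 - z i) * (1 - z i) ^ (j - 1)" using j by (cases j) auto
    then show "\<phi> n j i = (1 - z i) * \<gamma> i * alt_entry n z j (l j) i"
      using j by (simp add: \<phi>_def \<rho>_def alt_entry_def mult_ac)
  qed
  finally show ?thesis by blast
qed

section \<open>Horizontal strips, column counts and Moebius inversion\<close>

text \<open>The coefficient of K_\<nu> in the product of K_l and all (1-z_i)/(1-x z_i), up to the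
  cutoff in row 1. It is 0 off horizontal strips, so sums can run over any finite set of shapes that
  contains the strips. At \<open>x = 0\<close> it is the sign of a rook strip.\<close>

definition strip_kernel :: "nat \<Rightarrow> 'a \<Rightarrow> (nat \<Rightarrow> nat) \<Rightarrow> (nat \<Rightarrow> nat) \<Rightarrow> 'a :: comm_ring_1" where
  "strip_kernel n x l \<nu> = (\<Prod>j=1..n. if l j \<le> \<nu> j \<and> (j \<noteq> 1 \<longrightarrow> \<nu> j \<le> l (j - 1)) then strip_wt x (\<nu> j - l j) else 0)"

lemma strip_kernel_eq_0:
  assumes "j \<in> {1..n}" "\<not> (l j \<le> \<nu> j \<and> (j \<noteq> 1 \<longrightarrow> \<nu> j \<le> l (j - 1)))"
  shows "strip_kernel n x l \<nu> = 0"
  unfolding strip_kernel_def using assms by (intro prod_zero) auto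

lemma of_int_strip_wt: "(of_int (strip_wt y m) :: 'a :: comm_ring_1) = strip_wt (of_int y) m"
  by (cases m) (auto simp: strip_wt_Suc)

lemma strip_kernel_of_int: "strip_kernel n (of_int y) l \<nu> = (of_int (strip_kernel n y l \<nu>) :: 'a :: comm_ring_1)"
  unfolding strip_kernel_def of_int_prod by (intro prod.cong) (auto simp: of_int_strip_wt)

text \<open>Exchanges the product domain of a multilinear expansion for a set \<open>S\<close> of
  shapes; applied to \<open>box\<close> for alternants and to \<open>interval\<close> for
  \<open>power_ncols\<close>.\<close>

lemma sum_funs_default_strip_kernel:
  assumes l: "l \<in> par n" and fin: "finite S" and S: "funs_default 0 {1..n} (\<lambda>j. {l j..u j}) \<subseteq> S"
    and u: "\<And>j. 1 \<le> j \<Longrightarrow> j \<le> n \<Longrightarrow> j \<noteq> 1 \<Longrightarrow> u j \<le> l (j - 1)"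
    and S': "\<And>\<nu>. \<nu> \<in> S \<Longrightarrow> \<nu> \<in> par n \<and>
      (\<forall>j\<in>{1..n}. l j \<le> \<nu> j \<longrightarrow> (j \<noteq> 1 \<longrightarrow> \<nu> j \<le> l (j - 1)) \<longrightarrow> \<nu> j \<le> u j)"
  shows "(\<Sum>\<nu>\<in>funs_default 0 {1..n} (\<lambda>j. {l j..u j}). (\<Prod>j=1..n. strip_wt x (\<nu> j - l j)) * f \<nu>) =
    (\<Sum>\<nu>\<in>S. strip_kernel n x l \<nu> * f \<nu>)"
proof -
  let ?D = "funs_default 0 {1..n} (\<lambda>j. {l j..u j})"
  have "(\<Sum>\<nu>\<in>S. strip_kernel n x l \<nu> * f \<nu>) = (\<Sum>\<nu>\<in>?D. strip_kernel n x l \<nu> * f \<nu>)"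
  proof (rule sum.mono_neutral_right[OF fin S], safe)
    fix \<nu> assume "\<nu> \<in> S" and notD: "\<nu> \<notin> ?D"
    then have "\<nu> i = 0" if "i \<notin> {1..n}" for i
      using that S'[of \<nu>] by (cases "i = 0") (auto simp: par_def)
    then obtain j where j: "j \<in> {1..n}" "\<nu> j \<notin> {l j..u j}"
      using notD by (auto simp: funs_default_def)
    then have "\<not> (l j \<le> \<nu> j \<and> (j \<noteq> 1 \<longrightarrow> \<nu> j \<le> l (j - 1)))"
      using S'[OF \<open>\<nu> \<in> S\<close>] by auto
    then show "strip_kernel n x l \<nu> * f \<nu> = 0"
      using strip_kernel_eq_0[OF j(1), of l \<nu> x] by simp
  qed
  also have "\<dots> = (\<Sum>\<nu>\<in>?D. (\<Prod>j=1..n. strip_wt x (\<nu> j - l j)) * f \<nu>)"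
  proof (intro sum.cong refl)
    fix \<nu> assume "\<nu> \<in> ?D"
    then have a: "\<nu> j \<in> {l j..u j}" if "j \<in> {1..n}" for j using that by (auto simp: funs_default_def)
    have b: "\<nu> j \<le> l (j - 1)" if "j \<in> {1..n}" "j \<noteq> 1" for j
      using a[OF that(1)] u[of j] that by fastforce
    have "strip_kernel n x l \<nu> = (\<Prod>j=1..n. strip_wt x (\<nu> j - l j))"
      unfolding strip_kernel_def using a b by (intro prod.cong) auto
    then show "strip_kernel n x l \<nu> * f \<nu> = (\<Prod>j=1..n. strip_wt x (\<nu> j - l j)) * f \<nu>" by simp
  qed
  finally show ?thesis by simp
qed

lemma funs_default_strip_par:
  assumes l: "l \<in> par n" and u: "\<And>j. 1 \<le> j \<Longrightarrow> j \<le> n \<Longrightarrow> j \<noteq> 1 \<Longrightarrow> u j \<le> l (j - 1)"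
    and \<nu>: "\<nu> \<in> funs_default 0 {1..n} (\<lambda>j. {l j..u j})"
  shows "\<nu> \<in> par n"
proof -
  have "\<nu> (Suc i) \<le> \<nu> i" if "i \<ge> 1" for i
  proof (cases "Suc i \<le> n")
    case True
    then have "\<nu> (Suc i) \<le> u (Suc i)" "l i \<le> \<nu> i" using \<nu> that by (auto simp: funs_default_def)
    then show ?thesis using u[of "Suc i"] True that by auto
  qed (use \<nu> in \<open>auto simp: funs_default_def\<close>)
  then show ?thesis using \<nu> by (auto simp: par_def funs_default_def)
qed

lemma Kdet_box_expansion:
  fixes z :: "nat \<Rightarrow> 'a :: comm_ring_1"
  assumes n: "n \<ge> 1" and l: "l \<in> par n"
    and g: "\<And>i. i \<in> {1..n} \<Longrightarrow> (1 - x * z i) * \<gamma> i = 1"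
  shows "\<exists>R. (\<Prod>i=1..n. (1 - z i) * \<gamma> i) * Kdet n z l =
    (\<Sum>\<nu>\<in>box n (l 1 + d). strip_kernel n x l \<nu> * Kdet n z \<nu>) + strip_wt x (Suc d) * R"
proof -
  have u: "strip_bound d l j \<le> l (j - 1)" if "1 \<le> j" "j \<le> n" "j \<noteq> 1" for j
    using that by (simp add: strip_bound_def)
  have "(\<Sum>\<nu>\<in>funs_default 0 {1..n} (\<lambda>j. {l j..strip_bound d l j}). (\<Prod>j=1..n. strip_wt x (\<nu> j - l j)) * Kdet n z \<nu>) =
    (\<Sum>\<nu>\<in>box n (l 1 + d). strip_kernel n x l \<nu> * Kdet n z \<nu>)"
  proof (rule sum_funs_default_strip_kernel[OF l])
    show "funs_default 0 {1..n} (\<lambda>j. {l j..strip_bound d l j}) \<subseteq> box n (l 1 + d)"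
    proof
      fix \<nu> assume v: "\<nu> \<in> funs_default 0 {1..n} (\<lambda>j. {l j..strip_bound d l j})"
      have "\<nu> 1 \<in> {l 1..strip_bound d l 1}" using v n by (auto simp: funs_default_def)
      then show "\<nu> \<in> box n (l 1 + d)"
        using funs_default_strip_par[OF l u v] by (simp add: box_def strip_bound_def)
    qed
    show "\<nu> \<in> par n \<and> (\<forall>j\<in>{1..n}. l j \<le> \<nu> j \<longrightarrow> (j \<noteq> 1 \<longrightarrow> \<nu> j \<le> l (j - 1)) \<longrightarrow> \<nu> j \<le> strip_bound d l j)"
      if "\<nu> \<in> box n (l 1 + d)" for \<nu> using that by (auto simp: box_def strip_bound_def)
  qed (auto simp: strip_bound_def)
  then show ?thesis using Kdet_strip_expansion[of n l x z \<gamma> d] n l g by simp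
qed

text \<open>The number of columns met by $\nu/\lambda$ when $\lambda\subseteq\nu$: each column is counted at its lowest cell,
which in row $j > 1$ lies above a cell of $\lambda$.\<close>

definition ncols :: "nat \<Rightarrow> (nat \<Rightarrow> nat) \<Rightarrow> (nat \<Rightarrow> nat) \<Rightarrow> nat" where
  "ncols n l \<nu> = (\<Sum>j=1..n. (if j = 1 then \<nu> 1 else min (l (j - 1)) (\<nu> j)) - l j)"

text \<open>\<open>ncols\<close> is a sum of lengths over rows, so the power of \<open>x\<close> is
  a product over rows. Each factor is a telescoped sum of strip weights by
  \<open>sum_strip_wt\<close>, and multiplying out runs over the horizontal strips on
  \<open>l\<close> inside \<open>\<kappa>\<close>.\<close>

lemma power_ncols:
  assumes l: "l \<in> par n" and k: "\<kappa> \<in> par n" and le: "l \<le> \<kappa>"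
  shows "x ^ ncols n l \<kappa> = (\<Sum>\<eta>\<in>interval n l \<kappa>. strip_kernel n x l \<eta>)"
proof -
  define u where "u = (\<lambda>j. if j = 1 then \<kappa> 1 else min (l (j - 1)) (\<kappa> j))"
  have lu: "l j \<le> u j" if "j \<in> {1..n}" for j
    using that le parD(2)[OF l, of "j - 1"] by (auto simp: u_def le_fun_def)
  have u: "u j \<le> l (j - 1)" if "1 \<le> j" "j \<le> n" "j \<noteq> 1" for j
    using that by (simp add: u_def)
  have uk: "u j \<le> \<kappa> j" for j by (simp add: u_def)
  have "x ^ ncols n l \<kappa> = (\<Prod>j=1..n. x ^ (u j - l j))"
    by (simp add: ncols_def u_def power_sum)
  also have "\<dots> = (\<Prod>j=1..n. \<Sum>m=l j..u j. strip_wt x (m - l j))"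
    by (intro prod.cong refl) (simp add: sum_shift_diff[OF lu] sum_strip_wt)
  also have "\<dots> = (\<Sum>\<eta>\<in>funs_default 0 {1..n} (\<lambda>j. {l j..u j}). (\<Prod>j=1..n. strip_wt x (\<eta> j - l j)))"
    by (rule prod_sum_funs_default) auto
  also have "\<dots> = (\<Sum>\<eta>\<in>funs_default 0 {1..n} (\<lambda>j. {l j..u j}). (\<Prod>j=1..n. strip_wt x (\<eta> j - l j)) * 1)"
    by simp
  also have "\<dots> = (\<Sum>\<eta>\<in>interval n l \<kappa>. strip_kernel n x l \<eta> * 1)"
  proof (rule sum_funs_default_strip_kernel[OF l])
    show "finite (interval n l \<kappa>)" by (rule finite_interval[OF k])
    show "funs_default 0 {1..n} (\<lambda>j. {l j..u j}) \<subseteq> interval n l \<kappa>"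
    proof
      fix \<eta> assume e: "\<eta> \<in> funs_default 0 {1..n} (\<lambda>j. {l j..u j})"
      have "l j \<le> \<eta> j \<and> \<eta> j \<le> \<kappa> j" for j
      proof (cases "j \<in> {1..n}")
        case True
        then have "l j \<le> \<eta> j" "\<eta> j \<le> u j" using e by (auto simp: funs_default_def)
        then show ?thesis using uk[of j] by simp
      next
        case False
        then have "l j = 0" "\<eta> j = 0" using l e by (cases "j = 0"; auto simp: par_def funs_default_def)+
        then show ?thesis by simp
      qed
      then show "\<eta> \<in> interval n l \<kappa>"
        using funs_default_strip_par[OF l u e] by (auto simp: interval_def le_fun_def)
    qed
    show "\<nu> \<in> par n \<and> (\<forall>j\<in>{1..n}. l j \<le> \<nu> j \<longrightarrow> (j \<noteq> 1 \<longrightarrow> \<nu> j \<le> l (j - 1)) \<longrightarrow> \<nu> j \<le> u j)"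
      if "\<nu> \<in> interval n l \<kappa>" for \<nu> using that by (auto simp: interval_def u_def le_fun_def)
  qed (use u in auto)
  finally show ?thesis by simp
qed

text \<open>The signed rook strip kernel is the Moebius function of containment of shapes. The sum
  is a product over rows of full sums of \<open>strip_wt 0\<close>, each of which is a power of 0;
  it survives only if every row leaves a single choice.\<close>

lemma sum_strip_kernel_0:
  assumes e: "\<eta> \<in> par n" and v: "\<nu> \<in> par n" and le: "\<eta> \<le> \<nu>"
  shows "(\<Sum>\<kappa>\<in>interval n \<eta> \<nu>. strip_kernel n (0::'a::comm_ring_1) \<kappa> \<nu>) = of_bool (\<eta> = \<nu>)"
proof -
  \<comment> \<open>The least value of \<open>\<kappa> j\<close> for which \<kappa> contains \<eta>
    in row j and \<nu>/\<kappa> is a horizontal strip in row j+1.\<close>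
  define a where "a = (\<lambda>j. max (\<eta> j) (\<nu> (Suc j)))"
  have av: "a j \<le> \<nu> j" if "j \<in> {1..n}" for j
    using that le parD(2)[OF v, of j] by (auto simp: a_def le_fun_def)
  let ?D = "funs_default 0 {1..n} (\<lambda>j. {a j..\<nu> j})"
  have sub: "?D \<subseteq> interval n \<eta> \<nu>"
  proof
    fix \<kappa> assume k: "\<kappa> \<in> ?D"
    have 1: "\<eta> j \<le> \<kappa> j \<and> \<kappa> j \<le> \<nu> j" for j
    proof (cases "j \<in> {1..n}")
      case True
      then show ?thesis using k by (auto simp: funs_default_def a_def)
    next
      case False
      then have "\<eta> j = 0" "\<kappa> j = 0" using e k by (cases "j = 0"; auto simp: par_def funs_default_def)+
      then show ?thesis by simp
    qed
    have 2: "\<kappa> (Suc j) \<le> \<kappa> j" if "j \<ge> 1" for j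
    proof (cases "Suc j \<le> n")
      case True
      then have "\<nu> (Suc j) \<le> \<kappa> j" using k that by (auto simp: funs_default_def a_def)
      then show ?thesis using 1[of "Suc j"] by simp
    qed (use k in \<open>auto simp: funs_default_def\<close>)
    show "\<kappa> \<in> interval n \<eta> \<nu>"
      using 1 2 k by (auto simp: interval_def par_def le_fun_def funs_default_def)
  qed
  have "(\<Sum>\<kappa>\<in>interval n \<eta> \<nu>. strip_kernel n (0::'a) \<kappa> \<nu>) = (\<Sum>\<kappa>\<in>?D. strip_kernel n (0::'a) \<kappa> \<nu>)"
  proof (rule sum.mono_neutral_right[OF finite_interval[OF v] sub], safe)
    fix \<kappa> assume k: "\<kappa> \<in> interval n \<eta> \<nu>" "\<kappa> \<notin> ?D"
    then have "\<kappa> i = 0" if "i \<notin> {1..n}" for i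
      using that by (cases "i = 0") (auto simp: interval_def par_def)
    then obtain j where j: "j \<in> {1..n}" "\<kappa> j < a j"
      using k by (fastforce simp: funs_default_def interval_def le_fun_def)
    moreover have "\<eta> j \<le> \<kappa> j" using k by (auto simp: interval_def le_fun_def)
    ultimately have lt: "\<kappa> j < \<nu> (Suc j)" by (auto simp: a_def)
    then have "Suc j \<le> n" using parD(3)[OF v, of "Suc j"] by (metis not_less_zero not_le)
    then show "strip_kernel n 0 \<kappa> \<nu> = 0"
      using lt j by (intro strip_kernel_eq_0[of "Suc j"]) auto
  qed
  also have "\<dots> = (\<Sum>\<kappa>\<in>?D. \<Prod>j=1..n. strip_wt (0::'a) (\<nu> j - \<kappa> j))"
  proof (intro sum.cong refl)
    fix \<kappa> assume k: "\<kappa> \<in> ?D"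
    have "\<kappa> j \<le> \<nu> j \<and> (j \<noteq> 1 \<longrightarrow> \<nu> j \<le> \<kappa> (j - 1))" if "j \<in> {1..n}" for j
    proof -
      have "a (j - 1) \<le> \<kappa> (j - 1)" if "j \<noteq> 1"
      proof -
        have "j - 1 \<in> {1..n}" using \<open>j \<in> {1..n}\<close> that by auto
        then show ?thesis using k by (auto simp: funs_default_def)
      qed
      then show ?thesis using k that by (auto simp: funs_default_def a_def)
    qed
    then show "strip_kernel n (0::'a) \<kappa> \<nu> = (\<Prod>j=1..n. strip_wt (0::'a) (\<nu> j - \<kappa> j))"
      unfolding strip_kernel_def by (intro prod.cong) auto
  qed
  also have "\<dots> = (\<Prod>j=1..n. \<Sum>m=a j..\<nu> j. strip_wt (0::'a) (\<nu> j - m))"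
    by (rule prod_sum_funs_default[symmetric]) auto
  also have "\<dots> = (\<Prod>j=1..n. 0 ^ (\<nu> j - a j))"
    by (intro prod.cong refl) (simp add: sum_shift_diff_up[OF av] sum_strip_wt)
  also have "\<dots> = of_bool (\<eta> = \<nu>)"
  proof (cases "\<eta> = \<nu>")
    case True
    then have "a j = \<nu> j" if "j \<in> {1..n}" for j using av[OF that] by (simp add: a_def)
    then show ?thesis using True by simp
  next
    case False
    have "\<exists>j\<in>{1..n}. a j < \<nu> j"
    proof (rule ccontr)
      assume "\<not> (\<exists>j\<in>{1..n}. a j < \<nu> j)"
      then have eq: "a j = \<nu> j" if "j \<in> {1..n}" for j using av[OF that] that by force
      \<comment> \<open>Induction from row \<open>n\<close> down: if \<eta> and \<nu> agree in row
        j+1, then \<nu>(j+1) = \<eta>(j+1) \<le> \<eta> j, so \<open>a j\<close> is \<eta> j and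
        equality with \<nu> j follows.\<close>
      have "\<forall>i. n - i \<ge> 1 \<longrightarrow> \<eta> (n - i) = \<nu> (n - i)"
      proof
        fix i show "n - i \<ge> 1 \<longrightarrow> \<eta> (n - i) = \<nu> (n - i)"
        proof (induction i)
          case 0
          show ?case using eq[of n] parD(3)[OF v, of "Suc n"] by (auto simp: a_def)
        next
          case (Suc i)
          show ?case
          proof
            assume A: "1 \<le> n - Suc i"
            then have s: "Suc (n - Suc i) = n - i" by auto
            have ge: "\<nu> (n - i) \<le> \<eta> (n - Suc i)"
              using Suc A par_antimono[OF e, of "n - Suc i" "n - i"] by auto
            show "\<eta> (n - Suc i) = \<nu> (n - Suc i)"
              using eq[of "n - Suc i"] A ge by (simp add: a_def s)
          qed
        qed
      qed
      then have "\<eta> j = \<nu> j" if "j \<in> {1..n}" for j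
        using that by (metis diff_diff_cancel atLeastAtMost_iff)
      moreover have "\<eta> j = \<nu> j" if "j \<notin> {1..n}" for j
        using that e v by (cases "j = 0") (auto simp: par_def)
      ultimately show False using False by (auto simp: fun_eq_iff)
    qed
    then obtain j where "j \<in> {1..n}" "(0::'a) ^ (\<nu> j - a j) = 0" by (auto simp: power_0_left)
    then have "(\<Prod>j=1..n. (0::'a) ^ (\<nu> j - a j)) = 0" by (intro prod_zero) auto
    then show ?thesis using False by simp
  qed
  finally show ?thesis .
qed

text \<open>Moebius inversion of \<open>power_ncols\<close>. It moves the dependence on
  \<open>x\<close> into the power with exponent \<open>ncols n l \<kappa>\<close> alone, so that the
  coefficient of x^k selects the \<kappa> for which \<kappa>/l meets k columns.\<close>

lemma strip_kernel_eq_sum: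
  assumes l: "l \<in> par n" and v: "\<nu> \<in> par n"
  shows "strip_kernel n (x::'a::comm_ring_1) l \<nu> = (\<Sum>\<kappa>\<in>interval n l \<nu>. x ^ ncols n l \<kappa> * strip_kernel n 0 \<kappa> \<nu>)"
proof (cases "l \<le> \<nu>")
  case True
  have "(\<Sum>\<kappa>\<in>interval n l \<nu>. x ^ ncols n l \<kappa> * strip_kernel n 0 \<kappa> \<nu>) =
      (\<Sum>\<kappa>\<in>interval n l \<nu>. \<Sum>\<eta>\<in>{\<eta>\<in>interval n l \<nu>. \<eta> \<le> \<kappa>}. strip_kernel n x l \<eta> * strip_kernel n 0 \<kappa> \<nu>)"
  proof (intro sum.cong refl)
    fix \<kappa> assume k: "\<kappa> \<in> interval n l \<nu>"
    then have "interval n l \<kappa> = {\<eta>\<in>interval n l \<nu>. \<eta> \<le> \<kappa>}" by (auto simp: interval_def)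
    then show "x ^ ncols n l \<kappa> * strip_kernel n 0 \<kappa> \<nu> =
        (\<Sum>\<eta>\<in>{\<eta>\<in>interval n l \<nu>. \<eta> \<le> \<kappa>}. strip_kernel n x l \<eta> * strip_kernel n 0 \<kappa> \<nu>)"
      using power_ncols[OF l, of \<kappa> x] k by (simp add: sum_distrib_right interval_def)
  qed
  also have "\<dots> = (\<Sum>\<eta>\<in>interval n l \<nu>. \<Sum>\<kappa>\<in>{\<kappa>\<in>interval n l \<nu>. \<eta> \<le> \<kappa>}. strip_kernel n x l \<eta> * strip_kernel n 0 \<kappa> \<nu>)"
    by (rule sum.swap_restrict) (simp_all add: finite_interval[OF v])
  also have "\<dots> = (\<Sum>\<eta>\<in>interval n l \<nu>. strip_kernel n x l \<eta> * of_bool (\<eta> = \<nu>))"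
  proof (intro sum.cong refl)
    fix \<eta> assume e: "\<eta> \<in> interval n l \<nu>"
    then have "{\<kappa>\<in>interval n l \<nu>. \<eta> \<le> \<kappa>} = interval n \<eta> \<nu>" by (auto simp: interval_def)
    then show "(\<Sum>\<kappa>\<in>{\<kappa>\<in>interval n l \<nu>. \<eta> \<le> \<kappa>}. strip_kernel n x l \<eta> * strip_kernel n 0 \<kappa> \<nu>) =
        strip_kernel n x l \<eta> * of_bool (\<eta> = \<nu>)"
      using sum_strip_kernel_0[of \<eta> n \<nu>, where ?'a = 'a] e v by (simp add: sum_distrib_left[symmetric] interval_def)
  qed
  also have "\<dots> = strip_kernel n x l \<nu>"
    using True v finite_interval[OF v, of l] by (simp add: if_distrib[of "times _"] of_bool_def sum.delta' interval_def cong: if_cong)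
  finally show ?thesis by simp
next
  case False
  then obtain j where "\<not> l j \<le> \<nu> j" by (auto simp: le_fun_def)
  moreover from this have "j \<in> {1..n}" using l by (cases "j = 0") (auto simp: par_def simp flip: not_less)
  ultimately have "strip_kernel n x l \<nu> = 0" by (intro strip_kernel_eq_0) auto
  moreover have "interval n l \<nu> = {}" using False by (auto simp: interval_def)
  ultimately show ?thesis by simp
qed

section \<open>Multiplication of alternants by complete symmetric polynomials\<close>

definition complete_sym :: "nat \<Rightarrow> (nat \<Rightarrow> 'a) \<Rightarrow> nat \<Rightarrow> 'a :: comm_ring_1" where
  "complete_sym n z k = fps_nth (\<Prod>i=1..n. Abs_fps (\<lambda>m. z i ^ m)) k"

lemma fps_const_sum: "fps_const (sum f A) = (\<Sum>x\<in>A. fps_const (f x :: 'a :: comm_ring_1))"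
  by (induction A rule: infinite_finite_induct) (auto simp flip: fps_const_add)

lemma fps_const_prod: "fps_const (prod f A) = (\<Prod>x\<in>A. fps_const (f x :: 'a :: comm_ring_1))"
  by (induction A rule: infinite_finite_induct) (auto simp flip: fps_const_mult)

lemma fps_const_of_int: "fps_const (of_int k :: 'a :: comm_ring_1) = of_int k"
  by (simp add: fps_of_int)

lemma Kdet_fps_const: "Kdet n (\<lambda>i. fps_const (z i)) \<alpha> = fps_const (Kdet n z \<alpha> :: 'a :: comm_ring_1)"
  by (simp add: Kdet_def rows_det_def altsum_def alt_entry_def fps_const_sum fps_const_prod
     fps_const_of_int flip: fps_const_mult fps_const_power fps_const_sub)

text \<open>Multiplied by $\prod (1-z_i)$ the two sides expand over horizontal strips and rook strips,
where the kernel identity applies; the factor is then cancelled.\<close>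

lemma pieri:
  fixes z :: "nat \<Rightarrow> 'a :: idom"
  assumes n: "n \<ge> 1" and l: "l \<in> par n" and z: "\<And>i. i \<in> {1..n} \<Longrightarrow> z i \<noteq> 1"
  shows "complete_sym n z k * Kdet n z l =
    (\<Sum>\<kappa>\<in>{\<kappa>\<in>par n. l \<le> \<kappa> \<and> ncols n l \<kappa> = k}. Kdet n z \<kappa>)"
proof -
  \<comment> \<open>One more than the bound l 1 + k on \<kappa> 1: a rook strip on \<kappa> can add
    one cell in row 1.\<close>
  define M where "M = l 1 + Suc k"
  let ?c = "\<Prod>i=1..n. 1 - z i"
  let ?B = "box n M"
  let ?S = "{\<kappa>\<in>par n. l \<le> \<kappa> \<and> ncols n l \<kappa> = k}"
  have bnd: "\<kappa> 1 \<le> l 1 + k" if "ncols n l \<kappa> = k" for \<kappa>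
  proof -
    have "\<kappa> 1 - l 1 \<le> ncols n l \<kappa>"
      unfolding ncols_def using member_le_sum[of 1 "{1..n}" "\<lambda>j. (if j = 1 then \<kappa> 1 else min (l (j - 1)) (\<kappa> j)) - l j"] n
      by simp
    then show ?thesis using that by simp
  qed
  have S: "?S = {\<kappa>\<in>?B. l \<le> \<kappa> \<and> ncols n l \<kappa> = k}"
    using bnd by (force simp: box_def M_def)
  have rook: "?c * Kdet n z \<kappa> = (\<Sum>\<nu>\<in>?B. of_int (strip_kernel n 0 \<kappa> \<nu>) * Kdet n z \<nu>)"
    if "\<kappa> \<in> ?S" for \<kappa>
  proof -
    from that have k: "\<kappa> \<in> par n" "\<kappa> 1 + 1 \<le> M" using bnd[of \<kappa>] by (auto simp: M_def)
    then obtain d where d: "M = \<kappa> 1 + Suc d" by (metis Suc_eq_plus1 add_Suc_right le_Suc_ex add.commute add.left_commute)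
    \<comment> \<open>At \<open>x = 0\<close> the tail is absent, since \<open>strip_wt 0\<close>
      vanishes from index 2 on; only the rook strips remain.\<close>
    obtain R where "(\<Prod>i=1..n. (1 - z i) * 1) * Kdet n z \<kappa> =
        (\<Sum>\<nu>\<in>box n (\<kappa> 1 + Suc d). strip_kernel n 0 \<kappa> \<nu> * Kdet n z \<nu>) + strip_wt 0 (Suc (Suc d)) * R"
      using Kdet_box_expansion[OF n k(1), of 0 z "\<lambda>_. 1" "Suc d"] by auto
    then show ?thesis using strip_kernel_of_int[of n 0 \<kappa>, where ?'a = 'a] by (simp add: d strip_wt_Suc)
  qed
  define \<gamma> where "\<gamma> = (\<lambda>i. Abs_fps (\<lambda>m. z i ^ m))"
  have "(1 - fps_X * fps_const (z i)) * \<gamma> i = 1" for i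
    by (rule fps_ext) (auto simp: \<gamma>_def algebra_simps fps_eq_iff power_eq_if)
  then obtain R where R: "(\<Prod>i=1..n. (1 - fps_const (z i)) * \<gamma> i) * Kdet n (\<lambda>i. fps_const (z i)) l =
        (\<Sum>\<nu>\<in>box n (l 1 + Suc k). strip_kernel n fps_X l \<nu> * Kdet n (\<lambda>i. fps_const (z i)) \<nu>) + strip_wt fps_X (Suc (Suc k)) * R"
      using Kdet_box_expansion[OF n l, of fps_X "\<lambda>i. fps_const (z i)" \<gamma> "Suc k"] by blast
  \<comment> \<open>The cutoff \<open>Suc k\<close> makes the tail divisible by X^(k+1), hence
    invisible in the coefficient of X^k.\<close>
  have X: "fps_nth (strip_wt fps_X (Suc (Suc k)) * R) k = 0"
    by (simp add: strip_wt_Suc mult.assoc fps_X_power_mult_nth del: power_Suc)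
  have hk: "fps_nth (strip_kernel n fps_X l \<nu>) k = (\<Sum>\<kappa>\<in>?S. of_int (strip_kernel n 0 \<kappa> \<nu>) :: 'a)"
    if v: "\<nu> \<in> ?B" for \<nu>
  proof -
    from v have v': "\<nu> \<in> par n" by (simp add: box_def)
    have "fps_nth (strip_kernel n fps_X l \<nu>) k =
        (\<Sum>\<kappa>\<in>interval n l \<nu>. fps_nth (fps_X ^ ncols n l \<kappa> * of_int (strip_kernel n 0 \<kappa> \<nu>)) k :: 'a)"
      using strip_kernel_eq_sum[OF l v', of "fps_X :: 'a fps"] strip_kernel_of_int[of n 0, where ?'a = "'a fps"]
      by (simp add: fps_sum_nth)
    also have "\<dots> = (\<Sum>\<kappa>\<in>interval n l \<nu>. if ncols n l \<kappa> = k then of_int (strip_kernel n 0 \<kappa> \<nu>) else 0)"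
    proof (intro sum.cong refl)
      fix \<kappa> assume "\<kappa> \<in> interval n l \<nu>"
      have "(of_int (strip_kernel n 0 \<kappa> \<nu>) :: 'a fps) = fps_const (of_int (strip_kernel n 0 \<kappa> \<nu>))"
        by (rule fps_const_of_int[symmetric])
      then show "fps_nth (fps_X ^ ncols n l \<kappa> * of_int (strip_kernel n 0 \<kappa> \<nu>)) k =
          (if ncols n l \<kappa> = k then of_int (strip_kernel n 0 \<kappa> \<nu>) else (0::'a))"
        by (simp only:) (auto simp: fps_X_power_mult_nth simp del: fps_of_int)
    qed
    also have "\<dots> = (\<Sum>\<kappa>\<in>{\<kappa>\<in>interval n l \<nu>. ncols n l \<kappa> = k}. of_int (strip_kernel n 0 \<kappa> \<nu>))"
      by (simp add: sum.inter_filter finite_interval[OF v'])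
    also have "\<dots> = (\<Sum>\<kappa>\<in>?S. of_int (strip_kernel n 0 \<kappa> \<nu>))"
    proof (rule sum.mono_neutral_left)
      show "finite ?S" unfolding S by simp
      show "{\<kappa>\<in>interval n l \<nu>. ncols n l \<kappa> = k} \<subseteq> ?S" by (auto simp: interval_def)
      show "\<forall>\<kappa>\<in>?S - {\<kappa>\<in>interval n l \<nu>. ncols n l \<kappa> = k}. of_int (strip_kernel n 0 \<kappa> \<nu>) = (0::'a)"
      proof
        fix \<kappa> assume k: "\<kappa> \<in> ?S - {\<kappa>\<in>interval n l \<nu>. ncols n l \<kappa> = k}"
        then obtain j where j: "\<not> \<kappa> j \<le> \<nu> j" by (auto simp: interval_def le_fun_def)
        then have "j \<in> {1..n}" using k by (cases "j = 0") (auto simp: par_def simp flip: not_less)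
        then show "of_int (strip_kernel n 0 \<kappa> \<nu>) = (0::'a)" using j strip_kernel_eq_0[of j n \<kappa> \<nu> "0::int"] by auto
      qed
    qed
    finally show ?thesis .
  qed
  have "?c * (complete_sym n z k * Kdet n z l) =
      fps_nth ((\<Prod>i=1..n. (1 - fps_const (z i)) * \<gamma> i) * Kdet n (\<lambda>i. fps_const (z i)) l) k"
  proof -
    have "fps_const ?c = (\<Prod>i=1..n. 1 - fps_const (z i))"
      unfolding fps_const_prod by (intro prod.cong refl) (metis fps_const_1_eq_1 fps_const_sub)
    then have "(\<Prod>i=1..n. (1 - fps_const (z i)) * \<gamma> i) = fps_const ?c * (\<Prod>i=1..n. \<gamma> i)"
      by (simp only: prod.distrib)
    then have "fps_nth ((\<Prod>i=1..n. (1 - fps_const (z i)) * \<gamma> i) * Kdet n (\<lambda>i. fps_const (z i)) l) k =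
        fps_nth (fps_const ?c * ((\<Prod>i=1..n. \<gamma> i) * fps_const (Kdet n z l))) k"
      by (simp only: Kdet_fps_const mult.assoc)
    also have "\<dots> = ?c * (complete_sym n z k * Kdet n z l)"
      by (simp only: complete_sym_def \<gamma>_def fps_mult_left_const_nth fps_mult_right_const_nth)
    finally show ?thesis by simp
  qed
  also have "\<dots> = (\<Sum>\<nu>\<in>?B. fps_nth (strip_kernel n fps_X l \<nu>) k * Kdet n z \<nu>)"
    unfolding R fps_add_nth X by (simp add: fps_sum_nth Kdet_fps_const M_def)
  also have "\<dots> = (\<Sum>\<nu>\<in>?B. \<Sum>\<kappa>\<in>?S. of_int (strip_kernel n 0 \<kappa> \<nu>) * Kdet n z \<nu>)"
    by (intro sum.cong refl) (simp add: hk sum_distrib_right)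
  also have "\<dots> = (\<Sum>\<kappa>\<in>?S. \<Sum>\<nu>\<in>?B. of_int (strip_kernel n 0 \<kappa> \<nu>) * Kdet n z \<nu>)"
    by (rule sum.swap)
  also have "\<dots> = (\<Sum>\<kappa>\<in>?S. ?c * Kdet n z \<kappa>)"
    by (intro sum.cong refl) (simp add: rook)
  also have "\<dots> = ?c * (\<Sum>\<kappa>\<in>?S. Kdet n z \<kappa>)"
    by (simp add: sum_distrib_left)
  finally have "?c * (complete_sym n z k * Kdet n z l) = ?c * (\<Sum>\<kappa>\<in>?S. Kdet n z \<kappa>)" .
  moreover have "?c \<noteq> 0" using z by auto
  ultimately show ?thesis by simp
qed

section \<open>Set-valued tableaux as interlacing patterns\<close>

type_synonym pattern = "(nat \<Rightarrow> nat \<Rightarrow> nat) \<times> (nat \<Rightarrow> nat \<Rightarrow> nat)"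

text \<open>A set-valued tableau with letters at most $n$ is encoded by the shapes \<open>\<rho> k\<close> of the cells whose
least letter is at most \<open>k\<close>, and by indicators \<open>\<epsilon> k r\<close> telling whether \<open>k\<close> occurs in row \<open>r\<close> without being
the least letter of its cell. That cell can only be the one in column \<open>\<rho> (k - 1) r\<close>, and it must have
no cell of \<open>\<rho> k\<close> above it.\<close>

definition pat :: "nat \<Rightarrow> (nat \<Rightarrow> nat) \<Rightarrow> pattern set" where
  "pat n \<mu> = {(\<rho>, \<epsilon>). \<rho> 0 = (\<lambda>_. 0) \<and> \<rho> n = \<mu> \<and> (\<forall>k>n. \<rho> k = (\<lambda>_. 0)) \<and> (\<forall>k. \<rho> k 0 = 0) \<and>
     (\<forall>k<n. \<forall>r\<ge>1. \<rho> (Suc k) (Suc r) \<le> \<rho> k r \<and> \<rho> k r \<le> \<rho> (Suc k) r) \<and>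
     (\<forall>k r. \<epsilon> k r \<le> of_bool (1 \<le> k \<and> k \<le> n \<and> 1 \<le> r \<and> \<rho> k (Suc r) < \<rho> (k - 1) r))}"

lemma patD:
  assumes "(\<rho>, \<epsilon>) \<in> pat n \<mu>"
  shows "\<rho> 0 r = 0" "\<rho> n = \<mu>" "k > n \<Longrightarrow> \<rho> k r = 0" "\<rho> k 0 = 0"
    "k < n \<Longrightarrow> r \<ge> 1 \<Longrightarrow> \<rho> (Suc k) (Suc r) \<le> \<rho> k r"
    "k < n \<Longrightarrow> r \<ge> 1 \<Longrightarrow> \<rho> k r \<le> \<rho> (Suc k) r"
    "\<epsilon> k r \<le> of_bool (1 \<le> k \<and> k \<le> n \<and> 1 \<le> r \<and> \<rho> k (Suc r) < \<rho> (k - 1) r)"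
  using assms by (auto simp: pat_def)

lemma pat_row_0:
  assumes D: "(\<rho>, \<epsilon>) \<in> pat n \<mu>"
  shows "k < r \<Longrightarrow> \<rho> k r = 0"
proof (induction k arbitrary: r)
  case 0
  then show ?case using patD(1)[OF D] by simp
next
  case (Suc k)
  show ?case
  proof (cases "k < n")
    case True
    obtain r' where r: "r = Suc r'" "r' > k" using Suc.prems by (cases r) auto
    have "\<rho> (Suc k) (Suc r') \<le> \<rho> k r'" using patD(5)[OF D True, of r'] r by simp
    then show ?thesis using Suc.IH[of r'] r by simp
  qed (use patD(3)[OF D] in auto)
qed

lemma pat_mono: "(\<rho>, \<epsilon>) \<in> pat n \<mu> \<Longrightarrow> k < n \<Longrightarrow> \<rho> k r \<le> \<rho> (Suc k) r"
  using patD(4)[of \<rho> \<epsilon> n \<mu>] patD(6)[of \<rho> \<epsilon> n \<mu> k r] by (cases "r = 0") auto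

lemma pat_eps_0:
  assumes D: "(\<rho>, \<epsilon>) \<in> pat n \<mu>" and "k = 0 \<or> k > n \<or> r = 0 \<or> r \<ge> n \<or> r \<ge> k"
  shows "\<epsilon> k r = 0"
proof -
  have "\<rho> (k - 1) r = 0" if "1 \<le> k" "k \<le> n" "r \<ge> n \<or> r \<ge> k"
    using that pat_row_0[OF D, of "k - 1" r] by auto
  then show ?thesis using patD(7)[OF D, of k r] assms(2) by (auto simp: of_bool_def not_le split: if_splits)
qed

lemma pat_le_shape:
  assumes D: "(\<rho>, \<epsilon>) \<in> pat n \<mu>" and "k \<le> n"
  shows "\<rho> k r \<le> \<mu> r"
  using assms(2)
proof (induction k rule: inc_induct)
  case base
  then show ?case using patD(2)[OF D] by simp
next
  case (step k)
  then show ?case using pat_mono[OF D, of k r] by simp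
qed

lemma finite_pat: "finite (pat n \<mu>)"
proof -
  define M where "M = (\<Sum>r=0..n. \<mu> r) + 1"
  let ?F = "{f. \<forall>x. (x \<in> {..n} \<times> {..n} \<longrightarrow> f x \<in> {..M}) \<and> (x \<notin> {..n} \<times> {..n} \<longrightarrow> f x = (0::nat))}"
  have fin: "finite ?F" by (rule finite_set_of_finite_funs) auto
  let ?\<iota> = "\<lambda>(\<rho>, \<epsilon>). (\<lambda>(k, r). \<rho> k r, \<lambda>(k, r). \<epsilon> k r)"
  have "inj ?\<iota>" by (auto simp: inj_def fun_eq_iff)
  then have inj: "inj_on ?\<iota> (pat n \<mu>)" by (rule inj_on_subset) simp
  have sub: "?\<iota> ` pat n \<mu> \<subseteq> ?F \<times> ?F"
  proof (rule image_subsetI)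
    fix D assume "D \<in> pat n \<mu>"
    then obtain \<rho> \<epsilon> where De: "D = (\<rho>, \<epsilon>)" and D: "(\<rho>, \<epsilon>) \<in> pat n \<mu>" by (cases D) auto
    have m: "\<mu> r \<le> M" if "r \<le> n" for r
      using member_le_sum[of r "{0..n}" \<mu>] that by (simp add: M_def)
    have e: "\<epsilon> k r \<le> 1" for k r
      using patD(7)[OF D, of k r] by (auto simp: of_bool_def split: if_splits)
    have e': "\<epsilon> k r \<le> M" for k r using e[of k r] by (simp add: M_def)
    have r: "\<rho> k r \<le> M" if "k \<le> n" "r \<le> n" for k r
      using pat_le_shape[OF D, of k r] m[of r] that by auto
    have r0: "\<rho> k r = 0" if "\<not> (k \<le> n \<and> r \<le> n)" for k r
      using that pat_row_0[OF D, of k r] patD(3)[OF D] by (cases "k > n") auto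
    have e0: "\<epsilon> k r = 0" if "\<not> (k \<le> n \<and> r \<le> n)" for k r
      using that pat_eps_0[OF D, of k r] by auto
    show "?\<iota> D \<in> ?F \<times> ?F" using r r0 e' e0 by (auto simp: De)
  qed
  show ?thesis
    by (rule finite_imageD[OF finite_subset[OF sub] inj]) (rule finite_cartesian_product[OF fin fin])
qed

definition pat_term :: "pattern \<Rightarrow> (nat \<Rightarrow> 'a) \<Rightarrow> nat \<Rightarrow> nat \<Rightarrow> 'a :: comm_ring_1" where
  "pat_term D z k r = z k ^ (fst D k r - fst D (k - 1) r) * (- z k) ^ snd D k r"

definition pat_monomial :: "nat \<Rightarrow> pattern \<Rightarrow> (nat \<Rightarrow> 'a) \<Rightarrow> 'a :: comm_ring_1" where
  "pat_monomial n D z = (\<Prod>k=1..n. \<Prod>r=1..n. pat_term D z k r)"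

section \<open>Classes of patterns that differ only in the letters i and i+1\<close>

text \<open>Equal erasures mean that the patterns differ at most in \<rho> i, \<epsilon> i and
  \<epsilon> (i+1), and only from row q on. The fibres of \<open>erase i q\<close> are the classes
  whose signed sums are computed.\<close>

definition erase :: "nat \<Rightarrow> nat \<Rightarrow> pattern \<Rightarrow> pattern" where
  "erase i q D = (\<lambda>k r. if k = i \<and> q \<le> r then 0 else fst D k r,
                  \<lambda>k r. if (k = i \<or> k = Suc i) \<and> q \<le> r then 0 else snd D k r)"

text \<open>With all shapes but \<open>\<rho> i\<close> fixed (\<open>\<tau>\<close> is \<open>\<rho> (i - 1)\<close> and \<open>\<sigma>\<close> is \<open>\<rho> (i + 1)\<close>), a bundle \<open>(t, e, f)\<close> consists of
\<open>t = \<rho> i s\<close> and of the two indicators whose admissibility depends on \<open>t\<close>, namely \<open>e = \<epsilon> i (s - 1)\<close> and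
\<open>f = \<epsilon> (i + 1) s\<close>. Bundles of different rows are independent, so the sum over a class of patterns is a
product over rows. Only rows from \<open>q\<close> on vary; \<open>c\<close> is the fixed value of \<open>\<epsilon> i (q - 1)\<close>, and \<open>e = 0\<close> is a
placeholder in row \<open>q\<close>.\<close>

definition bundles :: "nat \<Rightarrow> nat \<Rightarrow> (nat \<Rightarrow> nat) \<Rightarrow> (nat \<Rightarrow> nat) \<Rightarrow> nat \<Rightarrow> (nat \<times> nat \<times> nat) set" where
  "bundles q c \<tau> \<sigma> s = {(t, e, f). \<tau> s \<le> t \<and> \<sigma> (Suc s) \<le> t \<and> t \<le> \<sigma> s \<and> (1 < s \<longrightarrow> t \<le> \<tau> (s - 1)) \<and>
     (if s = q then e = 0 \<and> (c = 1 \<longrightarrow> t < \<tau> (s - 1)) else e \<le> of_bool (t < \<tau> (s - 1))) \<and>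
     f \<le> of_bool (\<sigma> (Suc s) < t)}"

definition bundle_wt :: "(nat \<Rightarrow> nat) \<Rightarrow> (nat \<Rightarrow> nat) \<Rightarrow> 'a \<Rightarrow> 'a \<Rightarrow> nat \<Rightarrow> nat \<times> nat \<times> nat \<Rightarrow> 'a :: comm_ring_1" where
  "bundle_wt \<tau> \<sigma> x y s = (\<lambda>(t, e, f). x ^ (t - \<tau> s) * y ^ (\<sigma> s - t) * (- x) ^ e * (- y) ^ f)"

lemma finite_bundles: "finite (bundles q c \<tau> \<sigma> s)"
proof (rule finite_subset)
  show "bundles q c \<tau> \<sigma> s \<subseteq> {..\<sigma> s} \<times> {..1} \<times> {..1}"
    by (auto simp: bundles_def of_bool_def split: if_splits)
qed auto

text \<open>The indicator e of the bundle of row s+1 becomes \<epsilon> i s, because its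
  admissibility compares \<rho> i (s+1) with \<rho> (i-1) s. Row n gets 0, having no bundle after
  it.\<close>

definition build :: "nat \<Rightarrow> nat \<Rightarrow> nat \<Rightarrow> pattern \<Rightarrow> (nat \<Rightarrow> nat \<times> nat \<times> nat) \<Rightarrow> pattern" where
  "build n i q D b =
    (\<lambda>k s. if k = i \<and> q \<le> s then fst (b s) else fst D k s,
     \<lambda>k s. if k = i \<and> q \<le> s then (if s < n then fst (snd (b (Suc s))) else 0)
           else if k = Suc i \<and> q \<le> s then snd (snd (b s)) else snd D k s)"

definition unbuild :: "nat \<Rightarrow> nat \<Rightarrow> nat \<Rightarrow> pattern \<Rightarrow> (nat \<Rightarrow> nat \<times> nat \<times> nat)" where
  "unbuild n i q D = (\<lambda>s. if s \<in> {q..n}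
     then (fst D i s, if s = q then 0 else snd D i (s - 1), snd D (Suc i) s) else (0, 0, 0))"

text \<open>Each condition of \<open>pat\<close> on the varying entries involves \<rho> i in one row
  only. Grouping the conditions by that row gives membership in \<open>bundles\<close>,
  independently for each row.\<close>

lemma bij_betw_build:
  assumes D0: "(\<rho>0, \<epsilon>0) \<in> pat n \<mu>" and i: "1 \<le> i" "i < n" and q: "1 \<le> q" "q \<le> n"
  shows "bij_betw (build n i q (\<rho>0, \<epsilon>0))
     (funs_default (0, 0, 0) {q..n} (bundles q (\<epsilon>0 i (q - 1)) (\<rho>0 (i - 1)) (\<rho>0 (Suc i))))
     {D \<in> pat n \<mu>. erase i q D = erase i q (\<rho>0, \<epsilon>0)}"
proof -
  define \<tau> where "\<tau> = \<rho>0 (i - 1)"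
  define \<sigma> where "\<sigma> = \<rho>0 (Suc i)"
  define c where "c = \<epsilon>0 i (q - 1)"
  let ?S = "funs_default (0, 0, 0) {q..n} (bundles q c \<tau> \<sigma>)"
  let ?C = "{D \<in> pat n \<mu>. erase i q D = erase i q (\<rho>0, \<epsilon>0)}"
  have s0: "\<sigma> s = 0" "\<tau> s = 0" if "s > n" for s
    using pat_row_0[OF D0] that i by (auto simp: \<sigma>_def \<tau>_def)
  have "\<tau> n = 0" using pat_row_0[OF D0] i by (auto simp: \<tau>_def)
  have into: "build n i q (\<rho>0, \<epsilon>0) b \<in> ?C" if b: "b \<in> ?S" for b
  proof -
    have bs: "b s \<in> bundles q c \<tau> \<sigma> s" if "q \<le> s" "s \<le> n" for s using b that by (auto simp: funs_default_def)
    have b0: "b s = (0, 0, 0)" if "\<not> (q \<le> s \<and> s \<le> n)" for s using b that by (auto simp: funs_default_def)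
    define \<rho> where "\<rho> = fst (build n i q (\<rho>0, \<epsilon>0) b)"
    define \<epsilon> where "\<epsilon> = snd (build n i q (\<rho>0, \<epsilon>0) b)"
    have re: "build n i q (\<rho>0, \<epsilon>0) b = (\<rho>, \<epsilon>)" by (simp add: \<rho>_def \<epsilon>_def)
    have r1: "\<rho> k s = \<rho>0 k s" if "k \<noteq> i \<or> s < q" for k s
      using that by (auto simp: \<rho>_def \<epsilon>_def build_def)
    have r2: "\<rho> i s = fst (b s)" if "q \<le> s" for s
      using that by (auto simp: \<rho>_def \<epsilon>_def build_def)
    have e1: "\<epsilon> k s = \<epsilon>0 k s" if "(k \<noteq> i \<and> k \<noteq> Suc i) \<or> s < q" for k s
      using that by (auto simp: \<rho>_def \<epsilon>_def build_def)
    have e2: "\<epsilon> i s = (if s < n then fst (snd (b (Suc s))) else 0)" if "q \<le> s" for s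
      using that by (auto simp: \<rho>_def \<epsilon>_def build_def)
    have e3: "\<epsilon> (Suc i) s = snd (snd (b s))" if "q \<le> s" for s
      using that by (auto simp: \<rho>_def \<epsilon>_def build_def)
    have tlo: "\<tau> s \<le> \<rho> i s \<and> \<sigma> (Suc s) \<le> \<rho> i s \<and> \<rho> i s \<le> \<sigma> s" if "s \<ge> 1" for s
    proof (cases "q \<le> s")
      case True
      show ?thesis
      proof (cases "s \<le> n")
        case True
        then show ?thesis using bs[of s] r2[of s] \<open>q \<le> s\<close> by (auto simp: bundles_def split: prod.splits)
      next
        case False
        then show ?thesis using b0[of s] r2[of s] \<open>q \<le> s\<close> s0 by auto
      qed
    next
      case False
      then show ?thesis
        using r1[of i s] patD(5)[OF D0, of i s] patD(6)[OF D0, of i s] patD(6)[OF D0, of "i - 1" s] i that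
        by (auto simp: \<tau>_def \<sigma>_def)
    qed
    have tup: "\<rho> i (Suc s) \<le> \<tau> s" if "s \<ge> 1" for s
    proof (cases "q \<le> Suc s")
      case True
      show ?thesis
      proof (cases "Suc s \<le> n")
        case True
        then show ?thesis using bs[of "Suc s"] r2[of "Suc s"] \<open>q \<le> Suc s\<close> that
          by (auto simp: bundles_def split: prod.splits)
      next
        case False
        then show ?thesis using b0[of "Suc s"] r2[of "Suc s"] \<open>q \<le> Suc s\<close> by auto
      qed
    next
      case False
      then show ?thesis using r1[of i "Suc s"] patD(5)[OF D0, of "i - 1" s] i that by (auto simp: \<tau>_def)
    qed
    have inter: "\<rho> (Suc k) (Suc s) \<le> \<rho> k s \<and> \<rho> k s \<le> \<rho> (Suc k) s" if k: "k < n" "s \<ge> 1" for k s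
    proof -
      consider "k = i" | "Suc k = i" | "k \<noteq> i" "Suc k \<noteq> i" by blast
      then show ?thesis
      proof cases
        case 1
        then show ?thesis using tlo[OF k(2)] r1[of "Suc i"] by (simp add: \<sigma>_def)
      next
        case 2
        then have "\<rho> k s = \<tau> s" using r1[of k s] by (auto simp: \<tau>_def)
        then show ?thesis using tlo[OF k(2)] tup[OF k(2)] 2 by simp
      next
        case 3
        then show ?thesis using r1[of k] r1[of "Suc k"] patD(5,6)[OF D0] k by simp
      qed
    qed
    have eps: "\<epsilon> k s \<le> of_bool (1 \<le> k \<and> k \<le> n \<and> 1 \<le> s \<and> \<rho> k (Suc s) < \<rho> (k - 1) s)" for k s
    proof -
      have E0: "\<epsilon>0 k s \<le> of_bool (1 \<le> k \<and> k \<le> n \<and> 1 \<le> s \<and> \<rho>0 k (Suc s) < \<rho>0 (k - 1) s)"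
        by (rule patD(7)[OF D0])
      consider "k = i" "q \<le> s" | "k = i" "Suc s = q" | "k = i" "Suc s < q"
        | "k = Suc i" "q \<le> s" | "k = Suc i" "s < q" | "k \<noteq> i" "k \<noteq> Suc i" by linarith
      then show ?thesis
      proof cases
        case 1
        show ?thesis
        proof (cases "s < n")
          case True
          then have "b (Suc s) \<in> bundles q c \<tau> \<sigma> (Suc s)" using bs[of "Suc s"] 1 by auto
          then have "fst (snd (b (Suc s))) \<le> of_bool (fst (b (Suc s)) < \<tau> s)"
            using 1 by (auto simp: bundles_def split: prod.splits)
          then show ?thesis using 1 e2[of s] r2[of "Suc s"] r1[of "i - 1" s] i q True
            by (auto simp: \<tau>_def of_bool_def split: if_splits)
        next
          case False
          then show ?thesis using e2[of s] 1 by simp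
        qed
      next
        \<comment> \<open>Row q-1: \<epsilon> i (q-1) is fixed by the class, but its admissibility
          depends on the varying \<rho> i q. The clause for \<open>c = 1\<close> in
          \<open>bundles\<close> guards it.\<close>
        case 2
        show ?thesis
        proof (cases "\<epsilon>0 i s = 1")
          case True
          then have "c = 1" using 2 by (auto simp: c_def)
          moreover have "b q \<in> bundles q c \<tau> \<sigma> q" using bs[of q] q by auto
          ultimately have "fst (b q) < \<tau> (q - 1)" by (auto simp: bundles_def split: prod.splits)
          then show ?thesis using 2 r2[of "Suc s"] r1[of "i - 1" s] i q e1[of i s] E0 True
            by (auto simp: \<tau>_def of_bool_def split: if_splits)
        next
          case False
          then have "\<epsilon>0 i s = 0" using E0 2 by (auto simp: of_bool_def split: if_splits)
          then show ?thesis using e1[of i s] 2 by simp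
        qed
      next
        case 3
        then show ?thesis using E0 e1[of i s] r1[of i "Suc s"] r1[of "i - 1" s] i by auto
      next
        case 4
        show ?thesis
        proof (cases "s \<le> n")
          case True
          then have "b s \<in> bundles q c \<tau> \<sigma> s" using bs[of s] 4 by auto
          then have "snd (snd (b s)) \<le> of_bool (\<sigma> (Suc s) < fst (b s))"
            by (auto simp: bundles_def split: prod.splits)
          then show ?thesis using 4 e3[of s] r2[of s] r1[of "Suc i" "Suc s"] i q
            by (auto simp: \<sigma>_def of_bool_def split: if_splits)
        next
          case False
          then show ?thesis using e3[of s] 4 b0[of s] by simp
        qed
      next
        case 5
        then show ?thesis using E0 e1[of "Suc i" s] r1[of "Suc i" "Suc s"] r1[of i s] by simp
      next
        case 6
        then have "k - 1 \<noteq> i \<or> k = 0" by auto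
        then show ?thesis using E0 e1[of k s] r1[of k "Suc s"] r1[of "k - 1" s] 6 by auto
      qed
    qed
    have r0: "\<rho> k 0 = 0" for k using r1[of k 0] patD(4)[OF D0] q by simp
    have bd: "\<rho> 0 = (\<lambda>_. 0)" "\<rho> n = \<mu>" "\<forall>k>n. \<rho> k = (\<lambda>_. 0)"
      using r1 patD(1,2,3)[OF D0] i by (auto simp: fun_eq_iff)
    have "(\<rho>, \<epsilon>) \<in> pat n \<mu>"
      unfolding pat_def using bd r0 inter eps by blast
    moreover have "erase i q (\<rho>, \<epsilon>) = erase i q (\<rho>0, \<epsilon>0)"
      using r1 e1 by (auto simp: erase_def fun_eq_iff not_le)
    ultimately show ?thesis using re by simp
  qed
  have onto: "unbuild n i q D \<in> ?S" and inv: "build n i q (\<rho>0, \<epsilon>0) (unbuild n i q D) = D" if DC: "D \<in> ?C" for D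
  proof -
    obtain \<rho> \<epsilon> where De: "D = (\<rho>, \<epsilon>)" by force
    have D: "(\<rho>, \<epsilon>) \<in> pat n \<mu>" and er: "erase i q (\<rho>, \<epsilon>) = erase i q (\<rho>0, \<epsilon>0)"
      using DC De by auto
    have r1: "\<rho> k s = \<rho>0 k s" if "k \<noteq> i \<or> s < q" for k s
    proof -
      have "fst (erase i q (\<rho>, \<epsilon>)) k s = fst (erase i q (\<rho>0, \<epsilon>0)) k s" using er by simp
      then show ?thesis using that by (auto simp: erase_def split: if_splits)
    qed
    have e1: "\<epsilon> k s = \<epsilon>0 k s" if "(k \<noteq> i \<and> k \<noteq> Suc i) \<or> s < q" for k s
    proof -
      have "snd (erase i q (\<rho>, \<epsilon>)) k s = snd (erase i q (\<rho>0, \<epsilon>0)) k s" using er by simp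
      then show ?thesis using that by (auto simp: erase_def split: if_splits)
    qed
    have "i - 1 \<noteq> i" using i by linarith
    then have ts: "\<rho> (i - 1) s = \<tau> s" "\<rho> (Suc i) s = \<sigma> s" for s
      using r1[of "i - 1" s] r1[of "Suc i" s] i by (auto simp: \<tau>_def \<sigma>_def)
    have mem: "(\<rho> i s, if s = q then 0 else \<epsilon> i (s - 1), \<epsilon> (Suc i) s) \<in> bundles q c \<tau> \<sigma> s"
      if s: "q \<le> s" "s \<le> n" for s
    proof -
      have 1: "\<tau> s \<le> \<rho> i s" "\<sigma> (Suc s) \<le> \<rho> i s" "\<rho> i s \<le> \<sigma> s"
        using patD(5,6)[OF D, of i s] patD(6)[OF D, of "i - 1" s] i s q ts by auto
      have 2: "\<rho> i s \<le> \<tau> (s - 1)" if "1 < s"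
        using patD(5)[OF D, of "i - 1" "s - 1"] i that ts by auto
      have 3: "\<epsilon> i (s - 1) \<le> of_bool (\<rho> i s < \<tau> (s - 1))"
        using patD(7)[OF D, of i "s - 1"] ts i by (auto simp: of_bool_def split: if_splits)
      have 4: "\<epsilon> (Suc i) s \<le> of_bool (\<sigma> (Suc s) < \<rho> i s)"
        using patD(7)[OF D, of "Suc i" s] ts i by (auto simp: of_bool_def split: if_splits)
      have 5: "\<epsilon> i (q - 1) = c" using e1[of i "q - 1"] q by (simp add: c_def)
      show ?thesis unfolding bundles_def using 1 2 3 4 5 by (auto simp: of_bool_def split: if_splits)
    qed
    have "unbuild n i q D s \<in> bundles q c \<tau> \<sigma> s" if "s \<in> {q..n}" for s
      using mem[of s] that by (cases "s = q") (simp_all add: unbuild_def De)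
    then show "unbuild n i q D \<in> ?S" by (auto simp: funs_default_def) (auto simp: unbuild_def)
    have z1: "\<rho> i s = 0" if "s > n" for s using pat_row_0[OF D, of i s] i that by simp
    have z2: "\<epsilon> k s = 0" if "s \<ge> n" for k s using pat_eps_0[OF D, of k s] that by auto
    show "build n i q (\<rho>0, \<epsilon>0) (unbuild n i q D) = D"
      unfolding De build_def unbuild_def
      by (auto simp: fun_eq_iff not_le r1[symmetric] e1[symmetric] z1 z2)
  qed
  have "bij_betw (build n i q (\<rho>0, \<epsilon>0)) ?S ?C"
  proof (rule bij_betw_byWitness[where f' = "unbuild n i q"])
    show "\<forall>b\<in>?S. unbuild n i q (build n i q (\<rho>0, \<epsilon>0) b) = b"
    proof
      fix b assume b: "b \<in> ?S"
      have "b q \<in> bundles q c \<tau> \<sigma> q" using b q by (auto simp: funs_default_def)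
      then have "fst (snd (b q)) = 0" by (auto simp: bundles_def split: prod.splits)
      then show "unbuild n i q (build n i q (\<rho>0, \<epsilon>0) b) = b"
        using b by (auto simp: unbuild_def build_def fun_eq_iff funs_default_def prod_eq_iff)
    qed
  qed (use into onto inv in auto)
  then show ?thesis by (simp add: \<tau>_def \<sigma>_def c_def)
qed

lemma sum_shift_eq:
  fixes e :: "nat \<Rightarrow> nat"
  assumes "q \<le> n" "e q = 0"
  shows "(\<Sum>s=q..n. if s < n then e (Suc s) else 0) = (\<Sum>s=q..n. e s)"
proof -
  have "(\<Sum>s=q..n. if s < n then e (Suc s) else 0) = (\<Sum>s\<in>{q..<n}. e (Suc s))"
    by (rule sum.mono_neutral_cong_right) (use assms in auto)
  also have "\<dots> = (\<Sum>s\<in>{Suc q..n}. e s)"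
    using sum.shift_bounds_Suc_ivl[of e q n] by (simp add: atLeastLessThanSuc_atLeastAtMost)
  also have "\<dots> = (\<Sum>s=q..n. e s)"
    by (rule sum.mono_neutral_left) (use assms in \<open>auto simp: not_less_eq_eq le_antisym\<close>)
  finally show ?thesis .
qed

text \<open>What \<open>pat_monomial\<close> has in common for all members of a class: the letters
  other than i and i+1, and the rows below q.\<close>

definition class_factor :: "nat \<Rightarrow> nat \<Rightarrow> nat \<Rightarrow> pattern \<Rightarrow> (nat \<Rightarrow> 'a) \<Rightarrow> 'a :: comm_ring_1" where
  "class_factor n i q D z = (\<Prod>k\<in>{1..n} - {i, Suc i}. \<Prod>s=1..n. pat_term D z k s) *
     (\<Prod>s=1..<q. pat_term D z i s * pat_term D z (Suc i) s)"

lemma pat_monomial_build: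
  fixes z :: "nat \<Rightarrow> 'a :: comm_ring_1"
  assumes i: "1 \<le> i" "i < n" and q: "1 \<le> q" "q \<le> n" and b: "fst (snd (b q)) = 0"
  shows "pat_monomial n (build n i q D b) z =
    class_factor n i q D z * (\<Prod>s=q..n. bundle_wt (fst D (i - 1)) (fst D (Suc i)) (z i) (z (Suc i)) s (b s))"
proof -
  let ?B = "build n i q D b"
  have i1: "i - 1 \<noteq> i" "i - 1 \<noteq> Suc i" using i by linarith+
  have other: "pat_term ?B z k s = pat_term D z k s" if "k \<notin> {i, Suc i}" for k s
  proof -
    have "k - 1 \<noteq> i \<or> k = 0" using that by auto
    then show ?thesis using that i by (auto simp: pat_term_def build_def)
  qed
  have low: "pat_term ?B z k s = pat_term D z k s" if "s < q" for k s
    using that by (simp add: pat_term_def build_def)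
  have "pat_monomial n ?B z = (\<Prod>k\<in>{1..n} - {i, Suc i}. \<Prod>s=1..n. pat_term ?B z k s) *
      ((\<Prod>s=1..n. pat_term ?B z i s) * (\<Prod>s=1..n. pat_term ?B z (Suc i) s))"
  proof -
    have "pat_monomial n ?B z = (\<Prod>k\<in>{1..n} - {i, Suc i}. \<Prod>s=1..n. pat_term ?B z k s) *
        (\<Prod>k\<in>{i, Suc i}. \<Prod>s=1..n. pat_term ?B z k s)"
      unfolding pat_monomial_def by (rule prod.subset_diff) (use i in auto)
    then show ?thesis by simp
  qed
  also have "(\<Prod>s=1..n. pat_term ?B z i s) * (\<Prod>s=1..n. pat_term ?B z (Suc i) s) =
      (\<Prod>s=1..n. pat_term ?B z i s * pat_term ?B z (Suc i) s)" by (simp add: prod.distrib)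
  also have "\<dots> = (\<Prod>s=1..<q. pat_term ?B z i s * pat_term ?B z (Suc i) s) *
      (\<Prod>s=q..n. pat_term ?B z i s * pat_term ?B z (Suc i) s)"
  proof -
    have "{1..n} = {1..<q} \<union> {q..n}" using q by auto
    then show ?thesis by (simp add: prod.union_disjoint ivl_disj_int)
  qed
  also have "(\<Prod>s=q..n. pat_term ?B z i s * pat_term ?B z (Suc i) s) =
      (\<Prod>s=q..n. bundle_wt (fst D (i - 1)) (fst D (Suc i)) (z i) (z (Suc i)) s (b s))"
  proof -
    let ?u = "\<lambda>s. z i ^ (fst (b s) - fst D (i - 1) s) * z (Suc i) ^ (fst D (Suc i) s - fst (b s)) *
        (- z (Suc i)) ^ snd (snd (b s))"
    have "(\<Prod>s=q..n. pat_term ?B z i s * pat_term ?B z (Suc i) s) =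
        (\<Prod>s=q..n. ?u s * (- z i) ^ (if s < n then fst (snd (b (Suc s))) else 0))"
      using i1 by (intro prod.cong refl) (simp add: pat_term_def build_def mult_ac)
    also have "\<dots> = (\<Prod>s=q..n. ?u s) * (- z i) ^ (\<Sum>s=q..n. if s < n then fst (snd (b (Suc s))) else 0)"
      by (simp only: prod.distrib power_sum)
    also have "\<dots> = (\<Prod>s=q..n. ?u s * (- z i) ^ fst (snd (b s)))"
      by (simp only: sum_shift_eq[OF q(2), of "\<lambda>s. fst (snd (b s))", OF b] prod.distrib power_sum)
    also have "\<dots> = (\<Prod>s=q..n. bundle_wt (fst D (i - 1)) (fst D (Suc i)) (z i) (z (Suc i)) s (b s))"
      by (intro prod.cong refl) (simp add: bundle_wt_def case_prod_unfold mult_ac)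
    finally show ?thesis .
  qed
  also have "(\<Prod>k\<in>{1..n} - {i, Suc i}. \<Prod>s=1..n. pat_term ?B z k s) =
      (\<Prod>k\<in>{1..n} - {i, Suc i}. \<Prod>s=1..n. pat_term D z k s)"
    by (intro prod.cong refl other) auto
  also have "(\<Prod>s=1..<q. pat_term ?B z i s * pat_term ?B z (Suc i) s) = (\<Prod>s=1..<q. pat_term D z i s * pat_term D z (Suc i) s)"
    by (intro prod.cong refl) (simp add: low)
  finally show ?thesis by (simp only: class_factor_def mult.assoc)
qed

lemma bij_betw_filter:
  "bij_betw f A B \<Longrightarrow> bij_betw f {x\<in>A. P (f x)} {y\<in>B. P y}"
  by (auto simp: bij_betw_def inj_on_def)

text \<open>\<open>Q\<close> restricts the bundle of row q only, so it changes one factor of the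
  product. It becomes the violation condition in \<open>class_cancel\<close> and is trivial in
  \<open>Gpol_adjacent\<close>.\<close>

lemma class_sum:
  fixes z :: "nat \<Rightarrow> 'a :: comm_ring_1"
  assumes D0: "D0 \<in> pat n \<mu>" and i: "1 \<le> i" "i < n" and q: "1 \<le> q" "q \<le> n"
  defines "S \<equiv> bundles q (snd D0 i (q - 1)) (fst D0 (i - 1)) (fst D0 (Suc i))"
    and "W \<equiv> bundle_wt (fst D0 (i - 1)) (fst D0 (Suc i)) (z i) (z (Suc i))"
  shows "(\<Sum>D\<in>{D \<in> pat n \<mu>. erase i q D = erase i q D0 \<and> Q (fst D i q) (snd D (Suc i) q)}. pat_monomial n D z) =
    class_factor n i q D0 z * ((\<Sum>b\<in>{b\<in>S q. Q (fst b) (snd (snd b))}. W q b) *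
    (\<Prod>s=Suc q..n. \<Sum>b\<in>S s. W s b))"
proof -
  obtain \<rho>0 \<epsilon>0 where De: "D0 = (\<rho>0, \<epsilon>0)" by force
  let ?C = "{D \<in> pat n \<mu>. erase i q D = erase i q D0}"
  let ?F = "funs_default (0, 0, 0) {q..n} S"
  let ?P = "\<lambda>D :: pattern. Q (fst D i q) (snd D (Suc i) q)"
  define S' where "S' = (\<lambda>s. if s = q then {b\<in>S q. Q (fst b) (snd (snd b))} else S s)"
  have bij: "bij_betw (build n i q D0) ?F ?C"
    using bij_betw_build[of \<rho>0 \<epsilon>0 n \<mu> i q] D0 i q by (simp add: De S_def)
  have P: "?P (build n i q D0 b) \<longleftrightarrow> Q (fst (b q)) (snd (snd (b q)))" for b
    by (simp add: build_def)
  have "funs_default (0, 0, 0) {q..n} S' = {b\<in>?F. Q (fst (b q)) (snd (snd (b q)))}"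
    using q by (auto simp: funs_default_def S'_def)
  then have F': "funs_default (0, 0, 0) {q..n} S' = {b\<in>?F. ?P (build n i q D0 b)}"
    unfolding P .
  have bij': "bij_betw (build n i q D0) (funs_default (0, 0, 0) {q..n} S') {D\<in>?C. ?P D}"
    unfolding F' by (rule bij_betw_filter[OF bij])
  have z0: "fst (snd (b q)) = 0" if "b \<in> funs_default (0, 0, 0) {q..n} S'" for b
  proof -
    have "b q \<in> S q" using that q unfolding F' by (auto simp: funs_default_def)
    then show ?thesis by (auto simp: S_def bundles_def split: prod.splits)
  qed
  have fin: "finite (S s)" for s unfolding S_def by (rule finite_bundles)
  have "(\<Sum>D\<in>{D \<in> pat n \<mu>. erase i q D = erase i q D0 \<and> ?P D}. pat_monomial n D z) =
      (\<Sum>D\<in>{D\<in>?C. ?P D}. pat_monomial n D z)" by (rule sum.cong) auto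
  also have "\<dots> = (\<Sum>b\<in>funs_default (0, 0, 0) {q..n} S'. pat_monomial n (build n i q D0 b) z)"
    by (rule sum.reindex_bij_betw[OF bij', symmetric])
  also have "\<dots> = (\<Sum>b\<in>funs_default (0, 0, 0) {q..n} S'. class_factor n i q D0 z * (\<Prod>s=q..n. W s (b s)))"
    unfolding W_def by (intro sum.cong refl pat_monomial_build[OF i q] z0)
  also have "\<dots> = class_factor n i q D0 z * (\<Prod>s=q..n. \<Sum>b\<in>S' s. W s b)"
    unfolding sum_distrib_left[symmetric]
    by (subst prod_sum_funs_default[where d = "(0, 0, 0)"]) (auto simp: S'_def fin)
  also have "(\<Prod>s=q..n. \<Sum>b\<in>S' s. W s b) =
      (\<Sum>b\<in>{b\<in>S q. Q (fst b) (snd (snd b))}. W q b) * (\<Prod>s=Suc q..n. \<Sum>b\<in>S s. W s b)"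
  proof -
    have "(\<Prod>s=q..n. \<Sum>b\<in>S' s. W s b) = (\<Sum>b\<in>S' q. W q b) * (\<Prod>s=Suc q..n. \<Sum>b\<in>S' s. W s b)"
      by (rule prod.atLeast_Suc_atMost[OF q(2)])
    also have "(\<Prod>s=Suc q..n. \<Sum>b\<in>S' s. W s b) = (\<Prod>s=Suc q..n. \<Sum>b\<in>S s. W s b)"
      by (intro prod.cong refl) (auto simp: S'_def)
    finally show ?thesis by (simp add: S'_def)
  qed
  finally show ?thesis .
qed

section \<open>Symmetry of row sums in two adjacent variables\<close>

text \<open>The sum over \<rho> i s of one row, after its range is shifted to 0..m and boundary
  factors are removed. \<open>P\<close> means that the indicator e is free except at the top value
  of \<open>t\<close>, and \<open>Q\<close> that f is free except at the bottom value.\<close>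

definition trunc_sym :: "nat \<Rightarrow> bool \<Rightarrow> bool \<Rightarrow> 'a \<Rightarrow> 'a \<Rightarrow> 'a :: comm_ring_1" where
  "trunc_sym m P Q x y = (\<Sum>t=0..m. x ^ t * y ^ (m - t) *
     ((1 - x) ^ of_bool (P \<and> t < m) * (1 - y) ^ of_bool (Q \<and> 0 < t)))"

lemma trunc_sym_reflect: "trunc_sym m P Q y x = trunc_sym m Q P x y"
  unfolding trunc_sym_def
  by (rule sum.reindex_bij_witness[of _ "\<lambda>t. m - t" "\<lambda>t. m - t"]) (auto simp: mult_ac)

text \<open>Both sides are h_m - x y h_{m-1} in the variables x, y: the subtracted sums agree after
  a shift of the index.\<close>

lemma trunc_sym_eq:
  "trunc_sym m True False x y = trunc_sym m False True x (y :: 'a :: comm_ring_1)"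
proof -
  have t1: "trunc_sym m True False x y = (\<Sum>t=0..m. x ^ t * y ^ (m - t)) - (\<Sum>t=0..m. if t < m then x ^ Suc t * y ^ (m - t) else 0)"
    unfolding trunc_sym_def sum_subtractf[symmetric] by (intro sum.cong refl) (auto simp: algebra_simps)
  have t2: "trunc_sym m False True x y = (\<Sum>t=0..m. x ^ t * y ^ (m - t)) - (\<Sum>t=0..m. if 0 < t then x ^ t * y ^ Suc (m - t) else 0)"
    unfolding trunc_sym_def sum_subtractf[symmetric] by (intro sum.cong refl) (auto simp: algebra_simps)
  have "(\<Sum>t=0..m. if t < m then x ^ Suc t * y ^ (m - t) else 0) = (\<Sum>t\<in>{0..<m}. x ^ Suc t * y ^ (m - t))"
    by (rule sum.mono_neutral_cong_right) auto
  also have "\<dots> = (\<Sum>t\<in>{Suc 0..m}. x ^ t * y ^ Suc (m - t))"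
    by (rule sum.reindex_bij_witness[of _ "\<lambda>t. t - 1" Suc])
       (auto simp: Suc_diff_Suc simp flip: power_Suc)
  also have "\<dots> = (\<Sum>t=0..m. if 0 < t then x ^ t * y ^ Suc (m - t) else 0)"
    by (rule sum.mono_neutral_cong_left) auto
  finally show ?thesis using t1 t2 by simp
qed

text \<open>Reflecting t to m-t exchanges the variables and the two flags at once, so equal flags
  give symmetry directly; for different flags \<open>trunc_sym_eq\<close> exchanges the flags
  back.\<close>

lemma trunc_sym_sym: "trunc_sym m P Q x y = trunc_sym m P Q y x"
  using trunc_sym_reflect[of m P Q x y] trunc_sym_eq[of m x y] trunc_sym_reflect[of m True False x y]
    trunc_sym_reflect[of m False True x y] trunc_sym_eq[of m y x]
  by (cases P; cases Q) auto

text \<open>For s > 1, \<open>excess_len\<close> counts the columns in which row s-1 is forced to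
  have least letter i and row s least letter i+1. \<open>gap_ind\<close> tells whether the extra
  letters i and i+1 of row s-1 are admissible whatever \<rho> i is. Both concern only the border
  between rows s-1 and s.\<close>

definition excess_len :: "(nat \<Rightarrow> nat) \<Rightarrow> (nat \<Rightarrow> nat) \<Rightarrow> nat \<Rightarrow> nat" where
  "excess_len \<tau> \<sigma> s = \<sigma> s - \<tau> (s - 1)"
definition gap_ind :: "(nat \<Rightarrow> nat) \<Rightarrow> (nat \<Rightarrow> nat) \<Rightarrow> nat \<Rightarrow> nat" where
  "gap_ind \<tau> \<sigma> s = of_bool (\<sigma> s < \<tau> (s - 1))"

lemma sum_bool_le: "(\<Sum>e\<in>{e. e \<le> of_bool P}. (- x) ^ e) = (1 - x :: 'a :: comm_ring_1) ^ of_bool P"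
proof -
  have "{e :: nat. e \<le> of_bool P} = (if P then {0, 1} else {0})" by auto
  then show ?thesis by auto
qed

lemma bundles_sum_row:
  fixes x y :: "'a :: comm_ring_1"
  assumes s: "s \<noteq> q"
  shows "(\<Sum>b\<in>bundles q c \<tau> \<sigma> s. bundle_wt \<tau> \<sigma> x y s b) =
    (\<Sum>t\<in>{t. \<tau> s \<le> t \<and> \<sigma> (Suc s) \<le> t \<and> t \<le> \<sigma> s \<and> (1 < s \<longrightarrow> t \<le> \<tau> (s - 1))}.
      x ^ (t - \<tau> s) * y ^ (\<sigma> s - t) *
      ((1 - x) ^ of_bool (t < \<tau> (s - 1)) * (1 - y) ^ of_bool (\<sigma> (Suc s) < t)))"
proof -
  let ?T = "{t. \<tau> s \<le> t \<and> \<sigma> (Suc s) \<le> t \<and> t \<le> \<sigma> s \<and> (1 < s \<longrightarrow> t \<le> \<tau> (s - 1))}"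
  let ?E = "\<lambda>t. {e. e \<le> (of_bool (t < \<tau> (s - 1)) :: nat)}"
  let ?F = "\<lambda>t. {f. f \<le> (of_bool (\<sigma> (Suc s) < t) :: nat)}"
  have fin: "finite ?T" by (rule finite_subset[of _ "{..\<sigma> s}"]) auto
  have "bundles q c \<tau> \<sigma> s = Sigma ?T (\<lambda>t. ?E t \<times> ?F t)"
    using s by (auto simp: bundles_def)
  then have "(\<Sum>b\<in>bundles q c \<tau> \<sigma> s. bundle_wt \<tau> \<sigma> x y s b) =
      (\<Sum>t\<in>?T. \<Sum>ef\<in>?E t \<times> ?F t. bundle_wt \<tau> \<sigma> x y s (t, ef))"
    using fin by (simp add: sum.Sigma)
  also have "\<dots> = (\<Sum>t\<in>?T. \<Sum>e\<in>?E t. \<Sum>f\<in>?F t. x ^ (t - \<tau> s) * y ^ (\<sigma> s - t) * (- x) ^ e * (- y) ^ f)"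
    by (intro sum.cong refl) (simp add: sum.cartesian_product bundle_wt_def case_prod_unfold)
  also have "\<dots> = (\<Sum>t\<in>?T. x ^ (t - \<tau> s) * y ^ (\<sigma> s - t) *
      ((\<Sum>e\<in>?E t. (- x) ^ e) * (\<Sum>f\<in>?F t. (- y) ^ f)))"
    by (simp only: sum_distrib_left[symmetric] sum_distrib_right[symmetric] mult.assoc)
  finally show ?thesis unfolding sum_bool_le .
qed

text \<open>For each t the exponents and indicators split into a part determined by the neighbouring
  shapes and the corresponding part of \<open>trunc_sym\<close>. The flag \<open>k\<close> is
  \<open>False\<close> when no value of t is possible.\<close>

lemma bundles_sum_row_sym:
  assumes s: "s \<noteq> q" "1 < s"
  shows "\<exists>m P Q k. \<forall>x y :: 'a :: comm_ring_1. (\<Sum>b\<in>bundles q c \<tau> \<sigma> s. bundle_wt \<tau> \<sigma> x y s b) =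
    y ^ excess_len \<tau> \<sigma> s * (1 - x) ^ gap_ind \<tau> \<sigma> s * (x ^ excess_len \<tau> \<sigma> (Suc s) * (1 - y) ^ gap_ind \<tau> \<sigma> (Suc s)) *
    (of_bool k * trunc_sym m P Q x y)"
proof -
  define A where "A = max (\<tau> s) (\<sigma> (Suc s))"
  define B where "B = min (\<sigma> s) (\<tau> (s - 1))"
  have T: "{t. \<tau> s \<le> t \<and> \<sigma> (Suc s) \<le> t \<and> t \<le> \<sigma> s \<and> (1 < s \<longrightarrow> t \<le> \<tau> (s - 1))} = {A..B}"
    using s by (auto simp: A_def B_def)
  show ?thesis
  proof (cases "A \<le> B")
    case False
    then show ?thesis
      by (intro exI[of _ 0] exI[of _ True] exI[of _ False]) (simp add: bundles_sum_row[OF s(1)] T)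
  next
    case True
    define P where "P \<longleftrightarrow> \<not> \<sigma> s < \<tau> (s - 1)"
    define Q where "Q \<longleftrightarrow> \<not> \<sigma> (Suc s) < \<tau> s"
    have "(\<Sum>b\<in>bundles q c \<tau> \<sigma> s. bundle_wt \<tau> \<sigma> x y s b) =
      y ^ excess_len \<tau> \<sigma> s * (1 - x) ^ gap_ind \<tau> \<sigma> s * (x ^ excess_len \<tau> \<sigma> (Suc s) * (1 - y) ^ gap_ind \<tau> \<sigma> (Suc s)) *
      trunc_sym (B - A) P Q x y" for x y :: 'a
    proof -
      have "(\<Sum>b\<in>bundles q c \<tau> \<sigma> s. bundle_wt \<tau> \<sigma> x y s b) = (\<Sum>t\<in>{A..B}. x ^ (t - \<tau> s) * y ^ (\<sigma> s - t) *
          ((1 - x) ^ of_bool (t < \<tau> (s - 1)) * (1 - y) ^ of_bool (\<sigma> (Suc s) < t)))"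
        unfolding bundles_sum_row[OF s(1)] T ..
      also have "\<dots> = (\<Sum>t\<in>{0..B-A}. x ^ (t + A - \<tau> s) * y ^ (\<sigma> s - (t + A)) *
          ((1 - x) ^ of_bool (t + A < \<tau> (s - 1)) * (1 - y) ^ of_bool (\<sigma> (Suc s) < t + A)))"
        by (rule sum.reindex_bij_witness[of _ "\<lambda>t. t + A" "\<lambda>t. t - A"]) (use True in auto)
      also have "\<dots> = (\<Sum>t\<in>{0..B-A}.
          y ^ excess_len \<tau> \<sigma> s * (1 - x) ^ gap_ind \<tau> \<sigma> s * (x ^ excess_len \<tau> \<sigma> (Suc s) * (1 - y) ^ gap_ind \<tau> \<sigma> (Suc s)) *
          (x ^ t * y ^ (B - A - t) *
     ((1 - x) ^ of_bool (P \<and> t < B - A) * (1 - y) ^ of_bool (Q \<and> 0 < t))))"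
      proof (intro sum.cong refl)
        fix t assume t: "t \<in> {0..B-A}"
        have e1: "t + A - \<tau> s = excess_len \<tau> \<sigma> (Suc s) + t"
          by (auto simp: A_def excess_len_def)
        have e2: "\<sigma> s - (t + A) = excess_len \<tau> \<sigma> s + (B - A - t)"
          using t True by (auto simp: B_def excess_len_def min_def split: if_splits)
        have e3: "of_bool (t + A < \<tau> (s - 1)) = gap_ind \<tau> \<sigma> s + of_bool (P \<and> t < B - A)"
          using t True by (auto simp: B_def gap_ind_def P_def of_bool_def)
        have e4: "of_bool (\<sigma> (Suc s) < t + A) = gap_ind \<tau> \<sigma> (Suc s) + of_bool (Q \<and> 0 < t)"
          by (auto simp: A_def gap_ind_def Q_def of_bool_def)
        show "x ^ (t + A - \<tau> s) * y ^ (\<sigma> s - (t + A)) *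
          ((1 - x) ^ of_bool (t + A < \<tau> (s - 1)) * (1 - y) ^ of_bool (\<sigma> (Suc s) < t + A)) =
          y ^ excess_len \<tau> \<sigma> s * (1 - x) ^ gap_ind \<tau> \<sigma> s * (x ^ excess_len \<tau> \<sigma> (Suc s) * (1 - y) ^ gap_ind \<tau> \<sigma> (Suc s)) *
          (x ^ t * y ^ (B - A - t) *
            ((1 - x) ^ of_bool (P \<and> t < B - A) * (1 - y) ^ of_bool (Q \<and> 0 < t)))"
          unfolding e1 e2 e3 e4 power_add by (simp only: mult_ac)
      qed
      finally show ?thesis unfolding trunc_sym_def sum_distrib_left .
    qed
    then show ?thesis
      by (intro exI[of _ "B - A"] exI[of _ P] exI[of _ Q] exI[of _ True]) simp
  qed
qed

text \<open>Each row sum is symmetric in $x, y$ up to a prefactor in $y$ and $1-x$ that depends on \<open>\<tau> (s - 1)\<close>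
and \<open>\<sigma> s\<close> only, and the same prefactor with $x, y$ exchanged comes from row \<open>s - 1\<close>; so the prefactors pair up.\<close>

lemma upper_rows_sym:
  fixes x y :: "'a :: comm_ring_1" and c n :: nat
  assumes q: "1 \<le> q" and qr: "q \<le> r" "r \<le> n" and top: "\<sigma> (Suc n) = 0" "\<tau> n = 0"
  defines "L \<equiv> \<lambda>r x y :: 'a. x ^ excess_len \<tau> \<sigma> (Suc r) * (1 - y) ^ gap_ind \<tau> \<sigma> (Suc r) *
     (\<Prod>s=Suc r..n. \<Sum>b\<in>bundles q c \<tau> \<sigma> s. bundle_wt \<tau> \<sigma> x y s b)"
  shows "L r x y = L r y x"
  using qr(2,1)
proof (induction r rule: inc_induct)
  case base
  show ?case using top by (simp add: L_def excess_len_def gap_ind_def)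
next
  case (step r)
  let ?R = "\<lambda>s x y :: 'a. \<Sum>b\<in>bundles q c \<tau> \<sigma> s. bundle_wt \<tau> \<sigma> x y s b"
  obtain m P Q k where R: "\<And>x y. ?R (Suc r) x y =
    y ^ excess_len \<tau> \<sigma> (Suc r) * (1 - x) ^ gap_ind \<tau> \<sigma> (Suc r) * (x ^ excess_len \<tau> \<sigma> (Suc (Suc r)) * (1 - y) ^ gap_ind \<tau> \<sigma> (Suc (Suc r))) *
    (of_bool k * trunc_sym m P Q x y)"
    using bundles_sum_row_sym[where s = "Suc r" and q = q and c = c and \<tau> = \<tau> and \<sigma> = \<sigma> and ?'a = 'a] q step by auto
  have "L r x y = (x * y) ^ excess_len \<tau> \<sigma> (Suc r) * ((1 - x) * (1 - y)) ^ gap_ind \<tau> \<sigma> (Suc r) *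
      (of_bool k * trunc_sym m P Q x y) * L (Suc r) x y" for x y
  proof -
    have "{Suc r..n} = insert (Suc r) {Suc (Suc r)..n}" using step by auto
    then have "L r x y = x ^ excess_len \<tau> \<sigma> (Suc r) * (1 - y) ^ gap_ind \<tau> \<sigma> (Suc r) *
       (?R (Suc r) x y * (\<Prod>s=Suc (Suc r)..n. ?R s x y))" by (simp add: L_def)
    then show ?thesis unfolding R L_def by (simp only: power_mult_distrib mult_ac)
  qed
  from this[of x y] this[of y x] show ?case
    using step trunc_sym_sym[of m P Q x y] by (simp add: mult.commute[of x y] mult.commute[of "1 - x" "1 - y"])
qed

text \<open>Row 1 has no neighbour below, so only the prefactor shared with row 2 is left over. It
  is the one that makes the product over the upper rows symmetric in
  \<open>upper_rows_sym\<close>.\<close>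

lemma bottom_row_sym:
  assumes "\<tau> 0 = 0"
  shows "\<exists>m P Q k. \<forall>x y :: 'a :: comm_ring_1. (\<Sum>b\<in>bundles 1 0 \<tau> \<sigma> 1. bundle_wt \<tau> \<sigma> x y 1 b) =
     x ^ excess_len \<tau> \<sigma> 2 * (1 - y) ^ gap_ind \<tau> \<sigma> 2 * (of_bool k * trunc_sym m P Q x y)"
proof -
  define A where "A = max (\<tau> 1) (\<sigma> 2)"
  define B where "B = \<sigma> 1"
  have S2: "Suc 1 = 2" by simp
  have R: "(\<Sum>b\<in>bundles 1 0 \<tau> \<sigma> 1. bundle_wt \<tau> \<sigma> x y 1 b) =
      (\<Sum>t\<in>{A..B}. x ^ (t - \<tau> 1) * y ^ (\<sigma> 1 - t) * (1 - y) ^ of_bool (\<sigma> 2 < t))" for x y :: 'a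
  proof -
    \<comment> \<open>As \<tau> 0 = 0, the general clause also forces e = 0, so the formula for rows
      other than \<open>q\<close> covers row 1.\<close>
    have "bundles 1 0 \<tau> \<sigma> 1 = bundles 0 0 \<tau> \<sigma> 1"
      unfolding bundles_def using assms by auto
    then show ?thesis
      using bundles_sum_row[where s = 1 and q = 0 and c = 0 and \<tau> = \<tau> and \<sigma> = \<sigma> and x = x and y = y] assms
      by (simp add: A_def B_def S2 atLeastAtMost_def atLeast_def atMost_def Int_def conj_ac)
  qed
  show ?thesis
  proof (cases "A \<le> B")
    case False
    then show ?thesis
      by (intro exI[of _ 0] exI[of _ True] exI[of _ False]) (simp add: R)
  next
    case True
    define Q where "Q \<longleftrightarrow> \<not> \<sigma> 2 < \<tau> 1"
    have "(\<Sum>b\<in>bundles 1 0 \<tau> \<sigma> 1. bundle_wt \<tau> \<sigma> x y 1 b) =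
        x ^ excess_len \<tau> \<sigma> 2 * (1 - y) ^ gap_ind \<tau> \<sigma> 2 * trunc_sym (B - A) False Q x y" for x y :: 'a
    proof -
      have "(\<Sum>b\<in>bundles 1 0 \<tau> \<sigma> 1. bundle_wt \<tau> \<sigma> x y 1 b) =
          (\<Sum>t\<in>{0..B-A}. x ^ (t + A - \<tau> 1) * y ^ (\<sigma> 1 - (t + A)) * (1 - y) ^ of_bool (\<sigma> 2 < t + A))"
        unfolding R by (rule sum.reindex_bij_witness[of _ "\<lambda>t. t + A" "\<lambda>t. t - A"]) (use True in auto)
      also have "\<dots> = (\<Sum>t\<in>{0..B-A}. x ^ excess_len \<tau> \<sigma> 2 * (1 - y) ^ gap_ind \<tau> \<sigma> 2 *
          (x ^ t * y ^ (B - A - t) *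
     ((1 - x) ^ of_bool (False \<and> t < B - A) * (1 - y) ^ of_bool (Q \<and> 0 < t))))"
      proof (intro sum.cong refl)
        fix t assume t: "t \<in> {0..B-A}"
        have e1: "t + A - \<tau> 1 = excess_len \<tau> \<sigma> 2 + t"
          by (auto simp: A_def excess_len_def One_nat_def)
        have e2: "\<sigma> 1 - (t + A) = B - A - t"
          using t True by (auto simp: B_def)
        have e4: "of_bool (\<sigma> 2 < t + A) = gap_ind \<tau> \<sigma> 2 + of_bool (Q \<and> 0 < t)"
          by (auto simp: A_def gap_ind_def Q_def of_bool_def One_nat_def)
        show "x ^ (t + A - \<tau> 1) * y ^ (\<sigma> 1 - (t + A)) * (1 - y) ^ of_bool (\<sigma> 2 < t + A) =
          x ^ excess_len \<tau> \<sigma> 2 * (1 - y) ^ gap_ind \<tau> \<sigma> 2 * (x ^ t * y ^ (B - A - t) *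
            ((1 - x) ^ of_bool (False \<and> t < B - A) * (1 - y) ^ of_bool (Q \<and> 0 < t)))"
          unfolding e1 e2 e4 power_add by (simp add: mult_ac)
      qed
      finally show ?thesis unfolding trunc_sym_def sum_distrib_left .
    qed
    then show ?thesis
      by (intro exI[of _ "B - A"] exI[of _ False] exI[of _ Q] exI[of _ True]) simp
  qed
qed

text \<open>Restricting the sum to k < m gives y h_{m-1}, and to k > 0 gives x h_{m-1}. Hence S is
  xy(h_{m-1} - h_m) if p holds, and xy(1-x)(1-y)h_{m-1} otherwise; in the second case the factor 1-y
  on the left side completes the symmetry.\<close>

lemma violation_poly_sym:
  "\<exists>S. (\<forall>x y :: 'a :: comm_ring_1. (1 - y) * (x * (\<Sum>k=0..m. x ^ k * y ^ (m - k) *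
        (of_bool (k < m) - y * of_bool (p \<or> 0 < k)))) = (1 - y) ^ of_bool p * S x y) \<and>
      (\<forall>x y. S x y = S y x)"
proof -
  define h where "h = (\<lambda>x y :: 'a. \<Sum>k=0..m. x ^ k * y ^ (m - k))"
  define g' where "g' = (\<lambda>x y :: 'a. \<Sum>k\<in>{0..<m}. x ^ k * y ^ (m - 1 - k))"
  have hs: "h x y = h y x" for x y :: 'a
    unfolding h_def by (rule sum.reindex_bij_witness[of _ "\<lambda>t. m - t" "\<lambda>t. m - t"]) (auto simp: mult_ac)
  have gs: "g' x y = g' y x" for x y :: 'a
    unfolding g'_def
    by (rule sum.reindex_bij_witness[of _ "\<lambda>t. m - 1 - t" "\<lambda>t. m - 1 - t"]) (auto simp: mult_ac)
  have 1: "(\<Sum>k=0..m. x ^ k * y ^ (m - k) * of_bool (k < m)) = y * g' x y" for x y :: 'a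
  proof -
    have "(\<Sum>k=0..m. x ^ k * y ^ (m - k) * of_bool (k < m)) = (\<Sum>k\<in>{0..<m}. y * (x ^ k * y ^ (m - 1 - k)))"
    proof (rule sum.mono_neutral_cong_right)
      show "x ^ k * y ^ (m - k) * of_bool (k < m) = y * (x ^ k * y ^ (m - 1 - k))" if "k \<in> {0..<m}" for k
      proof -
        have "m - k = Suc (m - 1 - k)" using that by auto
        then show ?thesis using that by (simp add: mult_ac)
      qed
    qed auto
    then show ?thesis by (simp add: g'_def sum_distrib_left)
  qed
  have 2: "(\<Sum>k=0..m. x ^ k * y ^ (m - k) * of_bool (0 < k)) = x * g' x y" for x y :: 'a
  proof -
    have "(\<Sum>k=0..m. x ^ k * y ^ (m - k) * of_bool (0 < k)) = (\<Sum>k\<in>{1..m}. x ^ k * y ^ (m - k))"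
      by (rule sum.mono_neutral_cong_right) auto
    also have "\<dots> = (\<Sum>k\<in>{0..<m}. x * (x ^ k * y ^ (m - 1 - k)))"
      by (rule sum.reindex_bij_witness[of _ Suc "\<lambda>t. t - 1"]) (auto simp: power_eq_if mult_ac)
    finally show ?thesis by (simp add: g'_def sum_distrib_left)
  qed
  have sp: "(\<Sum>k=0..m. x ^ k * y ^ (m - k) * (of_bool (k < m) - y * of_bool (p \<or> 0 < k))) =
      y * g' x y - y * (\<Sum>k=0..m. x ^ k * y ^ (m - k) * of_bool (p \<or> 0 < k))" for x y :: 'a
    unfolding 1[symmetric] sum_distrib_left sum_subtractf[symmetric]
    by (intro sum.cong refl) (simp add: algebra_simps)
  show ?thesis
  proof (cases p)
    case True
    show ?thesis
    proof (intro exI[of _ "\<lambda>x y. x * y * (g' x y - h x y)"] conjI allI)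
      fix x y :: 'a
      show "(1 - y) * (x * (\<Sum>k=0..m. x ^ k * y ^ (m - k) * (of_bool (k < m) - y * of_bool (p \<or> 0 < k)))) =
        (1 - y) ^ of_bool p * (x * y * (g' x y - h x y))"
        unfolding sp using True by (simp add: h_def) (simp add: algebra_simps)
      show "x * y * (g' x y - h x y) = y * x * (g' y x - h y x)"
        by (simp add: gs[of x y] hs[of x y] mult.commute)
    qed
  next
    case False
    show ?thesis
    proof (intro exI[of _ "\<lambda>x y. x * y * ((1 - x) * (1 - y) * g' x y)"] conjI allI)
      fix x y :: 'a
      show "(1 - y) * (x * (\<Sum>k=0..m. x ^ k * y ^ (m - k) * (of_bool (k < m) - y * of_bool (p \<or> 0 < k)))) =
        (1 - y) ^ of_bool p * (x * y * ((1 - x) * (1 - y) * g' x y))"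
        unfolding sp using False by (simp add: 2) (simp add: algebra_simps)
      show "x * y * ((1 - x) * (1 - y) * g' x y) = y * x * ((1 - y) * (1 - x) * g' y x)"
        by (simp add: gs[of x y] mult_ac)
    qed
  qed
qed

section \<open>Cancellation of the non-Yamanouchi patterns\<close>

text \<open>The factor $1-y$ is the excess of the alternant over an expression symmetric in the variables
$x = z_i$, $y = z_{i+1}$; it is exactly what the violation condition on row \<open>q\<close> needs to become symmetric up
to the prefactor matched by the rows above.\<close>

lemma violation_row_sym:
  assumes ab: "bb \<le> a" and q: "1 \<le> q" and c: "c \<le> 1" "q = 1 \<longrightarrow> c = 0"
    and up: "1 < q \<longrightarrow> \<sigma> q + c + bb \<le> a + \<tau> (q - 1)"
  shows "\<exists>S. (\<forall>x y :: 'a :: comm_ring_1. x ^ Suc a * y ^ bb * ((1 - y) *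
      (\<Sum>b\<in>{b\<in>bundles q c \<tau> \<sigma> q. a < bb + (\<sigma> q - fst b + snd (snd b))}. bundle_wt \<tau> \<sigma> x y q b)) =
      x ^ excess_len \<tau> \<sigma> (Suc q) * (1 - y) ^ gap_ind \<tau> \<sigma> (Suc q) * S x y) \<and> (\<forall>x y. S x y = S y x)"
proof -
  \<comment> \<open>The surplus available before row q: the row is violating exactly if it contains
    more than d letters i+1.\<close>
  define d where "d = a - bb"
  define A where "A = max (\<tau> q) (\<sigma> (Suc q))"
  let ?T = "{t. A \<le> t \<and> t + d \<le> \<sigma> q}"
  let ?F = "\<lambda>t. {f. f \<le> (of_bool (\<sigma> (Suc q) < t) :: nat) \<and> t + d < \<sigma> q + f}"
  have set: "{b\<in>bundles q c \<tau> \<sigma> q. a < bb + (\<sigma> q - fst b + snd (snd b))} = Sigma ?T (\<lambda>t. {0} \<times> ?F t)"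
    (is "?L = ?R")
  proof (intro set_eqI)
    fix b :: "nat \<times> nat \<times> nat"
    obtain t e f where b: "b = (t, e, f)" by (cases b) auto
    show "b \<in> ?L \<longleftrightarrow> b \<in> ?R"
    proof
      assume "b \<in> ?L"
      then show "b \<in> ?R" using ab
        by (auto simp: b bundles_def A_def d_def of_bool_def split: if_splits)
    next
      assume R: "b \<in> ?R"
      then have f: "f \<le> of_bool (\<sigma> (Suc q) < t)" "t + d < \<sigma> q + f" "A \<le> t" "t + d \<le> \<sigma> q" "e = 0"
        by (auto simp: b)
      \<comment> \<open>A violating row has many letters i+1, hence a small t. By \<open>up\<close>,
        the bound t \<le> \<tau>(q-1) and the guard for \<open>c\<close> then hold automatically, so
        they do not cut the sum.\<close>
      have "t + c \<le> \<tau> (q - 1)" if "1 < q" using up that f(4) ab by (simp add: d_def)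
      moreover have "a < bb + (\<sigma> q - t + f)" using f ab by (simp add: d_def)
      ultimately show "b \<in> ?L" using f q c
        by (auto simp: b bundles_def A_def)
    qed
  qed
  have F: "(\<Sum>f\<in>?F t. (- y :: 'a) ^ f) = of_bool (t + d < \<sigma> q) - y * of_bool (\<sigma> (Suc q) < t)"
    if "t \<in> ?T" for t y
  proof -
    have "?F t = (if t + d < \<sigma> q then {0} else {}) \<union> (if \<sigma> (Suc q) < t then {1} else {})"
      using that by (auto simp: of_bool_def split: if_splits)
    then show ?thesis by auto
  qed
  have fin: "finite ?T" by (rule finite_subset[of _ "{..\<sigma> q}"]) auto
  have sum: "(\<Sum>b\<in>{b\<in>bundles q c \<tau> \<sigma> q. a < bb + (\<sigma> q - fst b + snd (snd b))}. bundle_wt \<tau> \<sigma> x y q b) =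
      (\<Sum>t\<in>?T. x ^ (t - \<tau> q) * y ^ (\<sigma> q - t) *
        (of_bool (t + d < \<sigma> q) - y * of_bool (\<sigma> (Suc q) < t)))" for x y :: 'a
  proof -
    have finF: "finite (?F t)" for t by (rule finite_subset[of _ "{..1}"]) (auto simp: of_bool_def)
    have "(\<Sum>b\<in>Sigma ?T (\<lambda>t. {0} \<times> ?F t). bundle_wt \<tau> \<sigma> x y q b) =
        (\<Sum>t\<in>?T. \<Sum>ef\<in>{0} \<times> ?F t. bundle_wt \<tau> \<sigma> x y q (t, ef))"
      using fin finF by (subst sum.Sigma) (auto simp: case_prod_unfold)
    also have "\<dots> = (\<Sum>t\<in>?T. \<Sum>e\<in>{0}. \<Sum>f\<in>?F t. x ^ (t - \<tau> q) * y ^ (\<sigma> q - t) * (- x) ^ e * (- y) ^ f)"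
      by (intro sum.cong refl) (simp only: sum.cartesian_product bundle_wt_def case_prod_unfold fst_conv snd_conv)
    also have "\<dots> = (\<Sum>t\<in>?T. x ^ (t - \<tau> q) * y ^ (\<sigma> q - t) * (\<Sum>f\<in>?F t. (- y) ^ f))"
      by (simp add: sum_distrib_left)
    finally show ?thesis unfolding set by (simp add: F)
  qed
  show ?thesis
  proof (cases "A + d \<le> \<sigma> q")
    case False
    then have "?T = {}" by auto
    then show ?thesis unfolding sum by (intro exI[of _ "\<lambda>_ _. 0"]) (simp only: sum.empty mult_zero_right, simp)
  next
    case True
    define m where "m = \<sigma> q - d - A"
    define p where "p \<longleftrightarrow> \<sigma> (Suc q) < \<tau> q"
    have ad: "a = bb + d" using ab by (simp add: d_def)
    obtain S :: "'a \<Rightarrow> 'a \<Rightarrow> 'a" where S: "\<And>x y. (1 - y) * (x * (\<Sum>k=0..m. x ^ k * y ^ (m - k) *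
        (of_bool (k < m) - y * of_bool (p \<or> 0 < k)))) = (1 - y) ^ of_bool p * S x y"
      and Ss: "\<And>x y. S x y = S y x" using violation_poly_sym[of m p] by blast
    have "x ^ Suc a * y ^ bb * ((1 - y) * (\<Sum>t\<in>?T. x ^ (t - \<tau> q) * y ^ (\<sigma> q - t) *
        (of_bool (t + d < \<sigma> q) - y * of_bool (\<sigma> (Suc q) < t)))) =
        x ^ excess_len \<tau> \<sigma> (Suc q) * (1 - y) ^ gap_ind \<tau> \<sigma> (Suc q) * ((x * y) ^ (bb + d) * S x y)" for x y
    proof -
      have pp: "gap_ind \<tau> \<sigma> (Suc q) = of_bool p" by (simp add: gap_ind_def p_def)
      have "(\<Sum>t\<in>?T. x ^ (t - \<tau> q) * y ^ (\<sigma> q - t) *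
        (of_bool (t + d < \<sigma> q) - y * of_bool (\<sigma> (Suc q) < t))) =
        (\<Sum>k=0..m. x ^ (k + A - \<tau> q) * y ^ (\<sigma> q - (k + A)) *
        (of_bool (k + A + d < \<sigma> q) - y * of_bool (\<sigma> (Suc q) < k + A)))"
        by (rule sum.reindex_bij_witness[of _ "\<lambda>t. t + A" "\<lambda>t. t - A"]) (use True in \<open>auto simp: m_def\<close>)
      also have "\<dots> = (\<Sum>k=0..m. x ^ excess_len \<tau> \<sigma> (Suc q) * y ^ d * (x ^ k * y ^ (m - k) *
        (of_bool (k < m) - y * of_bool (p \<or> 0 < k))))"
      proof (intro sum.cong refl)
        fix k assume k: "k \<in> {0..m}"
        have e1: "k + A - \<tau> q = excess_len \<tau> \<sigma> (Suc q) + k" by (auto simp: A_def excess_len_def)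
        have e2: "\<sigma> q - (k + A) = d + (m - k)" using k True by (auto simp: m_def)
        have e3: "k + A + d < \<sigma> q \<longleftrightarrow> k < m" using True by (auto simp: m_def)
        have e4: "\<sigma> (Suc q) < k + A \<longleftrightarrow> p \<or> 0 < k" by (auto simp: A_def p_def)
        show "x ^ (k + A - \<tau> q) * y ^ (\<sigma> q - (k + A)) *
            (of_bool (k + A + d < \<sigma> q) - y * of_bool (\<sigma> (Suc q) < k + A)) =
          x ^ excess_len \<tau> \<sigma> (Suc q) * y ^ d * (x ^ k * y ^ (m - k) * (of_bool (k < m) - y * of_bool (p \<or> 0 < k)))"
          unfolding e1 e2 e3 e4 power_add by (simp only: mult_ac)
      qed
      also have "\<dots> = x ^ excess_len \<tau> \<sigma> (Suc q) * y ^ d * (\<Sum>k=0..m. x ^ k * y ^ (m - k) *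
        (of_bool (k < m) - y * of_bool (p \<or> 0 < k)))" by (simp only: sum_distrib_left)
      finally have "x ^ Suc a * y ^ bb * ((1 - y) * (\<Sum>t\<in>?T. x ^ (t - \<tau> q) * y ^ (\<sigma> q - t) *
        (of_bool (t + d < \<sigma> q) - y * of_bool (\<sigma> (Suc q) < t)))) =
        x ^ a * y ^ (bb + d) * x ^ excess_len \<tau> \<sigma> (Suc q) * ((1 - y) * (x * (\<Sum>k=0..m. x ^ k * y ^ (m - k) *
        (of_bool (k < m) - y * of_bool (p \<or> 0 < k)))))"
        by (simp only: power_add power_Suc mult_ac)
      also have "\<dots> = x ^ a * y ^ (bb + d) * x ^ excess_len \<tau> \<sigma> (Suc q) * ((1 - y) ^ of_bool p * S x y)"
        by (simp only: S)
      finally show ?thesis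
        unfolding pp power_mult_distrib ad[symmetric] by (simp only: mult_ac)
    qed
    then show ?thesis unfolding sum
      by (intro exI[of _ "\<lambda>x y. (x * y) ^ (bb + d) * S x y"]) (simp add: Ss mult.commute)
  qed
qed

section \<open>Violations in row form and their classes\<close>

definition row_count :: "pattern \<Rightarrow> nat \<Rightarrow> nat \<Rightarrow> nat" where
  "row_count D k r = fst D k r - fst D (k - 1) r + snd D k r"

text \<open>A condition on rows, although the tableau condition reads columns;
  \<open>good_iff_column_yamanouchi\<close> shows that they agree. Letters in rows above r do not
  enter, which makes it a condition on one row of a class.\<close>

definition violation :: "(nat \<Rightarrow> nat) \<Rightarrow> pattern \<Rightarrow> nat \<Rightarrow> nat \<Rightarrow> bool" where
  "violation lam D i r \<longleftrightarrow> lam i + (\<Sum>s=1..<r. row_count D i s) < lam (Suc i) + (\<Sum>s=1..r. row_count D (Suc i) s)"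

definition good :: "nat \<Rightarrow> (nat \<Rightarrow> nat) \<Rightarrow> pattern \<Rightarrow> bool" where
  "good n lam D \<longleftrightarrow> (\<forall>i\<in>{1..<n}. \<forall>r\<in>{1..n}. \<not> violation lam D i r)"

definition pat_weight :: "nat \<Rightarrow> pattern \<Rightarrow> nat \<Rightarrow> nat" where
  "pat_weight n D k = (\<Sum>r=1..n. row_count D k r)"

definition num_extra :: "nat \<Rightarrow> pattern \<Rightarrow> nat" where
  "num_extra n D = (\<Sum>k=1..n. \<Sum>r=1..n. snd D k r)"

definition alt_monomial :: "nat \<Rightarrow> (nat \<Rightarrow> nat) \<Rightarrow> (nat \<Rightarrow> 'a) \<Rightarrow> 'a :: comm_ring_1" where
  "alt_monomial n lam z = (\<Prod>j=1..n. alt_entry n z j (lam j) j)"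

text \<open>The determinant as an antisymmetrization over the variables, the form in which symmetric
  factors can be moved inside.\<close>

lemma Kdet_altsum: "Kdet n z lam = altsum n (\<lambda>p. alt_monomial n lam (z \<circ> p))"
  unfolding Kdet_def rows_det_def alt_monomial_def by (intro altsum_cong prod.cong) (simp_all add: alt_entry_def)

lemma pat_term_eq: "pat_term D z k r = (-1) ^ snd D k r * z k ^ row_count D k r"
  using power_minus[of "z k" "snd D k r"] by (simp add: pat_term_def row_count_def power_add mult_ac)

lemma pat_monomial_eq: "pat_monomial n D z = (-1) ^ num_extra n D * (\<Prod>k=1..n. z k ^ pat_weight n D k)"
  by (simp add: pat_monomial_def pat_term_eq prod.distrib power_sum num_extra_def pat_weight_def)

lemma alt_monomial_pat_monomial: "alt_monomial n lam z * pat_monomial n D z = (-1) ^ num_extra n D * alt_monomial n (\<lambda>j. lam j + pat_weight n D j) z"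
proof -
  have "alt_monomial n (\<lambda>j. lam j + pat_weight n D j) z = (\<Prod>j=1..n. alt_entry n z j (lam j) j * z j ^ pat_weight n D j)"
    unfolding alt_monomial_def
  proof (intro prod.cong refl)
    fix j assume "j \<in> {1..n}"
    then have "lam j + pat_weight n D j + n - j = (lam j + n - j) + pat_weight n D j" by auto
    then show "alt_entry n z j (lam j + pat_weight n D j) j = alt_entry n z j (lam j) j * z j ^ pat_weight n D j"
      by (simp add: alt_entry_def power_add mult_ac)
  qed
  then show ?thesis by (simp add: pat_monomial_eq alt_monomial_def prod.distrib mult_ac)
qed

text \<open>Lowest row, and in it the largest letter: changing the letters $i, i+1$ in rows $\ge r$ cannot create
an earlier violation in this order.\<close>

definition first_violation :: "nat \<Rightarrow> (nat \<Rightarrow> nat) \<Rightarrow> nat \<Rightarrow> nat \<Rightarrow> pattern \<Rightarrow> bool" where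
  "first_violation n lam i r D \<longleftrightarrow> i \<in> {1..<n} \<and> r \<in> {1..n} \<and> violation lam D i r \<and>
     (\<forall>r'\<in>{1..<r}. \<forall>i'\<in>{1..<n}. \<not> violation lam D i' r') \<and> (\<forall>i'\<in>{i<..<n}. \<not> violation lam D i' r)"

lemma first_violation_exists:
  assumes "\<not> good n lam D"
  shows "\<exists>i r. first_violation n lam i r D"
proof -
  let ?P = "\<lambda>r. r \<in> {1..n} \<and> (\<exists>i\<in>{1..<n}. violation lam D i r)"
  have "\<exists>r. ?P r" using assms by (auto simp: good_def)
  then have P: "?P (LEAST r. ?P r)" by (rule LeastI_ex)
  define r where "r = (LEAST r. ?P r)"
  have r: "?P r" unfolding r_def by (rule P)
  have less: "\<not> ?P r'" if "r' < r" for r' using that not_less_Least unfolding r_def by blast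
  let ?I = "{i\<in>{1..<n}. violation lam D i r}"
  have I: "finite ?I" "?I \<noteq> {}" using r by auto
  have "Max ?I \<in> ?I" by (rule Max_in[OF I])
  moreover have "\<not> violation lam D i r" if "i \<in> {Max ?I<..<n}" for i
  proof
    assume "violation lam D i r"
    then have "i \<in> ?I" using that calculation by auto
    then have "i \<le> Max ?I" by (rule Max_ge[OF I(1)])
    moreover have "Max ?I < i" using that by (simp only: greaterThanLessThan_iff)
    ultimately show False by linarith
  qed
  moreover have "\<not> violation lam D i' r'" if "r' \<in> {1..<r}" "i' \<in> {1..<n}" for i' r'
  proof -
    have "r' < r" "r' \<in> {1..n}" using that r by auto
    then show ?thesis using less[of r'] that by blast
  qed
  ultimately have "first_violation n lam (Max ?I) r D"
    using r unfolding first_violation_def by blast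
  then show ?thesis by blast
qed

lemma first_violation_unique:
  assumes "first_violation n lam i r D" "first_violation n lam i' r' D"
  shows "i = i' \<and> r = r'"
proof -
  have "r = r'"
    using assms by (metis atLeastLessThan_iff atLeastAtMost_iff first_violation_def linorder_neqE_nat)
  moreover have "i = i'"
    using assms calculation unfolding first_violation_def
    by (metis atLeastLessThan_iff greaterThanLessThan_iff linorder_neqE_nat)
  ultimately show ?thesis by simp
qed

lemma erase_eqD:
  assumes "erase i q D = erase i q D0"
  shows "\<not> (k = i \<and> q \<le> s) \<Longrightarrow> fst D k s = fst D0 k s"
    and "\<not> ((k = i \<or> k = Suc i) \<and> q \<le> s) \<Longrightarrow> snd D k s = snd D0 k s"
proof -
  have "fst (erase i q D) k s = fst (erase i q D0) k s" "snd (erase i q D) k s = snd (erase i q D0) k s"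
    using assms by simp_all
  then show "\<not> (k = i \<and> q \<le> s) \<Longrightarrow> fst D k s = fst D0 k s"
    and "\<not> ((k = i \<or> k = Suc i) \<and> q \<le> s) \<Longrightarrow> snd D k s = snd D0 k s"
    by (simp_all add: erase_def split: if_splits)
qed

text \<open>Members of the class agree with \<open>D0\<close> in the rows below r and, in row r, in
  the letters beyond i+1. So the conditions preceding (i, r) hold for all of them, and what is left
  is a condition on the bundle of row r.\<close>

lemma first_violation_class:
  assumes D: "D \<in> pat n \<mu>" and fv: "first_violation n lam i r D0" and er: "erase i r D = erase i r D0"
  shows "first_violation n lam i r D \<longleftrightarrow>
    lam i + (\<Sum>s=1..<r. row_count D0 i s) <
    lam (Suc i) + (\<Sum>s=1..<r. row_count D0 (Suc i) s) + (fst D0 (Suc i) r - fst D i r + snd D (Suc i) r)"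
proof -
  note e = erase_eqD[OF er]
  have ir: "1 \<le> r" "i \<ge> 1" using fv by (auto simp: first_violation_def)
  have c1: "row_count D k s = row_count D0 k s" if "s < r" for k s using that e by (simp add: row_count_def)
  have c2: "row_count D k r = row_count D0 k r" if "k > Suc i" for k
  proof -
    have "k \<noteq> i" "k - 1 \<noteq> i" "k \<noteq> Suc i" using that by linarith+
    then show ?thesis using e by (simp add: row_count_def)
  qed
  have s1: "(\<Sum>s=1..<r'. row_count D k s) = (\<Sum>s=1..<r'. row_count D0 k s)" if "r' \<le> r" for k r'
    using that by (intro sum.cong refl c1) auto
  have s2: "(\<Sum>s=1..r'. row_count D k s) = (\<Sum>s=1..r'. row_count D0 k s)" if "r' < r" for k r'
    using that by (intro sum.cong refl c1) auto
  have split: "(\<Sum>s=1..r. row_count E k s) = (\<Sum>s=1..<r. row_count E k s) + row_count E k r" for E k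
  proof -
    have "{1..r} = insert r {1..<r}" using ir by auto
    then show ?thesis by simp
  qed
  have v1: "violation lam D i' r' \<longleftrightarrow> violation lam D0 i' r'" if "r' < r" for i' r'
    using that by (simp add: violation_def s1 s2)
  have v2: "violation lam D i' r \<longleftrightarrow> violation lam D0 i' r" if "i' > i" for i'
    using that by (simp add: violation_def split s1 c2)
  have "first_violation n lam i r D \<longleftrightarrow> violation lam D i r"
    using fv v1 v2 by (auto simp: first_violation_def)
  also have "\<dots> \<longleftrightarrow> lam i + (\<Sum>s=1..<r. row_count D0 i s) <
    lam (Suc i) + (\<Sum>s=1..<r. row_count D0 (Suc i) s) + (fst D0 (Suc i) r - fst D i r + snd D (Suc i) r)"
    using e(1)[of "Suc i" r] by (simp add: violation_def split s1 row_count_def[of D "Suc i" r] add.assoc)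
  finally show ?thesis .
qed

lemma alt_monomial_split:
  assumes "1 \<le> i" "i < n"
  shows "alt_monomial n lam z = (\<Prod>j\<in>{1..n} - {i, Suc i}. alt_entry n z j (lam j) j) *
    (z i ^ (lam i + n - i) * (1 - z i) ^ (i - 1) * (z (Suc i) ^ (lam (Suc i) + n - Suc i) * (1 - z (Suc i)) ^ i))"
proof -
  have "alt_monomial n lam z = (\<Prod>j\<in>{1..n} - {i, Suc i}. alt_entry n z j (lam j) j) * (\<Prod>j\<in>{i, Suc i}. alt_entry n z j (lam j) j)"
    unfolding alt_monomial_def by (rule prod.subset_diff) (use assms in auto)
  then show ?thesis by (simp add: alt_entry_def)
qed

lemma class_factor_split:
  "class_factor n i q D z = (\<Prod>k\<in>{1..n} - {i, Suc i}. \<Prod>s=1..n. pat_term D z k s) *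
     ((\<Prod>s=1..<q. (-1) ^ snd D i s * (-1) ^ snd D (Suc i) s) *
      (z i ^ (\<Sum>s=1..<q. row_count D i s) * z (Suc i) ^ (\<Sum>s=1..<q. row_count D (Suc i) s)))"
  by (simp add: class_factor_def pat_term_eq prod.distrib power_sum mult_ac)

text \<open>\<open>F\<close> is made of a factor free of z_i and z_{i+1}, the violating row q, and
  the rows above it. The prefactor left over by \<open>violation_row_sym\<close> is the one required
  by \<open>upper_rows_sym\<close>, so \<open>F\<close> is symmetric in the two variables.\<close>

lemma class_cancel:
  fixes z :: "nat \<Rightarrow> 'a :: comm_ring_1"
  assumes D0: "D0 \<in> pat n \<mu>" and fv: "first_violation n lam i q D0" and lam: "lam \<in> par n"
  defines "F \<equiv> \<lambda>z :: nat \<Rightarrow> 'a. alt_monomial n lam z *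
    (\<Sum>D\<in>{D \<in> pat n \<mu>. first_violation n lam i q D \<and> erase i q D = erase i q D0}. pat_monomial n D z)"
  shows "F (z \<circ> transpose i (Suc i)) = F z"
proof -
  have i: "1 \<le> i" "i < n" and q: "1 \<le> q" "q \<le> n" using fv by (auto simp: first_violation_def)
  obtain \<rho> \<epsilon> where De: "D0 = (\<rho>, \<epsilon>)" by force
  note P = D0[unfolded De]
  define \<tau> where "\<tau> = fst D0 (i - 1)"
  define \<sigma> where "\<sigma> = fst D0 (Suc i)"
  define c where "c = snd D0 i (q - 1)"
  define a where "a = lam i + (\<Sum>s=1..<q. row_count D0 i s)"
  define bb where "bb = lam (Suc i) + (\<Sum>s=1..<q. row_count D0 (Suc i) s)"
  have i1: "Suc (i - 1) = i" using i by simp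
  \<comment> \<open>As row q-1 has no violation, the letters i+1 up to row q-1 are already balanced
    by the letters i below row q-1; the letters i in row q-1 itself are a reserve, which
    \<open>up\<close> uses. For q = 1 only lam enters.\<close>
  have a_ge: "bb + (if 1 < q then row_count D0 i (q - 1) else 0) \<le> a"
  proof (cases "1 < q")
    case False
    then have "{1..<q} = {}" by auto
    then show ?thesis using parD(2)[OF lam, of i] i False by (simp add: a_def bb_def)
  next
    case True
    have s: "{1..<q} = insert (q - 1) {1..<q - 1}" using True by auto
    have "\<not> violation lam D0 i (q - 1)" using fv True i by (auto simp: first_violation_def)
    moreover have "{1..<q} = {1..q - 1}" using True by auto
    ultimately have "bb \<le> lam i + (\<Sum>s=1..<q - 1. row_count D0 i s)" by (simp add: violation_def bb_def)
    moreover have "(\<Sum>s=1..<q. row_count D0 i s) = row_count D0 i (q - 1) + (\<Sum>s=1..<q - 1. row_count D0 i s)"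
      unfolding s by (rule sum.insert) auto
    ultimately show ?thesis using True by (simp add: a_def)
  qed
  have ab: "bb \<le> a" using a_ge by simp
  have c: "c \<le> 1" "q = 1 \<longrightarrow> c = 0"
    using patD(7)[OF P, of i "q - 1"] by (auto simp: c_def De of_bool_def split: if_splits)
  have up: "1 < q \<longrightarrow> \<sigma> q + c + bb \<le> a + \<tau> (q - 1)"
  proof
    assume q1: "1 < q"
    then have "bb + row_count D0 i (q - 1) \<le> a" using a_ge by simp
    moreover have "\<sigma> q \<le> \<rho> i (q - 1)"
      using patD(5)[OF P, of i "q - 1"] i q1 by (simp add: \<sigma>_def De)
    moreover have "\<tau> (q - 1) \<le> \<rho> i (q - 1)"
      using pat_mono[OF P, of "i - 1" "q - 1"] i by (simp add: \<tau>_def De)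
    ultimately show "\<sigma> q + c + bb \<le> a + \<tau> (q - 1)"
      unfolding row_count_def c_def De \<tau>_def fst_conv snd_conv by arith
  qed
  obtain S :: "'a \<Rightarrow> 'a \<Rightarrow> 'a" where S: "\<And>x y. x ^ Suc a * y ^ bb * ((1 - y) *
      (\<Sum>b\<in>{b\<in>bundles q c \<tau> \<sigma> q. a < bb + (\<sigma> q - fst b + snd (snd b))}. bundle_wt \<tau> \<sigma> x y q b)) =
      x ^ excess_len \<tau> \<sigma> (Suc q) * (1 - y) ^ gap_ind \<tau> \<sigma> (Suc q) * S x y" and Ss: "\<And>x y. S x y = S y x"
    using violation_row_sym[where a = a and bb = bb and q = q and c = c and \<sigma> = \<sigma> and \<tau> = \<tau>, OF ab q(1) c up]
    by blast
  have top: "\<sigma> (Suc n) = 0" "\<tau> n = 0"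
    using pat_row_0[OF P] i by (auto simp: \<sigma>_def \<tau>_def De)
  define L where "L = (\<lambda>x y :: 'a. x ^ excess_len \<tau> \<sigma> (Suc q) * (1 - y) ^ gap_ind \<tau> \<sigma> (Suc q) *
     (\<Prod>s=Suc q..n. \<Sum>b\<in>bundles q c \<tau> \<sigma> s. bundle_wt \<tau> \<sigma> x y s b))"
  have Ls: "L x y = L y x" for x y
    using upper_rows_sym[where q = q and r = q and n = n and \<sigma> = \<sigma> and \<tau> = \<tau> and c = c and x = x and y = y] q top by (simp add: L_def)
  define R where "R = (\<lambda>z :: nat \<Rightarrow> 'a. (\<Prod>j\<in>{1..n} - {i, Suc i}. alt_entry n z j (lam j) j) *
     (\<Prod>k\<in>{1..n} - {i, Suc i}. \<Prod>s=1..n. pat_term D0 z k s) *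
     (\<Prod>s=1..<q. (-1) ^ snd D0 i s * (-1) ^ snd D0 (Suc i) s))"
  \<comment> \<open>The diagonal entries contribute z_i^(n-i) (1-z_i)^(i-1) and z_{i+1}^(n-i-1)
    (1-z_{i+1})^i. After the symmetric part is split off, one z_i and one 1 - z_{i+1} remain; these
    are the \<open>Suc a\<close> and the factor 1-y of \<open>violation_row_sym\<close>.\<close>
  have key: "F z = R z * ((z i * z (Suc i)) ^ (n - Suc i) * ((1 - z i) * (1 - z (Suc i))) ^ (i - 1) *
      (S (z i) (z (Suc i)) * L (z i) (z (Suc i))))" for z
  proof -
    let ?x = "z i" and ?y = "z (Suc i)"
    let ?V = "\<Sum>b\<in>{b\<in>bundles q c \<tau> \<sigma> q. a < bb + (\<sigma> q - fst b + snd (snd b))}. bundle_wt \<tau> \<sigma> ?x ?y q b"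
    let ?U = "\<Prod>s=Suc q..n. \<Sum>b\<in>bundles q c \<tau> \<sigma> s. bundle_wt \<tau> \<sigma> ?x ?y s b"
    have "{D \<in> pat n \<mu>. first_violation n lam i q D \<and> erase i q D = erase i q D0} =
      {D \<in> pat n \<mu>. erase i q D = erase i q D0 \<and> a < bb + (\<sigma> q - fst D i q + snd D (Suc i) q)}"
      using first_violation_class[OF _ fv] by (auto simp: a_def bb_def \<sigma>_def)
    then have "F z = alt_monomial n lam z * (class_factor n i q D0 z * (?V * ?U))"
      using class_sum[OF D0 i q, where z = z and Q = "\<lambda>t f. a < bb + (\<sigma> q - t + f)"]
      by (simp add: F_def c_def \<tau>_def \<sigma>_def)
    also have "\<dots> = R z * (?x ^ (lam i + n - i) * ?x ^ (\<Sum>s=1..<q. row_count D0 i s) * (1 - ?x) ^ (i - 1) *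
        (?y ^ (lam (Suc i) + n - Suc i) * ?y ^ (\<Sum>s=1..<q. row_count D0 (Suc i) s)) * (1 - ?y) ^ i * (?V * ?U))"
      unfolding alt_monomial_split[OF i] class_factor_split R_def by (simp only: mult_ac)
    also have "?x ^ (lam i + n - i) * ?x ^ (\<Sum>s=1..<q. row_count D0 i s) = ?x ^ (n - Suc i) * ?x ^ Suc a"
      unfolding power_add[symmetric] by (rule arg_cong[of _ _ "power ?x"]) (use i in \<open>simp add: a_def\<close>)
    also have "?y ^ (lam (Suc i) + n - Suc i) * ?y ^ (\<Sum>s=1..<q. row_count D0 (Suc i) s) = ?y ^ (n - Suc i) * ?y ^ bb"
      unfolding power_add[symmetric] by (rule arg_cong[of _ _ "power ?y"]) (use i in \<open>simp add: bb_def\<close>)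
    also have "(1 - ?y) ^ i = (1 - ?y) ^ (i - 1) * (1 - ?y)"
      using i1 by (metis power_Suc2)
    also have "R z * (?x ^ (n - Suc i) * ?x ^ Suc a * (1 - ?x) ^ (i - 1) * (?y ^ (n - Suc i) * ?y ^ bb) *
        ((1 - ?y) ^ (i - 1) * (1 - ?y)) * (?V * ?U)) =
      R z * ((?x * ?y) ^ (n - Suc i) * ((1 - ?x) * (1 - ?y)) ^ (i - 1) *
        ((?x ^ Suc a * ?y ^ bb * ((1 - ?y) * ?V)) * ?U))"
      by (simp only: power_mult_distrib mult_ac)
    also have "\<dots> = R z * ((?x * ?y) ^ (n - Suc i) * ((1 - ?x) * (1 - ?y)) ^ (i - 1) * (S ?x ?y * L ?x ?y))"
      unfolding S L_def by (simp only: mult_ac)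
    finally show ?thesis .
  qed
  let ?s = "transpose i (Suc i)"
  have "R (z \<circ> ?s) = R z"
  proof -
    have "z (?s j) = z j" if "j \<notin> {i, Suc i}" for j
      using that by (simp add: transpose_def)
    then show ?thesis unfolding R_def
      by (intro arg_cong2[of _ _ _ _ times] prod.cong refl) (auto simp: alt_entry_def pat_term_def)
  qed
  moreover have "(z \<circ> ?s) i = z (Suc i)" "(z \<circ> ?s) (Suc i) = z i" by simp_all
  ultimately show ?thesis unfolding key
    by (simp only: Ss[of "z (Suc i)"] Ls[of "z (Suc i)"] mult.commute[of "z (Suc i)"] mult.commute[of "1 - z (Suc i)"])
qed

section \<open>Symmetry of the Grothendieck polynomial and its products with alternants\<close>

definition Gpol :: "nat \<Rightarrow> (nat \<Rightarrow> nat) \<Rightarrow> (nat \<Rightarrow> 'a) \<Rightarrow> 'a :: comm_ring_1" where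
  "Gpol n \<mu> z = (\<Sum>D\<in>pat n \<mu>. pat_monomial n D z)"

text \<open>The classes for q = 1 leave \<rho> i, \<epsilon> i and \<epsilon> (i+1) free in all
  rows. Their sums are symmetric by \<open>bottom_row_sym\<close> and \<open>upper_rows_sym\<close>,
  which replaces an involution of Bender-Knuth type.\<close>

lemma Gpol_adjacent:
  fixes z :: "nat \<Rightarrow> 'a :: comm_ring_1"
  assumes i: "1 \<le> i" "i < n"
  shows "Gpol n \<mu> (z \<circ> transpose i (Suc i)) = Gpol n \<mu> z"
proof -
  have cls: "(\<Sum>D\<in>{D \<in> pat n \<mu>. erase i 1 D = e}. pat_monomial n D (z \<circ> transpose i (Suc i))) =
      (\<Sum>D\<in>{D \<in> pat n \<mu>. erase i 1 D = e}. pat_monomial n D z)" if e: "e \<in> erase i 1 ` pat n \<mu>" for e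
  proof -
    obtain D0 where D0: "D0 \<in> pat n \<mu>" "e = erase i 1 D0" using e by blast
    obtain \<rho> \<epsilon> where De: "D0 = (\<rho>, \<epsilon>)" by force
    note P = D0(1)[unfolded De]
    define \<tau> where "\<tau> = fst D0 (i - 1)"
    define \<sigma> where "\<sigma> = fst D0 (Suc i)"
    have c0: "snd D0 i (1 - 1) = 0" using pat_eps_0[OF P, of i 0] by (simp add: De)
    have top: "\<sigma> (Suc n) = 0" "\<tau> n = 0" "\<tau> 0 = 0"
      using pat_row_0[OF P] patD(4)[OF P] i by (auto simp: \<sigma>_def \<tau>_def De)
    define L where "L = (\<lambda>x y :: 'a. x ^ excess_len \<tau> \<sigma> 2 * (1 - y) ^ gap_ind \<tau> \<sigma> 2 *
       (\<Prod>s=2..n. \<Sum>b\<in>bundles 1 0 \<tau> \<sigma> s. bundle_wt \<tau> \<sigma> x y s b))"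
    have S1: "Suc 1 = 2" by simp
    have Ls: "L x y = L y x" for x y
      using upper_rows_sym[where q = 1 and r = 1 and n = n and \<sigma> = \<sigma> and \<tau> = \<tau> and c = 0 and x = x and y = y] i top by (simp add: L_def S1)
    obtain m P Q k where B: "\<And>x y :: 'a. (\<Sum>b\<in>bundles 1 0 \<tau> \<sigma> 1. bundle_wt \<tau> \<sigma> x y 1 b) =
       x ^ excess_len \<tau> \<sigma> 2 * (1 - y) ^ gap_ind \<tau> \<sigma> 2 * (of_bool k * trunc_sym m P Q x y)"
      using bottom_row_sym[of \<tau> \<sigma>, where ?'a = 'a] top by blast
    define R where "R = (\<lambda>z :: nat \<Rightarrow> 'a. \<Prod>k\<in>{1..n} - {i, Suc i}. \<Prod>s=1..n. pat_term D0 z k s)"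
    have key: "(\<Sum>D\<in>{D \<in> pat n \<mu>. erase i 1 D = e}. pat_monomial n D z) =
        R z * (of_bool k * trunc_sym m P Q (z i) (z (Suc i)) * L (z i) (z (Suc i)))" for z
      using class_sum[OF D0(1) i order_refl, where z = z and Q = "\<lambda>t f. True"] i
      by (simp add: D0(2) c0[simplified] S1 class_factor_split R_def B L_def \<tau>_def[symmetric] \<sigma>_def[symmetric] mult_ac)
    have "R (z \<circ> transpose i (Suc i)) = R z"
    proof -
      have "z (transpose i (Suc i) j) = z j" if "j \<notin> {i, Suc i}" for j
        using that by (simp add: transpose_def)
      then show ?thesis unfolding R_def
        by (intro prod.cong refl) (auto simp: pat_term_def)
    qed
    then show ?thesis unfolding key using trunc_sym_sym[of m P Q "z (Suc i)" "z i"] Ls[of "z (Suc i)" "z i"] by simp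
  qed
  have fin: "finite (pat n \<mu>)" by (rule finite_pat)
  show ?thesis unfolding Gpol_def
    by (subst (1 2) sum.image_gen[OF fin, where g = "erase i 1"]) (intro sum.cong refl cls)
qed

lemma Gpol_transpose:
  fixes z :: "nat \<Rightarrow> 'a :: comm_ring_1"
  assumes "1 \<le> i" "i < j" "j \<le> n"
  shows "Gpol n \<mu> (z \<circ> transpose i j) = Gpol n \<mu> z"
  using assms(2,3)
proof (induction j arbitrary: z)
  case (Suc j)
  show ?case
  proof (cases "j = i")
    case True
    then show ?thesis using Gpol_adjacent[of i n \<mu> z] assms(1) Suc.prems by (auto simp: comp_def)
  next
    case False
    then have ij: "i < j" using Suc.prems by simp
    have "transpose i (Suc j) = transpose j (Suc j) \<circ> transpose i j \<circ> transpose j (Suc j)"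
      using ij by (auto simp: fun_eq_iff transpose_def)
    then have "Gpol n \<mu> (z \<circ> transpose i (Suc j)) =
        Gpol n \<mu> (z \<circ> transpose j (Suc j) \<circ> transpose i j \<circ> transpose j (Suc j))"
      by (simp add: comp_assoc)
    also have "\<dots> = Gpol n \<mu> (z \<circ> transpose j (Suc j) \<circ> transpose i j)"
      by (rule Gpol_adjacent) (use assms(1) ij Suc.prems in auto)
    also have "\<dots> = Gpol n \<mu> (z \<circ> transpose j (Suc j))"
      by (rule Suc.IH[OF ij]) (use Suc.prems in auto)
    also have "\<dots> = Gpol n \<mu> z"
      by (rule Gpol_adjacent) (use assms(1) ij Suc.prems in auto)
    finally show ?thesis .
  qed
qed simp

lemma Gpol_permutes:
  fixes z :: "nat \<Rightarrow> 'a :: comm_ring_1"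
  assumes p: "p permutes {1..n}"
  shows "Gpol n \<mu> (z \<circ> p) = Gpol n \<mu> z"
  using finite_atLeastAtMost p
proof (induction arbitrary: z rule: permutes_rev_induct)
  case id
  show ?case by simp
next
  case (swap a b p)
  have "Gpol n \<mu> (z \<circ> (p \<circ> transpose a b)) = Gpol n \<mu> (z \<circ> p \<circ> transpose a b)" by (simp add: comp_assoc)
  also have "\<dots> = Gpol n \<mu> (z \<circ> p)"
  proof -
    consider "a < b" | "b < a" using swap by linarith
    then show ?thesis
    proof cases
      case 1
      then show ?thesis by (intro Gpol_transpose) (use swap in auto)
    next
      case 2
      then show ?thesis unfolding transpose_commute[of a b] by (intro Gpol_transpose) (use swap in auto)
    qed
  qed
  also have "\<dots> = Gpol n \<mu> z" by (rule swap)
  finally show ?case .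
qed

lemma Gpol_Kdet:
  fixes z :: "nat \<Rightarrow> 'a :: comm_ring_1"
  assumes lam: "lam \<in> par n"
  shows "Gpol n \<mu> z * Kdet n z lam =
    (\<Sum>D\<in>{D\<in>pat n \<mu>. good n lam D}. (-1) ^ num_extra n D * Kdet n z (\<lambda>j. lam j + pat_weight n D j))"
proof -
  let ?f = "\<lambda>D. altsum n (\<lambda>p. alt_monomial n lam (z \<circ> p) * pat_monomial n D (z \<circ> p))"
  have f: "?f D = (-1) ^ num_extra n D * Kdet n z (\<lambda>j. lam j + pat_weight n D j)" for D
    unfolding alt_monomial_pat_monomial altsum_mult Kdet_altsum ..
  have fin: "finite (pat n \<mu>)" by (rule finite_pat)
  have zero: "(\<Sum>D\<in>{D\<in>pat n \<mu>. first_violation n lam i r D}. ?f D) = 0" for i r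
  proof -
    let ?X = "{D\<in>pat n \<mu>. first_violation n lam i r D}"
    have "(\<Sum>D\<in>?X. ?f D) = (\<Sum>e\<in>erase i r ` ?X. \<Sum>D\<in>{D\<in>?X. erase i r D = e}. ?f D)"
      by (rule sum.image_gen) (use fin in auto)
    also have "\<dots> = 0"
    proof (rule sum.neutral, rule ballI)
      fix e assume "e \<in> erase i r ` ?X"
      then obtain D0 where D0: "D0 \<in> pat n \<mu>" "first_violation n lam i r D0" "e = erase i r D0" by auto
      then have ir: "i \<in> {1..n}" "Suc i \<in> {1..n}" "i \<noteq> Suc i" by (auto simp: first_violation_def)
      let ?Y = "{D \<in> pat n \<mu>. first_violation n lam i r D \<and> erase i r D = erase i r D0}"
      have "(\<Sum>D\<in>{D\<in>?X. erase i r D = e}. ?f D) = (\<Sum>D\<in>?Y. ?f D)"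
        by (rule sum.cong) (auto simp: D0(3))
      also have "\<dots> = altsum n (\<lambda>p. alt_monomial n lam (z \<circ> p) * (\<Sum>D\<in>?Y. pat_monomial n D (z \<circ> p)))"
        unfolding altsum_sum[symmetric] sum_distrib_left ..
      also have "\<dots> = 0"
        by (rule altsum_eq_0[OF ir])
           (use class_cancel[OF D0(1,2) lam, of "z \<circ> p" for p] in \<open>simp add: comp_assoc\<close>)
      finally show "(\<Sum>D\<in>{D\<in>?X. erase i r D = e}. ?f D) = 0" .
    qed
    finally show ?thesis .
  qed
  \<comment> \<open>By symmetry G may be evaluated at the permuted variables and thus moves under
    the alternating sum.\<close>
  have "Gpol n \<mu> z * Kdet n z lam = altsum n (\<lambda>p. Gpol n \<mu> (z \<circ> p) * alt_monomial n lam (z \<circ> p))"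
    unfolding Kdet_altsum altsum_mult[symmetric]
    by (rule altsum_cong) (simp add: Gpol_permutes)
  also have "\<dots> = (\<Sum>D\<in>pat n \<mu>. ?f D)"
    unfolding Gpol_def altsum_sum[symmetric] by (simp add: sum_distrib_left mult.commute)
  also have "\<dots> = (\<Sum>D\<in>{D\<in>pat n \<mu>. good n lam D}. ?f D) + (\<Sum>D\<in>{D\<in>pat n \<mu>. \<not> good n lam D}. ?f D)"
    by (subst sum.union_disjoint[symmetric]) (use fin in \<open>auto intro!: sum.cong\<close>)
  also have "(\<Sum>D\<in>{D\<in>pat n \<mu>. \<not> good n lam D}. ?f D) =
      (\<Sum>ir\<in>{1..<n} \<times> {1..n}. \<Sum>D\<in>{D\<in>pat n \<mu>. first_violation n lam (fst ir) (snd ir) D}. ?f D)"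
  proof -
    have "{D\<in>pat n \<mu>. \<not> good n lam D} =
        (\<Union>ir\<in>{1..<n} \<times> {1..n}. {D\<in>pat n \<mu>. first_violation n lam (fst ir) (snd ir) D})"
    proof (intro set_eqI iffI)
      fix D assume "D \<in> {D\<in>pat n \<mu>. \<not> good n lam D}"
      then obtain i r where "D \<in> pat n \<mu>" "first_violation n lam i r D" using first_violation_exists by blast
      then show "D \<in> (\<Union>ir\<in>{1..<n} \<times> {1..n}. {D\<in>pat n \<mu>. first_violation n lam (fst ir) (snd ir) D})"
        by (intro UN_I[of "(i, r)"]) (auto simp: first_violation_def)
    qed (auto simp: first_violation_def good_def)
    moreover have "{D\<in>pat n \<mu>. first_violation n lam (fst ir) (snd ir) D} \<inter>
        {D\<in>pat n \<mu>. first_violation n lam (fst ir') (snd ir') D} = {}" if "ir \<noteq> ir'" for ir ir'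
      using that first_violation_unique by (auto simp: prod_eq_iff)
    ultimately show ?thesis
      using fin by (simp only:) (subst sum.UNION_disjoint; auto)
  qed
  finally show ?thesis unfolding zero unfolding f by simp
qed

section \<open>Linear independence of the alternants and the coefficient identity\<close>

text \<open>The superstandard tableau: every cell of row r holds just the letter r.\<close>

definition superstd :: "nat \<Rightarrow> (nat \<Rightarrow> nat) \<Rightarrow> pattern" where
  "superstd n \<mu> = (\<lambda>k r. if r \<le> k \<and> k \<le> n then \<mu> r else 0, \<lambda>k r. 0)"

lemma superstd_in_pat:
  assumes m: "\<mu> \<in> par n"
  shows "superstd n \<mu> \<in> pat n \<mu>"
  unfolding superstd_def pat_def using m by (auto simp: par_def fun_eq_iff not_le Suc_le_eq)

lemma row_count_superstd:
  assumes m: "\<mu> \<in> par n" and "1 \<le> k"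
  shows "row_count (superstd n \<mu>) k s = (if s = k \<and> k \<le> n then \<mu> k else 0)"
proof -
  obtain k' where "k = Suc k'" using assms(2) by (cases k) auto
  then show ?thesis by (simp add: row_count_def superstd_def)
qed

lemma good_superstd:
  assumes m: "\<mu> \<in> par n"
  shows "good n (\<lambda>_. 0) (superstd n \<mu>)"
  unfolding good_def violation_def
proof (intro ballI)
  fix i r assume ir: "i \<in> {1..<n}" "r \<in> {1..n}"
  then have "\<mu> (Suc i) \<le> \<mu> i" using parD(2)[OF m, of i] by simp
  then show "\<not> 0 + (\<Sum>s=1..<r. row_count (superstd n \<mu>) i s) < 0 + (\<Sum>s=1..r. row_count (superstd n \<mu>) (Suc i) s)"
    using ir by (simp add: row_count_superstd[OF m] sum.delta)
qed

lemma pat_weight_superstd: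
  assumes m: "\<mu> \<in> par n"
  shows "pat_weight n (superstd n \<mu>) = \<mu>"
proof
  fix k show "pat_weight n (superstd n \<mu>) k = \<mu> k"
  proof (cases "1 \<le> k")
    case True
    then show ?thesis using parD(3)[OF m, of k]
      by (cases "k \<le> n") (simp_all add: pat_weight_def row_count_superstd[OF m True] sum.delta)
  next
    case False
    then have "k = 0" by simp
    then show ?thesis using parD(1)[OF m] by (auto simp: pat_weight_def row_count_def superstd_def)
  qed
qed

lemma num_extra_superstd: "num_extra n (superstd n \<mu>) = 0"
  by (simp add: num_extra_def superstd_def)

text \<open>By induction on r, row r has no letter above r: for i \<ge> r the rows below r contain
  no i, so the condition at (i, r) excludes i+1 from row r. Letters below r are excluded by column
  strictness (\<open>pat_row_0\<close>).\<close>

lemma good_zero_unique: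
  assumes D: "D \<in> pat n \<mu>" and g: "good n (\<lambda>_. 0) D"
  shows "D = superstd n \<mu>"
proof -
  obtain \<rho> \<epsilon> where De: "D = (\<rho>, \<epsilon>)" by force
  note P = D[unfolded De]
  have c0: "\<forall>k. r < k \<longrightarrow> k \<le> n \<longrightarrow> row_count D k r = 0" if "1 \<le> r" for r
    using that
  proof (induction r rule: less_induct)
    case (less r)
    show ?case
    proof (intro allI impI)
      fix k assume k: "r < k" "k \<le> n"
      then obtain i where i: "k = Suc i" "r \<le> i" by (cases k) auto
      have "\<not> violation (\<lambda>_. 0) D i r" using g i k less.prems by (auto simp: good_def)
      moreover have "(\<Sum>s=1..<r. row_count D i s) = 0" using less.IH i k by auto
      ultimately show "row_count D k r = 0" using less.prems by (auto simp: violation_def i(1))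
    qed
  qed
  have rho: "\<rho> k r = \<mu> r" if "r \<le> k" "k \<le> n" "1 \<le> r" for k r
    using that(2,1)
  proof (induction k rule: inc_induct)
    case base
    then show ?case using patD(2)[OF P] by simp
  next
    case (step k)
    have "row_count D (Suc k) r = 0" using c0[of r] step that(3) by auto
    then have "\<rho> (Suc k) r \<le> \<rho> k r" by (simp add: row_count_def De)
    then show ?case using step pat_mono[OF P, of k r] by simp
  qed
  have eps: "\<epsilon> k r = 0" for k r
  proof (cases "1 \<le> r \<and> r < k \<and> k \<le> n")
    case True
    then have "row_count D k r = 0" using c0[of r] by auto
    then show ?thesis by (simp add: row_count_def De)
  next
    case False
    then show ?thesis using pat_eps_0[OF P, of k r] by auto
  qed
  have "\<rho> k r = (if r \<le> k \<and> k \<le> n then \<mu> r else 0)" for k r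
  proof (cases "r = 0")
    case True
    have "\<rho> k 0 = 0" "\<mu> 0 = 0" using patD(2,4)[OF P] by auto
    then show ?thesis using True by simp
  next
    case False
    then show ?thesis using rho[of r k] pat_row_0[OF P, of k r] patD(3)[OF P] by (auto simp: not_le)
  qed
  then show ?thesis using eps by (simp add: De superstd_def fun_eq_iff)
qed

lemma zero_par [simp]: "(\<lambda>_. 0) \<in> par n"
  by (simp add: par_def)

lemma Gpol_Kdet_zero:
  assumes m: "\<mu> \<in> par n"
  shows "Gpol n \<mu> z * Kdet n z (\<lambda>_. 0) = Kdet n z \<mu>"
proof -
  have "{D\<in>pat n \<mu>. good n (\<lambda>_. 0) D} = {superstd n \<mu>}"
    using superstd_in_pat[OF m] good_superstd[OF m] good_zero_unique by blast
  then show ?thesis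
    using Gpol_Kdet[of "\<lambda>_. 0" n \<mu> z] by (simp add: pat_weight_superstd[OF m] num_extra_superstd)
qed

section \<open>Iterating the Pieri rule\<close>

text \<open>Counts chains of shapes from \<open>lam\<close> to \<open>\<nu>\<close> whose i-th step
  meets \<open>\<alpha> i\<close> columns. Iterated multiplication of alternants and reverse plane
  partitions are both reduced to it, in \<open>complete_sym_prod_Kdet\<close> and
  \<open>card_rpps\<close>.\<close>

fun chain_count :: "nat \<Rightarrow> nat \<Rightarrow> (nat \<Rightarrow> nat) \<Rightarrow> (nat \<Rightarrow> nat) \<Rightarrow> (nat \<Rightarrow> nat) \<Rightarrow> nat" where
  "chain_count n 0 lam \<nu> \<alpha> = of_bool (lam = \<nu>)"
| "chain_count n (Suc N) lam \<nu> \<alpha> = (\<Sum>\<kappa>\<in>{\<kappa>\<in>interval n lam \<nu>. ncols n \<kappa> \<nu> = \<alpha> (Suc N)}. chain_count n N lam \<kappa> \<alpha>)"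

lemma ncols_row_1:
  assumes "n \<ge> 1"
  shows "\<nu> 1 \<le> \<kappa> 1 + ncols n \<kappa> \<nu>"
proof -
  have "\<nu> 1 - \<kappa> 1 \<le> ncols n \<kappa> \<nu>"
    unfolding ncols_def using member_le_sum[of 1 "{1..n}" "\<lambda>j. (if j = 1 then \<nu> 1 else min (\<kappa> (j - 1)) (\<nu> j)) - \<kappa> j"] assms
    by simp
  then show ?thesis by simp
qed

text \<open>Confines the end points of chains to a box that is known in advance.\<close>

lemma chain_count_nonzero:
  assumes n: "n \<ge> 1"
  shows "chain_count n N lam \<nu> \<alpha> \<noteq> 0 \<Longrightarrow> lam \<le> \<nu> \<and> \<nu> 1 \<le> lam 1 + (\<Sum>i=1..N. \<alpha> i)"
proof (induction N arbitrary: \<nu>)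
  case 0
  then show ?case by (auto split: if_splits)
next
  case (Suc N)
  have "\<exists>\<kappa>\<in>{\<kappa>\<in>interval n lam \<nu>. ncols n \<kappa> \<nu> = \<alpha> (Suc N)}. chain_count n N lam \<kappa> \<alpha> \<noteq> 0"
  proof (rule ccontr)
    assume "\<not> ?thesis"
    then have "chain_count n (Suc N) lam \<nu> \<alpha> = 0" by (simp del: sum_eq_0_iff add: sum.neutral)
    then show False using Suc.prems by simp
  qed
  then obtain \<kappa> where k: "\<kappa> \<in> interval n lam \<nu>" "ncols n \<kappa> \<nu> = \<alpha> (Suc N)" "chain_count n N lam \<kappa> \<alpha> \<noteq> 0"
    by blast
  then show ?case using Suc.IH[OF k(3)] ncols_row_1[OF n, of \<nu> \<kappa>] by (auto simp: interval_def)
qed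

definition complete_sym_prod :: "nat \<Rightarrow> (nat \<Rightarrow> 'a) \<Rightarrow> nat \<Rightarrow> (nat \<Rightarrow> nat) \<Rightarrow> 'a :: comm_ring_1" where
  "complete_sym_prod n z N \<alpha> = (\<Prod>i=1..N. complete_sym n z (\<alpha> i))"

text \<open>\<open>M\<close> is left general so that the induction can use a smaller box for the
  chains that are one step shorter.\<close>

lemma complete_sym_prod_Kdet:
  fixes z :: "nat \<Rightarrow> 'a :: idom"
  assumes n: "n \<ge> 1" and l: "lam \<in> par n" and z: "\<And>i. i \<in> {1..n} \<Longrightarrow> z i \<noteq> 1"
  shows "lam 1 + (\<Sum>i=1..N. \<alpha> i) \<le> M \<Longrightarrow>
    complete_sym_prod n z N \<alpha> * Kdet n z lam = (\<Sum>\<nu>\<in>box n M. of_nat (chain_count n N lam \<nu> \<alpha>) * Kdet n z \<nu>)"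
proof (induction N arbitrary: M)
  case 0
  then have "lam \<in> box n M" using l by (simp add: box_def)
  then show ?case by (simp add: complete_sym_prod_def of_bool_def if_distrib[of of_nat] if_distrib[of "\<lambda>x. x * _"] sum.delta cong: if_cong)
next
  case (Suc N)
  let ?a = "\<alpha> (Suc N)"
  define M' where "M' = M - ?a"
  have M': "lam 1 + (\<Sum>i=1..N. \<alpha> i) \<le> M'" using Suc.prems by (simp add: M'_def)
  have Ma: "M' + ?a \<le> M" using Suc.prems by (simp add: M'_def)
  have "complete_sym_prod n z (Suc N) \<alpha> * Kdet n z lam = complete_sym n z ?a * (complete_sym_prod n z N \<alpha> * Kdet n z lam)"
    by (simp add: complete_sym_prod_def mult_ac)
  also have "\<dots> = (\<Sum>\<kappa>\<in>box n M'. of_nat (chain_count n N lam \<kappa> \<alpha>) * (complete_sym n z ?a * Kdet n z \<kappa>))"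
    unfolding Suc.IH[OF M'] by (simp add: sum_distrib_left mult_ac)
  also have "\<dots> = (\<Sum>\<kappa>\<in>box n M'. \<Sum>\<nu>\<in>{\<nu>\<in>box n M. \<kappa> \<le> \<nu> \<and> ncols n \<kappa> \<nu> = ?a}. of_nat (chain_count n N lam \<kappa> \<alpha>) * Kdet n z \<nu>)"
  proof (intro sum.cong refl)
    fix \<kappa> assume k: "\<kappa> \<in> box n M'"
    then have kp: "\<kappa> \<in> par n" by (simp add: box_def)
    have "{\<nu>\<in>par n. \<kappa> \<le> \<nu> \<and> ncols n \<kappa> \<nu> = ?a} = {\<nu>\<in>box n M. \<kappa> \<le> \<nu> \<and> ncols n \<kappa> \<nu> = ?a}"
    proof -
      have "\<nu> 1 \<le> M" if "ncols n \<kappa> \<nu> = ?a" for \<nu>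
        using ncols_row_1[OF n, of \<nu> \<kappa>] k Ma that by (simp add: box_def)
      then show ?thesis by (auto simp: box_def)
    qed
    then show "of_nat (chain_count n N lam \<kappa> \<alpha>) * (complete_sym n z ?a * Kdet n z \<kappa>) =
        (\<Sum>\<nu>\<in>{\<nu>\<in>box n M. \<kappa> \<le> \<nu> \<and> ncols n \<kappa> \<nu> = ?a}. of_nat (chain_count n N lam \<kappa> \<alpha>) * Kdet n z \<nu>)"
      using pieri[where k = ?a, OF n kp z] by (simp add: sum_distrib_left)
  qed
  also have "\<dots> = (\<Sum>\<nu>\<in>box n M. \<Sum>\<kappa>\<in>{\<kappa>\<in>box n M'. \<kappa> \<le> \<nu> \<and> ncols n \<kappa> \<nu> = ?a}. of_nat (chain_count n N lam \<kappa> \<alpha>) * Kdet n z \<nu>)"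
    by (rule sum.swap_restrict) auto
  also have "\<dots> = (\<Sum>\<nu>\<in>box n M. of_nat (chain_count n (Suc N) lam \<nu> \<alpha>) * Kdet n z \<nu>)"
  proof (intro sum.cong refl)
    fix \<nu> assume v: "\<nu> \<in> box n M"
    have "(\<Sum>\<kappa>\<in>{\<kappa>\<in>box n M'. \<kappa> \<le> \<nu> \<and> ncols n \<kappa> \<nu> = ?a}. chain_count n N lam \<kappa> \<alpha>) =
        (\<Sum>\<kappa>\<in>{\<kappa>\<in>interval n lam \<nu>. ncols n \<kappa> \<nu> = ?a \<and> \<kappa> 1 \<le> M'}. chain_count n N lam \<kappa> \<alpha>)"
    proof (rule sum.mono_neutral_right)
      show "finite {\<kappa>\<in>box n M'. \<kappa> \<le> \<nu> \<and> ncols n \<kappa> \<nu> = ?a}" by simp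
    qed (use chain_count_nonzero[OF n, of N lam _ \<alpha>] in \<open>auto simp: interval_def box_def\<close>)
    also have "\<dots> = (\<Sum>\<kappa>\<in>{\<kappa>\<in>interval n lam \<nu>. ncols n \<kappa> \<nu> = ?a}. chain_count n N lam \<kappa> \<alpha>)"
    proof (rule sum.mono_neutral_left)
      have "finite (interval n lam \<nu>)" using v by (intro finite_interval) (simp add: box_def)
      then show "finite {\<kappa>\<in>interval n lam \<nu>. ncols n \<kappa> \<nu> = ?a}" by simp
    qed (use chain_count_nonzero[OF n, of N lam _ \<alpha>] M' in \<open>fastforce+\<close>)
    finally have e: "(\<Sum>\<kappa>\<in>{\<kappa>\<in>box n M'. \<kappa> \<le> \<nu> \<and> ncols n \<kappa> \<nu> = ?a}. chain_count n N lam \<kappa> \<alpha>) = chain_count n (Suc N) lam \<nu> \<alpha>"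
      by simp
    show "(\<Sum>\<kappa>\<in>{\<kappa>\<in>box n M'. \<kappa> \<le> \<nu> \<and> ncols n \<kappa> \<nu> = ?a}. of_nat (chain_count n N lam \<kappa> \<alpha>) * Kdet n z \<nu>) =
        of_nat (chain_count n (Suc N) lam \<nu> \<alpha>) * Kdet n z \<nu>"
      unfolding e[symmetric] of_nat_sum sum_distrib_right ..
  qed
  finally show ?case .
qed

section \<open>Linear independence by Kronecker substitution\<close>

text \<open>The highest differing digit decides, because the lower digits of \<open>f\<close>
  together stay below W^i.\<close>

lemma digits_less:
  fixes f h :: "nat \<Rightarrow> nat"
  assumes i: "i \<in> {1..n}" and lt: "f i < h i" and top: "\<And>j. i < j \<Longrightarrow> j \<le> n \<Longrightarrow> f j = h j"
    and dig: "\<And>j. 1 \<le> j \<Longrightarrow> j < i \<Longrightarrow> f j < W" and W: "W \<ge> 1"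
  shows "(\<Sum>j=1..n. f j * W ^ j) < (\<Sum>j=1..n. h j * W ^ j)"
proof -
  have low: "k \<le> i \<Longrightarrow> (\<Sum>j=1..<k. f j * W ^ j) < W ^ k" for k
  proof (induction k)
    case 0
    then show ?case by simp
  next
    case (Suc k)
    show ?case
    proof (cases "k = 0")
      case True
      then show ?thesis using W by simp
    next
      case False
      then have k: "1 \<le> k" "k < i" using Suc.prems by auto
      have "{1..<Suc k} = insert k {1..<k}" using k by auto
      then have "(\<Sum>j=1..<Suc k. f j * W ^ j) = f k * W ^ k + (\<Sum>j=1..<k. f j * W ^ j)" by simp
      moreover have "Suc (f k) * W ^ k \<le> W * W ^ k" using dig[OF k] by (intro mult_right_mono) auto
      ultimately show ?thesis using Suc.IH k by auto
    qed
  qed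
  have split: "(\<Sum>j=1..n. e j * W ^ j) = (\<Sum>j=1..<i. e j * W ^ j) + (e i * W ^ i + (\<Sum>j=Suc i..n. e j * W ^ j))" for e
  proof -
    have "{1..n} = {1..<i} \<union> ({i} \<union> {Suc i..n})" using i by auto
    then have "(\<Sum>j=1..n. e j * W ^ j) = (\<Sum>j\<in>{1..<i} \<union> ({i} \<union> {Suc i..n}). e j * W ^ j)" by simp
    also have "\<dots> = (\<Sum>j=1..<i. e j * W ^ j) + (\<Sum>j\<in>{i} \<union> {Suc i..n}. e j * W ^ j)"
      by (rule sum.union_disjoint) auto
    also have "(\<Sum>j\<in>{i} \<union> {Suc i..n}. e j * W ^ j) = e i * W ^ i + (\<Sum>j=Suc i..n. e j * W ^ j)"
      by (subst sum.union_disjoint) auto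
    finally show ?thesis .
  qed
  have t: "(\<Sum>j=Suc i..n. f j * W ^ j) = (\<Sum>j=Suc i..n. h j * W ^ j)"
    by (intro sum.cong refl) (simp add: top)
  have "Suc (f i) * W ^ i \<le> h i * W ^ i" using lt by (intro mult_right_mono) auto
  then show ?thesis unfolding split t using low[of i] by simp
qed

text \<open>Kronecker substitution $z_j = X^{W^j}$: the exponent vector of a monomial becomes the digits in base $W$ of
one exponent, and the diagonal term of an alternant has the least exponent.\<close>

definition kron_var :: "nat \<Rightarrow> nat \<Rightarrow> int poly" where
  "kron_var W j = monom 1 (W ^ j)"

definition kron_exponent :: "nat \<Rightarrow> nat \<Rightarrow> (nat \<Rightarrow> nat) \<Rightarrow> nat" where
  "kron_exponent n W \<nu> = (\<Sum>j=1..n. (\<nu> j + n - j) * W ^ j)"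

lemma coeff_of_int_mult: "coeff (of_int k * p) m = k * coeff (p :: int poly) m"
  by (simp add: of_int_poly)

lemma coeff_0_prod: "coeff (prod f A) 0 = (\<Prod>a\<in>A. coeff (f a :: int poly) 0)"
  by (induction A rule: infinite_finite_induct) (auto simp: coeff_mult)

lemma coeff_0_power: "coeff (p ^ m) 0 = (coeff (p :: int poly) 0) ^ m"
  by (induction m) (auto simp: coeff_mult)

text \<open>The powers of 1 - z have constant term 1, so each permutation contributes a single
  lowest monomial with coefficient 1.\<close>

lemma prod_kron_var:
  assumes "W \<ge> 1"
  shows "\<exists>q. (\<Prod>j=1..n. alt_entry n (kron_var W) j (\<nu> j) (p j)) =
      monom 1 (\<Sum>j=1..n. (\<nu> j + n - j) * W ^ p j) * q \<and> coeff q 0 = 1"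
proof -
  let ?q = "\<Prod>j=1..n. (1 - kron_var W (p j)) ^ (j - 1)"
  have m: "(\<Prod>j\<in>A. monom 1 (e j)) = (monom 1 (\<Sum>j\<in>A. e j) :: int poly)" for A :: "nat set" and e :: "nat \<Rightarrow> nat"
    by (induction A rule: infinite_finite_induct) (auto simp: mult_monom)
  have "(\<Prod>j=1..n. alt_entry n (kron_var W) j (\<nu> j) (p j)) = (\<Prod>j=1..n. kron_var W (p j) ^ (\<nu> j + n - j)) * ?q"
    by (simp add: alt_entry_def prod.distrib)
  also have "(\<Prod>j=1..n. kron_var W (p j) ^ (\<nu> j + n - j)) = monom 1 (\<Sum>j=1..n. (\<nu> j + n - j) * W ^ p j)"
    by (simp add: kron_var_def monom_power m mult.commute)
  finally have "(\<Prod>j=1..n. alt_entry n (kron_var W) j (\<nu> j) (p j)) =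
      monom 1 (\<Sum>j=1..n. (\<nu> j + n - j) * W ^ p j) * ?q" .
  moreover have "coeff ?q 0 = 1"
    using assms by (simp add: coeff_0_prod coeff_0_power kron_var_def)
  ultimately show ?thesis by blast
qed

text \<open>The exponents \<nu> j + n - j strictly decrease in j while the weights W^j increase, so
  the identity pairs them with the least total. The comparison is decided at the largest index moved
  by the inverse permutation.\<close>

lemma kron_exponent_permute:
  assumes nu: "\<nu> \<in> par n" and W: "\<nu> 1 + n < W" and p: "p permutes {1..n}" "p \<noteq> id"
  shows "kron_exponent n W \<nu> < (\<Sum>j=1..n. (\<nu> j + n - j) * W ^ p j)"
proof -
  let ?\<gamma> = "\<lambda>j. \<nu> j + n - j"
  define q where "q = inv p"
  have q: "q permutes {1..n}" unfolding q_def by (rule permutes_inv[OF p(1)])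
  have pq: "p (q j) = j" for j unfolding q_def by (rule permutes_inverses[OF p(1)])
  have qne: "q \<noteq> id" using pq p(2) by (metis comp_id eq_id_iff ext o_apply)
  have "(\<Sum>j=1..n. ?\<gamma> j * W ^ p j) = (\<Sum>j=1..n. ?\<gamma> (q j) * W ^ j)"
    using sum.permute[OF q, of "\<lambda>j. ?\<gamma> j * W ^ p j"] by (simp add: o_def pq)
  moreover have "kron_exponent n W \<nu> < (\<Sum>j=1..n. ?\<gamma> (q j) * W ^ j)"
    unfolding kron_exponent_def
  proof -
    let ?I = "{i\<in>{1..n}. q i \<noteq> i}"
    have ne: "?I \<noteq> {}"
    proof
      assume "?I = {}"
      then have "q i = i" for i using permutes_not_in[OF q, of i] by (cases "i \<in> {1..n}") auto
      then show False using qne by auto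
    qed
    define i where "i = Max ?I"
    have i: "i \<in> ?I" unfolding i_def by (rule Max_in) (use ne in auto)
    have top: "q j = j" if "i < j" "j \<le> n" for j
    proof (rule ccontr)
      assume "q j \<noteq> j"
      then have "j \<in> ?I" using that by auto
      then have "j \<le> i" unfolding i_def by (intro Max_ge) auto
      then show False using that by simp
    qed
    have qi: "q i \<in> {1..n}" using i permutes_in_image[OF q, of i] by auto
    \<comment> \<open>All larger indices are fixed by \<open>q\<close>, so the largest moved index
      must be sent down.\<close>
    have "q i < i"
    proof (rule ccontr)
      assume "\<not> q i < i"
      then have "i < q i" using i by auto
      then have "q (q i) = q i" using top qi by auto
      then have "q i = i" using permutes_inj[OF q] by (auto simp: inj_def)
      then show False using i by simp
    qed
    then have "\<nu> i \<le> \<nu> (q i)" using par_antimono[OF nu, of "q i" i] qi by simp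
    then have "?\<gamma> i < ?\<gamma> (q i)" using \<open>q i < i\<close> i by auto
    then show "(\<Sum>j=1..n. ?\<gamma> j * W ^ j) < (\<Sum>j=1..n. ?\<gamma> (q j) * W ^ j)"
    proof (rule digits_less[rotated])
      show "?\<gamma> j < W" if "1 \<le> j" for j using par_antimono[OF nu, of 1 j] that W by auto
    qed (use i top W in auto)
  qed
  ultimately show ?thesis by simp
qed

lemma coeff_Kdet:
  assumes nu: "\<nu> \<in> par n" and W: "\<nu> 1 + n < W" and m: "m \<le> kron_exponent n W \<nu>"
  shows "coeff (Kdet n (kron_var W) \<nu>) m = of_bool (m = kron_exponent n W \<nu>)"
proof -
  let ?t = "\<lambda>p. \<Prod>j=1..n. alt_entry n (kron_var W) j (\<nu> j) (p j)"
  have c: "coeff (?t p) m = of_bool (p = id \<and> m = kron_exponent n W \<nu>)" if p: "p permutes {1..n}" for p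
  proof -
    obtain q where q: "?t p = monom 1 (\<Sum>j=1..n. (\<nu> j + n - j) * W ^ p j) * q" "coeff q 0 = 1"
      using prod_kron_var[of W n \<nu> p] W by auto
    show ?thesis
    proof (cases "p = id")
      case True
      then show ?thesis using q m by (auto simp: coeff_monom_mult kron_exponent_def)
    next
      case False
      then show ?thesis using q m kron_exponent_permute[OF nu W p] by (auto simp: coeff_monom_mult)
    qed
  qed
  have "coeff (Kdet n (kron_var W) \<nu>) m = (\<Sum>p | p permutes {1..n}. sign p * coeff (?t p) m)"
    unfolding Kdet_def rows_det_def altsum_def by (simp add: coeff_sum coeff_of_int_mult)
  also have "\<dots> = (\<Sum>p | p permutes {1..n}. if p = id then of_bool (m = kron_exponent n W \<nu>) else 0)"
    by (intro sum.cong refl) (auto simp: c)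
  also have "\<dots> = of_bool (m = kron_exponent n W \<nu>)"
    by (subst sum.delta) (auto simp: finite_permutations permutes_id)
  finally show ?thesis .
qed

lemma kron_exponent_inj:
  assumes "\<nu> \<in> par n" "\<kappa> \<in> par n" "\<nu> 1 + n < W" "\<kappa> 1 + n < W" "kron_exponent n W \<nu> = kron_exponent n W \<kappa>"
  shows "\<nu> = \<kappa>"
proof (rule ccontr)
  assume ne: "\<nu> \<noteq> \<kappa>"
  let ?I = "{i\<in>{1..n}. \<nu> i \<noteq> \<kappa> i}"
  have ne': "?I \<noteq> {}"
  proof
    assume e: "?I = {}"
    have "\<nu> i = \<kappa> i" for i
    proof (cases "i \<in> {1..n}")
      case False
      then show ?thesis using assms(1,2) by (cases "i = 0") (auto simp: par_def)
    qed (use e in auto)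
    then show False using ne by auto
  qed
  define i where "i = Max ?I"
  have i: "i \<in> ?I" unfolding i_def by (rule Max_in) (use ne' in auto)
  have top: "\<nu> j = \<kappa> j" if "i < j" "j \<le> n" for j
  proof (rule ccontr)
    assume "\<nu> j \<noteq> \<kappa> j"
    then have "j \<in> ?I" using that by auto
    then have "j \<le> i" unfolding i_def by (intro Max_ge) auto
    then show False using that by simp
  qed
  have dig: "\<nu> j + n - j < W" "\<kappa> j + n - j < W" if "1 \<le> j" for j
    using par_antimono[OF assms(1), of 1 j] par_antimono[OF assms(2), of 1 j] that assms(3,4) by auto
  have "kron_exponent n W \<nu> \<noteq> kron_exponent n W \<kappa>"
  proof (cases "\<nu> i < \<kappa> i")
    case True
    then have "kron_exponent n W \<nu> < kron_exponent n W \<kappa>" unfolding kron_exponent_def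
      by (intro digits_less[of i]) (use i top dig assms(3) in auto)
    then show ?thesis by simp
  next
    case False
    then have "\<kappa> i < \<nu> i" using i by auto
    then have "kron_exponent n W \<kappa> < kron_exponent n W \<nu>" unfolding kron_exponent_def
      by (intro digits_less[of i]) (use i top dig assms(3) in auto)
    then show ?thesis by simp
  qed
  then show False using assms(5) by simp
qed

text \<open>Among the shapes with nonzero coefficient take one with least exponent. By
  \<open>coeff_Kdet\<close> and \<open>kron_exponent_inj\<close> no other alternant contributes to
  that power of X.\<close>

lemma Kdet_independent:
  assumes fin: "finite S" and S: "\<And>\<nu>. \<nu> \<in> S \<Longrightarrow> \<nu> \<in> par n \<and> \<nu> 1 + n < W"
    and zero: "(\<Sum>\<nu>\<in>S. of_int (c \<nu>) * Kdet n (kron_var W) \<nu>) = 0" and nu: "\<nu> \<in> S"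
  shows "c \<nu> = 0"
proof (rule ccontr)
  assume "c \<nu> \<noteq> 0"
  let ?T = "{\<nu>\<in>S. c \<nu> \<noteq> 0}"
  have "finite (kron_exponent n W ` ?T)" "kron_exponent n W ` ?T \<noteq> {}" using fin nu \<open>c \<nu> \<noteq> 0\<close> by auto
  then have "Min (kron_exponent n W ` ?T) \<in> kron_exponent n W ` ?T" by (rule Min_in)
  then obtain \<kappa> where k: "\<kappa> \<in> ?T" "Min (kron_exponent n W ` ?T) = kron_exponent n W \<kappa>" by blast
  have mn: "kron_exponent n W \<kappa> \<le> kron_exponent n W \<eta>" if "\<eta> \<in> ?T" for \<eta>
    unfolding k(2)[symmetric] using fin that by (intro Min_le) auto
  have "0 = coeff (\<Sum>\<nu>\<in>S. of_int (c \<nu>) * Kdet n (kron_var W) \<nu>) (kron_exponent n W \<kappa>)" using zero by simp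
  also have "\<dots> = (\<Sum>\<eta>\<in>S. c \<eta> * coeff (Kdet n (kron_var W) \<eta>) (kron_exponent n W \<kappa>))"
    by (simp add: coeff_sum coeff_of_int_mult)
  also have "\<dots> = (\<Sum>\<eta>\<in>S. if \<eta> = \<kappa> then c \<kappa> else 0)"
  proof (intro sum.cong refl)
    fix \<eta> assume e: "\<eta> \<in> S"
    show "c \<eta> * coeff (Kdet n (kron_var W) \<eta>) (kron_exponent n W \<kappa>) = (if \<eta> = \<kappa> then c \<kappa> else 0)"
    proof (cases "c \<eta> = 0")
      case False
      then have "kron_exponent n W \<kappa> \<le> kron_exponent n W \<eta>" using mn e by auto
      then have "coeff (Kdet n (kron_var W) \<eta>) (kron_exponent n W \<kappa>) = of_bool (kron_exponent n W \<kappa> = kron_exponent n W \<eta>)"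
        using S[OF e] by (intro coeff_Kdet) auto
      moreover have "\<eta> = \<kappa>" if eq: "kron_exponent n W \<eta> = kron_exponent n W \<kappa>"
      proof (rule kron_exponent_inj[OF _ _ _ _ eq])
        have "\<kappa> \<in> S" using k by simp
        then show "\<kappa> \<in> par n" "\<kappa> 1 + n < W" using S by auto
        show "\<eta> \<in> par n" "\<eta> 1 + n < W" using S[OF e] by auto
      qed
      ultimately show ?thesis by (cases "\<eta> = \<kappa>") auto
    qed (use k in auto)
  qed
  also have "\<dots> = c \<kappa>" using fin k by (simp add: sum.delta)
  finally show False using k by simp
qed

section \<open>The coefficient identity\<close>

definition signed_good_count :: "nat \<Rightarrow> (nat \<Rightarrow> nat) \<Rightarrow> (nat \<Rightarrow> nat) \<Rightarrow> (nat \<Rightarrow> nat) \<Rightarrow> int" where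
  "signed_good_count n lam \<nu> \<mu> = (\<Sum>D\<in>{D\<in>pat n \<mu>. good n lam D \<and> (\<lambda>j. lam j + pat_weight n D j) = \<nu>}. (-1) ^ num_extra n D)"

lemma row_count_outside:
  assumes "D \<in> pat n \<mu>" "k = 0 \<or> k > n"
  shows "row_count D k r = 0"
proof -
  obtain \<rho> \<epsilon> where De: "D = (\<rho>, \<epsilon>)" by force
  note P = assms(1)[unfolded De]
  show ?thesis using assms(2) patD(1,3)[OF P] pat_eps_0[OF P, of k r] by (auto simp: row_count_def De)
qed

text \<open>The condition at row \<open>n\<close> compares all letters i+1 with letters i, which
  makes \<open>lam\<close> plus the weight weakly decreasing.\<close>

lemma good_par:
  assumes lam: "lam \<in> par n" and D: "D \<in> pat n \<mu>" and g: "good n lam D" and n: "n \<ge> 1"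
  shows "(\<lambda>j. lam j + pat_weight n D j) \<in> par n"
proof -
  have z: "pat_weight n D j = 0" if "j = 0 \<or> j > n" for j
    using row_count_outside[OF D that] by (simp add: pat_weight_def)
  have "lam (Suc i) + pat_weight n D (Suc i) \<le> lam i + pat_weight n D i" if "i \<ge> 1" for i
  proof (cases "i < n")
    case True
    then have "\<not> violation lam D i n" using g that n by (auto simp: good_def)
    moreover have "(\<Sum>s=1..<n. row_count D i s) \<le> pat_weight n D i"
      unfolding pat_weight_def by (rule sum_mono2) auto
    ultimately show ?thesis by (simp add: violation_def pat_weight_def)
  next
    case False
    then show ?thesis using z[of "Suc i"] parD(2)[OF lam that] by simp
  qed
  then show ?thesis using z lam by (auto simp: par_def)
qed

lemma chain_count_eq_sum:
  assumes n: "n \<ge> 1" and lam: "lam \<in> par n" and nu: "\<nu> \<in> par n" and M: "(\<Sum>i=1..N. \<alpha> i) \<le> M"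
  shows "int (chain_count n N lam \<nu> \<alpha>) = (\<Sum>\<mu>\<in>box n M. int (chain_count n N (\<lambda>_. 0) \<mu> \<alpha>) * signed_good_count n lam \<nu> \<mu>)"
proof -
  let ?X = "\<lambda>\<mu>. {D\<in>pat n \<mu>. good n lam D}"
  let ?w = "\<lambda>D j. lam j + pat_weight n D j"
  \<comment> \<open>All shapes that occur on either side, together with \<nu>. Independence concerns
    one finite set, and \<open>W\<close> is chosen afterwards, large enough for all of it.\<close>
  define S where "S = box n (lam 1 + (\<Sum>i=1..N. \<alpha> i)) \<union> (\<Union>\<mu>\<in>box n M. ?w ` ?X \<mu>) \<union> {\<nu>}"
  have finX: "finite (?X \<mu>)" for \<mu> using finite_pat[of n \<mu>] by simp
  have finS: "finite S" unfolding S_def using finX by simp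
  have Sp: "\<kappa> \<in> par n" if "\<kappa> \<in> S" for \<kappa>
    using that nu good_par[OF lam _ _ n] by (auto simp: S_def box_def)
  define W where "W = Suc (n + (\<Sum>\<kappa>\<in>S. \<kappa> 1))"
  have SW: "\<kappa> \<in> par n \<and> \<kappa> 1 + n < W" if "\<kappa> \<in> S" for \<kappa>
    using Sp[OF that] member_le_sum[OF that, of "\<lambda>\<kappa>. \<kappa> 1"] finS by (simp add: W_def)
  let ?z = "kron_var W"
  let ?K = "Kdet n ?z"
  \<comment> \<open>The proof of \<open>pieri\<close> cancels the product of all 1 - z_i.\<close>
  have z1: "?z i \<noteq> 1" for i
  proof
    assume "?z i = 1"
    then have "degree (?z i) = 0" by simp
    moreover have "W \<ge> 1" by (simp add: W_def)
    ultimately show False by (simp add: kron_var_def degree_monom_eq)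
  qed
  have "complete_sym_prod n ?z N \<alpha> * ?K lam = (\<Sum>\<kappa>\<in>S. of_int (int (chain_count n N lam \<kappa> \<alpha>)) * ?K \<kappa>)"
  proof -
    have "complete_sym_prod n ?z N \<alpha> * ?K lam = (\<Sum>\<kappa>\<in>box n (lam 1 + (\<Sum>i=1..N. \<alpha> i)). of_nat (chain_count n N lam \<kappa> \<alpha>) * ?K \<kappa>)"
      by (rule complete_sym_prod_Kdet[OF n lam z1]) simp
    also have "\<dots> = (\<Sum>\<kappa>\<in>S. of_nat (chain_count n N lam \<kappa> \<alpha>) * ?K \<kappa>)"
    proof (rule sum.mono_neutral_left[OF finS])
      show "\<forall>\<kappa>\<in>S - box n (lam 1 + (\<Sum>i=1..N. \<alpha> i)). of_nat (chain_count n N lam \<kappa> \<alpha>) * ?K \<kappa> = 0"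
        using chain_count_nonzero[OF n, of N lam _ \<alpha>] Sp by (auto simp: box_def)
    qed (auto simp: S_def)
    finally show ?thesis by simp
  qed
  moreover have "complete_sym_prod n ?z N \<alpha> * ?K lam =
      (\<Sum>\<kappa>\<in>S. of_int (\<Sum>\<mu>\<in>box n M. int (chain_count n N (\<lambda>_. 0) \<mu> \<alpha>) * signed_good_count n lam \<kappa> \<mu>) * ?K \<kappa>)"
  proof -
    have GK: "Gpol n \<mu> ?z * ?K lam = (\<Sum>\<kappa>\<in>S. of_int (signed_good_count n lam \<kappa> \<mu>) * ?K \<kappa>)" if m: "\<mu> \<in> box n M" for \<mu>
    proof -
      have "Gpol n \<mu> ?z * ?K lam = (\<Sum>D\<in>?X \<mu>. (-1) ^ num_extra n D * ?K (?w D))"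
        by (rule Gpol_Kdet[OF lam])
      also have "\<dots> = (\<Sum>\<kappa>\<in>S. \<Sum>D\<in>{D\<in>?X \<mu>. ?w D = \<kappa>}. (-1) ^ num_extra n D * ?K (?w D))"
        by (rule sum.group[symmetric]) (use finX finS m in \<open>auto simp: S_def\<close>)
      also have "\<dots> = (\<Sum>\<kappa>\<in>S. of_int (signed_good_count n lam \<kappa> \<mu>) * ?K \<kappa>)"
      proof (intro sum.cong refl)
        fix \<kappa>
        have "(\<Sum>D\<in>{D\<in>?X \<mu>. ?w D = \<kappa>}. (-1) ^ num_extra n D * ?K (?w D)) =
            (\<Sum>D\<in>{D\<in>?X \<mu>. ?w D = \<kappa>}. (-1) ^ num_extra n D * ?K \<kappa>)"
          by (intro sum.cong refl) auto
        then show "(\<Sum>D\<in>{D\<in>?X \<mu>. ?w D = \<kappa>}. (-1) ^ num_extra n D * ?K (?w D)) = of_int (signed_good_count n lam \<kappa> \<mu>) * ?K \<kappa>"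
          by (simp add: signed_good_count_def sum_distrib_right conj_assoc)
      qed
      finally show ?thesis .
    qed
    have "complete_sym_prod n ?z N \<alpha> * ?K lam = Gpol n lam ?z * (complete_sym_prod n ?z N \<alpha> * ?K (\<lambda>_. 0))"
      using Gpol_Kdet_zero[OF lam, of ?z] by (simp add: mult_ac)
    also have "complete_sym_prod n ?z N \<alpha> * ?K (\<lambda>_. 0) = (\<Sum>\<mu>\<in>box n M. of_nat (chain_count n N (\<lambda>_. 0) \<mu> \<alpha>) * ?K \<mu>)"
      by (rule complete_sym_prod_Kdet[OF n zero_par z1]) (use M in simp)
    also have "\<dots> = (\<Sum>\<mu>\<in>box n M. of_nat (chain_count n N (\<lambda>_. 0) \<mu> \<alpha>) * (Gpol n \<mu> ?z * ?K (\<lambda>_. 0)))"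
      by (intro sum.cong refl) (simp add: box_def Gpol_Kdet_zero)
    also have "Gpol n lam ?z * \<dots> = (\<Sum>\<mu>\<in>box n M. of_nat (chain_count n N (\<lambda>_. 0) \<mu> \<alpha>) * (Gpol n \<mu> ?z * (Gpol n lam ?z * ?K (\<lambda>_. 0))))"
      by (simp add: sum_distrib_left mult_ac)
    also have "\<dots> = (\<Sum>\<mu>\<in>box n M. of_nat (chain_count n N (\<lambda>_. 0) \<mu> \<alpha>) * (\<Sum>\<kappa>\<in>S. of_int (signed_good_count n lam \<kappa> \<mu>) * ?K \<kappa>))"
      unfolding Gpol_Kdet_zero[OF lam] by (intro sum.cong refl) (simp add: GK)
    also have "\<dots> = (\<Sum>\<kappa>\<in>S. \<Sum>\<mu>\<in>box n M. of_nat (chain_count n N (\<lambda>_. 0) \<mu> \<alpha>) * (of_int (signed_good_count n lam \<kappa> \<mu>) * ?K \<kappa>))"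
      unfolding sum_distrib_left by (rule sum.swap)
    finally show ?thesis by (simp add: sum_distrib_right mult.assoc)
  qed
  ultimately have "(\<Sum>\<kappa>\<in>S. of_int (int (chain_count n N lam \<kappa> \<alpha>) -
      (\<Sum>\<mu>\<in>box n M. int (chain_count n N (\<lambda>_. 0) \<mu> \<alpha>) * signed_good_count n lam \<kappa> \<mu>)) * ?K \<kappa>) = 0"
    by (simp only: of_int_diff left_diff_distrib sum_subtractf diff_self)
  from Kdet_independent[OF finS SW this, of \<nu>] show ?thesis by (simp add: S_def)
qed

section \<open>Reverse plane partitions as chains of shapes\<close>

lemma mem_diagram: "(r, c) \<in> diagram p \<longleftrightarrow> 1 \<le> r \<and> 1 \<le> c \<and> c \<le> p r"
  by (simp add: diagram_def)

lemma initial_segment_eq: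
  fixes A :: "nat set"
  assumes "finite A" "\<And>c c'. c \<in> A \<Longrightarrow> 1 \<le> c' \<Longrightarrow> c' \<le> c \<Longrightarrow> c' \<in> A" "0 \<notin> A"
  shows "A = {1..card A}"
proof (cases "A = {}")
  case False
  have "A = {1..Max A}"
  proof (intro set_eqI iffI)
    fix c assume c: "c \<in> A"
    then have "c \<noteq> 0" using assms(3) by (cases "c = 0") auto
    then show "c \<in> {1..Max A}" using Max_ge[OF assms(1) c] by simp
  next
    fix c assume "c \<in> {1..Max A}"
    then show "c \<in> A" using assms(2)[of "Max A" c] Max_in[OF assms(1) False] by simp
  qed
  then show ?thesis by (metis card_atLeastAtMost diff_Suc_1 Suc_eq_plus1 add_diff_cancel_right')
qed simp

lemma diagram_par_down:
  assumes "p \<in> par n" "(r, c) \<in> diagram p" "1 \<le> r'" "r' \<le> r" "1 \<le> c'" "c' \<le> c"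
  shows "(r', c') \<in> diagram p"
  using assms par_antimono[OF assms(1,3,4)] by (simp add: mem_diagram)

lemma finite_diagram: "p \<in> par n \<Longrightarrow> finite (diagram p)"
proof (rule finite_subset)
  assume p: "p \<in> par n"
  show "diagram p \<subseteq> {1..n} \<times> {1..p 1}"
  proof safe
    fix r c assume rc: "(r, c) \<in> diagram p"
    then have "1 \<le> r" "1 \<le> c" "c \<le> p r" by (auto simp: mem_diagram)
    moreover from this have "r \<le> n" using parD(3)[OF p, of r] by (cases "r \<le> n") auto
    ultimately show "r \<in> {1..n}" "c \<in> {1..p 1}" using par_antimono[OF p, of 1 r] by auto
  qed
qed simp

text \<open>Shapes cut out of a filling by a bound on the entries are recognised as partitions
  through this, both for reverse plane partitions and for set-valued tableaux.\<close>

lemma diagram_of_downset: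
  assumes p: "p \<in> par n" and S: "S \<subseteq> diagram p"
    and down: "\<And>r c r' c'. (r, c) \<in> S \<Longrightarrow> 1 \<le> r' \<Longrightarrow> r' \<le> r \<Longrightarrow> 1 \<le> c' \<Longrightarrow> c' \<le> c \<Longrightarrow> (r', c') \<in> S"
  shows "(\<lambda>r. card {c. (r, c) \<in> S}) \<in> par n" "diagram (\<lambda>r. card {c. (r, c) \<in> S}) = S"
proof -
  have fin: "finite {c. (r, c) \<in> S}" for r
    by (rule finite_subset[of _ "{..p r}"]) (use S in \<open>auto simp: mem_diagram\<close>)
  have pos: "1 \<le> r \<and> 1 \<le> c" if "(r, c) \<in> S" for r c using that S by (auto simp: mem_diagram)
  have seg: "{c. (r, c) \<in> S} = {1..card {c. (r, c) \<in> S}}" for r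
  proof (rule initial_segment_eq[OF fin])
    fix c c' assume c: "c \<in> {c. (r, c) \<in> S}" "1 \<le> c'" "c' \<le> c"
    then show "c' \<in> {c. (r, c) \<in> S}" using down[of r c r c'] pos[of r c] by simp
  qed (use pos in force)
  have "card {c. (Suc r, c) \<in> S} \<le> card {c. (r, c) \<in> S}" if "r \<ge> 1" for r
    by (rule card_mono[OF fin]) (use down[of "Suc r" _ r] pos that in auto)
  moreover have "{c. (0, c) \<in> S} = {}" using pos by force
  moreover have "{c. (r, c) \<in> S} = {}" if "r > n" for r
  proof -
    have "p r = 0" using parD(3)[OF p that] .
    then show ?thesis using S by (force simp: mem_diagram)
  qed
  ultimately show "(\<lambda>r. card {c. (r, c) \<in> S}) \<in> par n" by (simp add: par_def)
  show "diagram (\<lambda>r. card {c. (r, c) \<in> S}) = S"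
  proof (intro set_eqI)
    fix x :: "nat \<times> nat"
    obtain r c where x: "x = (r, c)" by force
    have "(r, c) \<in> S \<longleftrightarrow> c \<in> {1..card {c. (r, c) \<in> S}}" using seg[of r] by blast
    then show "x \<in> diagram (\<lambda>r. card {c. (r, c) \<in> S}) \<longleftrightarrow> x \<in> S"
      using pos[of r c] by (auto simp: x mem_diagram)
  qed
qed

lemma diagram_inj:
  assumes "p \<in> par n" "q \<in> par n" "diagram p = diagram q"
  shows "p = q"
proof
  fix r
  show "p r = q r"
  proof (cases "r = 0")
    case False
    have "c \<le> p r \<longleftrightarrow> c \<le> q r" if "1 \<le> c" for c
      using assms(3) that False mem_diagram[of r c p] mem_diagram[of r c q] by auto
    from this[of "p r"] this[of "q r"] show ?thesis by (cases "p r"; cases "q r") auto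
  qed (use assms(1,2) in \<open>simp add: par_def\<close>)
qed

lemma diagram_subset_iff:
  assumes "p \<in> par n" "q \<in> par m"
  shows "diagram p \<subseteq> diagram q \<longleftrightarrow> p \<le> q"
proof
  assume s: "diagram p \<subseteq> diagram q"
  show "p \<le> q"
  proof (rule le_funI)
    fix r show "p r \<le> q r"
    proof (cases "r = 0 \<or> p r = 0")
      case True
      then show ?thesis using parD(1)[OF assms(1)] by auto
    next
      case False
      then have "(r, p r) \<in> diagram p" by (auto simp: mem_diagram)
      then have "(r, p r) \<in> diagram q" using s by blast
      then show ?thesis by (simp add: mem_diagram)
    qed
  qed
next
  assume le: "p \<le> q"
  show "diagram p \<subseteq> diagram q"
  proof safe
    fix r c assume "(r, c) \<in> diagram p"
    then show "(r, c) \<in> diagram q" using le_funD[OF le, of r] by (simp add: mem_diagram)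
  qed
qed

lemma mem_skew: "(r, c) \<in> skew_diagram \<nu> lam \<longleftrightarrow> 1 \<le> r \<and> 1 \<le> c \<and> lam r < c \<and> c \<le> \<nu> r"
  by (auto simp: skew_diagram_def mem_diagram)

lemma card_skew_columns:
  assumes k: "\<kappa> \<in> par n" and v: "\<nu> \<in> par n" and le: "\<kappa> \<le> \<nu>"
  shows "card {c. \<exists>r. (r, c) \<in> skew_diagram \<nu> \<kappa>} = ncols n \<kappa> \<nu>"
proof -
  define u where "u = (\<lambda>j. if j = 1 then \<nu> 1 else min (\<kappa> (j - 1)) (\<nu> j))"
  have "{c. \<exists>r. (r, c) \<in> skew_diagram \<nu> \<kappa>} = (\<Union>j\<in>{1..n}. {\<kappa> j<..u j})"
  proof (intro set_eqI iffI)
    fix c assume "c \<in> {c. \<exists>r. (r, c) \<in> skew_diagram \<nu> \<kappa>}"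
    then have ex: "\<exists>r. (r, c) \<in> skew_diagram \<nu> \<kappa>" by simp
    define r where "r = (LEAST r. (r, c) \<in> skew_diagram \<nu> \<kappa>)"
    have r: "(r, c) \<in> skew_diagram \<nu> \<kappa>" unfolding r_def by (rule LeastI_ex[OF ex])
    have least: "(r', c) \<notin> skew_diagram \<nu> \<kappa>" if "r' < r" for r'
      using that not_less_Least unfolding r_def by blast
    have r1: "1 \<le> r" "r \<le> n" using r parD(3)[OF v, of r] by (auto simp: mem_skew not_le[symmetric])
    have "c \<le> u r"
    proof (cases "r = 1")
      case False
      then have "1 \<le> r - 1" "r - 1 < r" using r1 by auto
      moreover have "\<nu> r \<le> \<nu> (r - 1)" by (rule par_antimono[OF v]) (use calculation in auto)
      ultimately have "c \<le> \<kappa> (r - 1)" using least[of "r - 1"] r by (auto simp: mem_skew)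
      then show ?thesis using r False by (simp add: u_def mem_skew)
    qed (use r in \<open>simp add: u_def mem_skew\<close>)
    then show "c \<in> (\<Union>j\<in>{1..n}. {\<kappa> j<..u j})" using r r1 by (auto simp: mem_skew)
  next
    fix c assume "c \<in> (\<Union>j\<in>{1..n}. {\<kappa> j<..u j})"
    then obtain j where "1 \<le> j" "\<kappa> j < c" "c \<le> u j" by auto
    then have "(j, c) \<in> skew_diagram \<nu> \<kappa>" by (auto simp: mem_skew u_def split: if_splits)
    then show "c \<in> {c. \<exists>r. (r, c) \<in> skew_diagram \<nu> \<kappa>}" by blast
  qed
  moreover have "card (\<Union>j\<in>{1..n}. {\<kappa> j<..u j}) = (\<Sum>j=1..n. card {\<kappa> j<..u j})"
  proof (rule card_UN_disjoint)
    have disj: "{\<kappa> i<..u i} \<inter> {\<kappa> j<..u j} = {}" if "1 \<le> i" "i < j" for i j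
    proof -
      have "\<kappa> (j - 1) \<le> \<kappa> i" by (rule par_antimono[OF k]) (use that in auto)
      then have "u j \<le> \<kappa> i" using that by (auto simp: u_def)
      then show ?thesis by auto
    qed
    show "\<forall>i\<in>{1..n}. \<forall>j\<in>{1..n}. i \<noteq> j \<longrightarrow> {\<kappa> i<..u i} \<inter> {\<kappa> j<..u j} = {}"
    proof (intro ballI impI)
      fix i j assume "i \<in> {1..n}" "j \<in> {1..n}" "i \<noteq> j"
      then show "{\<kappa> i<..u i} \<inter> {\<kappa> j<..u j} = {}"
        using disj[of i j] disj[of j i] by (cases "i < j") (auto simp: Int_commute)
    qed
  qed auto
  ultimately show ?thesis by (simp add: ncols_def u_def)
qed

definition rpps :: "(nat \<Rightarrow> nat) \<Rightarrow> (nat \<Rightarrow> nat) \<Rightarrow> (nat \<Rightarrow> nat) \<Rightarrow> (nat \<times> nat \<Rightarrow> nat) set" where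
  "rpps \<nu> lam \<alpha> = {R. is_rpp \<nu> lam R \<and> rpp_weight \<nu> lam R = \<alpha>}"

lemma finite_weight_columns:
  assumes "\<nu> \<in> par n"
  shows "finite {c. \<exists>r. (r, c) \<in> skew_diagram \<nu> lam \<and> P r c}"
  by (rule finite_subset[of _ "snd ` diagram \<nu>"])
     (use finite_diagram[OF assms] in \<open>force simp: skew_diagram_def\<close>)+

lemma rpp_weight_pos:
  assumes "\<nu> \<in> par n" "x \<in> skew_diagram \<nu> lam"
  shows "rpp_weight \<nu> lam R (R x) \<noteq> 0"
proof -
  obtain r c where x: "x = (r, c)" by force
  have "c \<in> {c. \<exists>r. (r, c) \<in> skew_diagram \<nu> lam \<and> R (r, c) = R x}" using assms x by auto
  then show ?thesis unfolding rpp_weight_def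
    using finite_weight_columns[OF assms(1)] by (auto simp: card_eq_0_iff)
qed

lemma rpps_bounded:
  assumes v: "\<nu> \<in> par n" and R: "R \<in> rpps \<nu> lam \<alpha>" and a: "\<And>i. i > N \<Longrightarrow> \<alpha> i = 0" and x: "x \<in> skew_diagram \<nu> lam"
  shows "R x \<le> N"
proof (rule ccontr)
  assume "\<not> R x \<le> N"
  then have "\<alpha> (R x) = 0" using a by simp
  then show False using rpp_weight_pos[OF v x, of R] R by (simp add: rpps_def)
qed

lemma finite_rpps:
  assumes v: "\<nu> \<in> par n" and a: "\<And>i. i > N \<Longrightarrow> \<alpha> i = 0"
  shows "finite (rpps \<nu> lam \<alpha>)"
proof (rule finite_subset)
  show "rpps \<nu> lam \<alpha> \<subseteq> {R. \<forall>x. (x \<in> skew_diagram \<nu> lam \<longrightarrow> R x \<in> {..N}) \<and> (x \<notin> skew_diagram \<nu> lam \<longrightarrow> R x = 0)}"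
  proof
    fix R assume R: "R \<in> rpps \<nu> lam \<alpha>"
    have "R x \<in> {..N}" if "x \<in> skew_diagram \<nu> lam" for x
      using rpps_bounded[OF v R a that] by simp
    moreover have "R x = 0" if "x \<notin> skew_diagram \<nu> lam" for x
      using R that unfolding rpps_def is_rpp_def by blast
    ultimately show "R \<in> {R. \<forall>x. (x \<in> skew_diagram \<nu> lam \<longrightarrow> R x \<in> {..N}) \<and> (x \<notin> skew_diagram \<nu> lam \<longrightarrow> R x = 0)}"
      by blast
  qed
  have "finite (skew_diagram \<nu> lam)" using finite_diagram[OF v] by (simp add: skew_diagram_def)
  then show "finite {R. \<forall>x. (x \<in> skew_diagram \<nu> lam \<longrightarrow> R x \<in> {..N}) \<and> (x \<notin> skew_diagram \<nu> lam \<longrightarrow> R x = 0)}"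
    by (rule finite_set_of_finite_funs) simp
qed

lemma chain_count_cong: "(\<And>i. i \<in> {1..N} \<Longrightarrow> \<alpha> i = \<beta> i) \<Longrightarrow> chain_count n N lam \<nu> \<alpha> = chain_count n N lam \<nu> \<beta>"
  by (induction N arbitrary: \<nu>) auto

lemma rpps_0:
  assumes "\<nu> \<in> par n" "lam \<in> par n" "lam \<le> \<nu>" "\<alpha> = (\<lambda>_. 0)"
  shows "card (rpps \<nu> lam \<alpha>) = of_bool (lam = \<nu>)"
proof (cases "lam = \<nu>")
  case True
  then have "skew_diagram \<nu> lam = {}" by (simp add: skew_diagram_def)
  then have "rpps \<nu> lam \<alpha> = {\<lambda>_. 0}" using assms(4)
    by (auto simp: rpps_def is_rpp_def rpp_weight_def fun_eq_iff)
  then show ?thesis using True by simp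
next
  case False
  have "skew_diagram \<nu> lam \<noteq> {}"
    using False diagram_inj[OF assms(1,2)] diagram_subset_iff[OF assms(2,1)] assms(3)
    by (auto simp: skew_diagram_def)
  then obtain x where x: "x \<in> skew_diagram \<nu> lam" by blast
  have "R \<notin> rpps \<nu> lam \<alpha>" for R
    using rpp_weight_pos[OF assms(1) x, of R] assms(4) by (auto simp: rpps_def)
  then have "rpps \<nu> lam \<alpha> = {}" by blast
  then show ?thesis using False by simp
qed

lemma skew_split:
  assumes "lam \<le> \<kappa>" "\<kappa> \<le> \<nu>"
  shows "skew_diagram \<nu> lam = skew_diagram \<kappa> lam \<union> skew_diagram \<nu> \<kappa>"
    "skew_diagram \<kappa> lam \<inter> skew_diagram \<nu> \<kappa> = {}"
proof -
  have le: "lam r \<le> \<kappa> r" "\<kappa> r \<le> \<nu> r" for r using assms by (auto simp: le_fun_def)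
  have "x \<in> skew_diagram \<nu> lam \<longleftrightarrow> x \<in> skew_diagram \<kappa> lam \<union> skew_diagram \<nu> \<kappa>" for x
    using le[of "fst x"] by (cases x) (auto simp: mem_skew)
  then show "skew_diagram \<nu> lam = skew_diagram \<kappa> lam \<union> skew_diagram \<nu> \<kappa>" by blast
  show "skew_diagram \<kappa> lam \<inter> skew_diagram \<nu> \<kappa> = {}" by (auto simp: mem_skew)
qed

lemma is_rpp_extend:
  assumes v: "\<nu> \<in> par n" and k: "\<kappa> \<in> par n" and l: "lam \<le> \<kappa>" "\<kappa> \<le> \<nu>"
    and R: "is_rpp \<kappa> lam R" and bd: "\<And>x. x \<in> skew_diagram \<kappa> lam \<Longrightarrow> R x \<le> N"
  shows "is_rpp \<nu> lam (\<lambda>x. if x \<in> skew_diagram \<nu> \<kappa> then Suc N else R x)"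
proof -
  note sp = skew_split[OF l]
  have le: "lam r \<le> \<kappa> r" "\<kappa> r \<le> \<nu> r" for r using l by (auto simp: le_fun_def)
  have row: "(r, c) \<in> skew_diagram \<kappa> lam" if "(r, c) \<in> skew_diagram \<nu> lam" "(r, c') \<in> skew_diagram \<kappa> lam" "c < c'" for r c c'
    using that by (auto simp: mem_skew)
  have col: "(r, c) \<in> skew_diagram \<kappa> lam" if "(r, c) \<in> skew_diagram \<nu> lam" "(r', c) \<in> skew_diagram \<kappa> lam" "r < r'" for r r' c
    using that par_antimono[OF k, of r r'] by (auto simp: mem_skew)
  have out: "R x = 0" if "x \<notin> skew_diagram \<kappa> lam" for x using R that unfolding is_rpp_def by blast
  have disj: "x \<in> skew_diagram \<kappa> lam \<Longrightarrow> x \<notin> skew_diagram \<nu> \<kappa>" for x using sp(2) by blast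
  have mono_r: "R (r, c) \<le> R (r, c')" if "(r, c) \<in> skew_diagram \<kappa> lam" "(r, c') \<in> skew_diagram \<kappa> lam" "c < c'" for r c c'
    using R that unfolding is_rpp_def by blast
  have mono_c: "R (r, c) \<le> R (r', c)" if "(r, c) \<in> skew_diagram \<kappa> lam" "(r', c) \<in> skew_diagram \<kappa> lam" "r < r'" for r r' c
    using R that unfolding is_rpp_def by blast
  have bd': "R x \<le> Suc N" for x using bd[of x] out[of x] by (cases "x \<in> skew_diagram \<kappa> lam") auto
  let ?E = "\<lambda>x. if x \<in> skew_diagram \<nu> \<kappa> then Suc N else R x"
  have "1 \<le> ?E x" if "x \<in> skew_diagram \<nu> lam" for x
    using that sp R unfolding is_rpp_def by auto
  moreover have "?E x = 0" if "x \<notin> skew_diagram \<nu> lam" for x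
    using that sp out by auto
  moreover have "?E (r, c) \<le> ?E (r, c')"
    if h: "(r, c) \<in> skew_diagram \<nu> lam" "(r, c') \<in> skew_diagram \<nu> lam" "c < c'" for r c c'
  proof (cases "(r, c') \<in> skew_diagram \<nu> \<kappa>")
    case True
    then show ?thesis using bd' by simp
  next
    case False
    then have "(r, c') \<in> skew_diagram \<kappa> lam" using h sp by blast
    moreover from this have "(r, c) \<in> skew_diagram \<kappa> lam" using row h by blast
    ultimately show ?thesis using disj mono_r h(3) by simp
  qed
  moreover have "?E (r, c) \<le> ?E (r', c)"
    if h: "(r, c) \<in> skew_diagram \<nu> lam" "(r', c) \<in> skew_diagram \<nu> lam" "r < r'" for r r' c
  proof (cases "(r', c) \<in> skew_diagram \<nu> \<kappa>")
    case True
    then show ?thesis using bd' by simp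
  next
    case False
    then have "(r', c) \<in> skew_diagram \<kappa> lam" using h sp by blast
    moreover from this have "(r, c) \<in> skew_diagram \<kappa> lam" using col h by blast
    ultimately show ?thesis using disj mono_c h(3) by simp
  qed
  ultimately show ?thesis unfolding is_rpp_def by blast
qed

text \<open>The entries at most N fill \<kappa>/lam, and every remaining cell holds N+1. Hence the
  letter N+1 has weight \<open>ncols n \<kappa> \<nu>\<close>, whatever the smaller entries
  are.\<close>

lemma rpps_fixed_subshape:
  assumes v: "\<nu> \<in> par n" and k: "\<kappa> \<in> par n" and l: "lam \<le> \<kappa>" "\<kappa> \<le> \<nu>"
    and a: "\<And>i. i > Suc N \<Longrightarrow> \<alpha> i = 0"
  shows "card {R \<in> rpps \<nu> lam \<alpha>. \<forall>x\<in>skew_diagram \<nu> lam. R x \<le> N \<longleftrightarrow> x \<in> skew_diagram \<kappa> lam} =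
    (if ncols n \<kappa> \<nu> = \<alpha> (Suc N) then card (rpps \<kappa> lam (\<alpha>(Suc N := 0))) else 0)"
proof -
  let ?A = "{R \<in> rpps \<nu> lam \<alpha>. \<forall>x\<in>skew_diagram \<nu> lam. R x \<le> N \<longleftrightarrow> x \<in> skew_diagram \<kappa> lam}"
  let ?B = "rpps \<kappa> lam (\<alpha>(Suc N := 0))"
  note sp = skew_split[OF l]
  define f where "f = (\<lambda>R x. if x \<in> skew_diagram \<kappa> lam then R x else (0::nat))"
  define h where "h = (\<lambda>R x. if x \<in> skew_diagram \<nu> \<kappa> then Suc N else (R x :: nat))"
  have top: "R x = Suc N" if R: "R \<in> ?A" and x: "x \<in> skew_diagram \<nu> \<kappa>" for R x
  proof -
    have xs: "x \<in> skew_diagram \<nu> lam" "x \<notin> skew_diagram \<kappa> lam" using x sp by auto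
    then have "R x \<le> Suc N" using rpps_bounded[where R = R and lam = lam and x = x, OF v _ a] R by auto
    moreover have "\<not> R x \<le> N" using R xs by auto
    ultimately show ?thesis by simp
  qed
  have wtop: "ncols n \<kappa> \<nu> = \<alpha> (Suc N)" if R: "R \<in> ?A" for R
  proof -
    have "{c. \<exists>r. (r, c) \<in> skew_diagram \<nu> lam \<and> R (r, c) = Suc N} = {c. \<exists>r. (r, c) \<in> skew_diagram \<nu> \<kappa>}"
    proof -
      have "R x \<le> N" if "x \<in> skew_diagram \<kappa> lam" for x using R that sp(1) by blast
      then have "(r, c) \<notin> skew_diagram \<kappa> lam" if "R (r, c) = Suc N" for r c using that by fastforce
      then have "(r, c) \<in> skew_diagram \<nu> lam \<and> R (r, c) = Suc N \<longleftrightarrow> (r, c) \<in> skew_diagram \<nu> \<kappa>" for r c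
        using top[OF R, of "(r, c)"] sp by auto
      then show ?thesis by simp
    qed
    then show ?thesis using R card_skew_columns[OF k v l(2)] by (auto simp: rpps_def rpp_weight_def)
  qed
  show ?thesis
  proof (cases "ncols n \<kappa> \<nu> = \<alpha> (Suc N)")
    case False
    then have "?A = {}" using wtop by blast
    then have "card ?A = 0" by (simp only: card.empty)
    then show ?thesis using False by simp
  next
    case True
    have Bbd: "R x \<le> N" if "R \<in> ?B" "x \<in> skew_diagram \<kappa> lam" for R x
      by (rule rpps_bounded[OF k that(1) _ that(2)]) (use a in auto)
    have "bij_betw f ?A ?B"
    proof (rule bij_betw_byWitness[where f' = h])
      show "\<forall>R\<in>?A. h (f R) = R"
      proof (intro ballI ext)
        fix R x assume R: "R \<in> ?A"
        have "R x = 0" if "x \<notin> skew_diagram \<nu> lam" using R that unfolding rpps_def is_rpp_def by blast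
        then show "h (f R) x = R x" using top[OF R, of x] sp by (auto simp: f_def h_def)
      qed
      show "\<forall>R\<in>?B. f (h R) = R"
      proof (intro ballI ext)
        fix R x assume R: "R \<in> ?B"
        have "R x = 0" if "x \<notin> skew_diagram \<kappa> lam" using R that unfolding rpps_def is_rpp_def by blast
        then show "f (h R) x = R x" using sp by (auto simp: f_def h_def)
      qed
      show "f ` ?A \<subseteq> ?B"
      proof (rule image_subsetI)
        fix R assume R: "R \<in> ?A"
        then have rpp: "is_rpp \<nu> lam R" and w: "rpp_weight \<nu> lam R = \<alpha>" by (auto simp: rpps_def)
        have sub: "x \<in> skew_diagram \<kappa> lam \<Longrightarrow> x \<in> skew_diagram \<nu> lam" for x using sp by blast
        have "is_rpp \<kappa> lam (f R)"
          using rpp sub unfolding is_rpp_def f_def by simp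
        moreover have "rpp_weight \<kappa> lam (f R) i = (\<alpha>(Suc N := 0)) i" for i
        proof (cases "i = Suc N")
          case True
          have "R x \<noteq> Suc N" if "x \<in> skew_diagram \<kappa> lam" for x
          proof -
            have "R x \<le> N" using R that sub by blast
            then show ?thesis by simp
          qed
          then have "{c. \<exists>r. (r, c) \<in> skew_diagram \<kappa> lam \<and> f R (r, c) = i} = {}"
            using True by (auto simp: f_def)
          then have "rpp_weight \<kappa> lam (f R) i = card ({} :: nat set)"
            unfolding rpp_weight_def by (rule arg_cong)
          then show ?thesis using True by simp
        next
          case False
          have "(r, c) \<in> skew_diagram \<kappa> lam \<and> f R (r, c) = i \<longleftrightarrow> (r, c) \<in> skew_diagram \<nu> lam \<and> R (r, c) = i" for r c
            using top[OF R, of "(r, c)"] False sp by (auto simp: f_def)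
          then show ?thesis using False w by (auto simp: rpp_weight_def fun_eq_iff)
        qed
        ultimately show "f R \<in> ?B" by (simp add: rpps_def fun_eq_iff)
      qed
      show "h ` ?B \<subseteq> ?A"
      proof (rule image_subsetI)
        fix R assume R: "R \<in> ?B"
        then have rpp: "is_rpp \<kappa> lam R" and w: "rpp_weight \<kappa> lam R = \<alpha>(Suc N := 0)" by (auto simp: rpps_def)
        have "is_rpp \<nu> lam (h R)"
          unfolding h_def by (rule is_rpp_extend[OF v k l rpp Bbd[OF R]])
        moreover have "rpp_weight \<nu> lam (h R) i = \<alpha> i" for i
        proof (cases "i = Suc N")
          case True
          have "(r, c) \<in> skew_diagram \<nu> lam \<and> h R (r, c) = i \<longleftrightarrow> (r, c) \<in> skew_diagram \<nu> \<kappa>" for r c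
            using Bbd[OF R, of "(r, c)"] True sp by (auto simp: h_def)
          then have "rpp_weight \<nu> lam (h R) i = ncols n \<kappa> \<nu>"
            using card_skew_columns[OF k v l(2)] by (simp add: rpp_weight_def)
          then show ?thesis using True \<open>ncols n \<kappa> \<nu> = \<alpha> (Suc N)\<close> by simp
        next
          case False
          have "(r, c) \<in> skew_diagram \<nu> lam \<and> h R (r, c) = i \<longleftrightarrow> (r, c) \<in> skew_diagram \<kappa> lam \<and> R (r, c) = i" for r c
            using False sp by (auto simp: h_def)
          then have "rpp_weight \<nu> lam (h R) i = rpp_weight \<kappa> lam R i" by (simp add: rpp_weight_def)
          then show ?thesis using False w by simp
        qed
        moreover have "h R x \<le> N \<longleftrightarrow> x \<in> skew_diagram \<kappa> lam" if "x \<in> skew_diagram \<nu> lam" for x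
          using that sp Bbd[OF R, of x] by (auto simp: h_def)
        ultimately show "h R \<in> ?A" by (simp add: rpps_def fun_eq_iff)
      qed
    qed
    then have "card ?A = card ?B" by (rule bij_betw_same_card)
    then show ?thesis using True by simp
  qed
qed

text \<open>A filling amounts to the chain of shapes formed by \<open>lam\<close> and the entries at
  most 0, 1, 2 and so on. The shape \<kappa> for the bound N sorts the fillings into the classes of
  \<open>rpps_fixed_subshape\<close>.\<close>

lemma card_rpps:
  assumes l: "lam \<in> par n"
  shows "\<nu> \<in> par n \<Longrightarrow> lam \<le> \<nu> \<Longrightarrow> \<alpha> 0 = 0 \<Longrightarrow> (\<And>i. i > N \<Longrightarrow> \<alpha> i = 0) \<Longrightarrow>
    card (rpps \<nu> lam \<alpha>) = chain_count n N lam \<nu> \<alpha>"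
proof (induction N arbitrary: \<nu> \<alpha>)
  case 0
  then have "\<alpha> = (\<lambda>_. 0)" by (auto simp: fun_eq_iff) (metis not_gr_zero)
  then show ?case using rpps_0[OF 0(1) l 0(2)] by simp
next
  case (Suc N)
  note v = Suc.prems(1) and le = Suc.prems(2) and a = Suc.prems(4)
  let ?Q = "\<lambda>\<kappa> R. \<forall>x\<in>skew_diagram \<nu> lam. R x \<le> N \<longleftrightarrow> x \<in> skew_diagram \<kappa> lam"
  let ?A = "\<lambda>\<kappa>. {R \<in> rpps \<nu> lam \<alpha>. ?Q \<kappa> R}"
  have fin: "finite (rpps \<nu> lam \<alpha>)" by (rule finite_rpps[OF v a])
  have "rpps \<nu> lam \<alpha> = (\<Union>\<kappa>\<in>interval n lam \<nu>. ?A \<kappa>)"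
  proof (intro set_eqI iffI)
    fix R assume R: "R \<in> rpps \<nu> lam \<alpha>"
    then have rpp: "is_rpp \<nu> lam R" by (simp add: rpps_def)
    have dl: "diagram lam \<subseteq> diagram \<nu>" using diagram_subset_iff[OF l v] le by simp
    define S where "S = diagram lam \<union> {x\<in>skew_diagram \<nu> lam. R x \<le> N}"
    have S: "S \<subseteq> diagram \<nu>" using dl by (auto simp: S_def skew_diagram_def)
    have down: "(r', c') \<in> S" if h: "(r, c) \<in> S" "1 \<le> r'" "r' \<le> r" "1 \<le> c'" "c' \<le> c" for r c r' c'
    proof (cases "(r', c') \<in> diagram lam")
      case False
      \<comment> \<open>Monotonicity is applied along row r to (r, c') and then down that column.
        Both cells lie outside lam because (r', c') does.\<close>
      have nl: "(r, c) \<notin> diagram lam" using diagram_par_down[OF l _ h(2-5)] False by blast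
      then have s1: "(r, c) \<in> skew_diagram \<nu> lam" "R (r, c) \<le> N" using h(1) by (auto simp: S_def)
      have inv: "(r', c') \<in> diagram \<nu>" "(r, c') \<in> diagram \<nu>"
        using diagram_par_down[OF v _ h(2-5)] diagram_par_down[OF v, of r c r c'] h S by auto
      then have s3: "(r', c') \<in> skew_diagram \<nu> lam" using False by (simp add: skew_diagram_def)
      have s2: "(r, c') \<in> skew_diagram \<nu> lam"
        using inv diagram_par_down[OF l, of r c' r' c'] h False by (auto simp: skew_diagram_def)
      have "R (r, c') \<le> R (r, c)"
        using rpp s1 s2 h(5) unfolding is_rpp_def by (cases "c' = c") (auto simp: le_less)
      moreover have "R (r', c') \<le> R (r, c')"
        using rpp s2 s3 h(3) unfolding is_rpp_def by (cases "r' = r") (auto simp: le_less)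
      ultimately show ?thesis using s1 s3 by (simp add: S_def)
    qed (simp add: S_def)
    define \<kappa> where "\<kappa> = (\<lambda>r. card {c. (r, c) \<in> S})"
    have k: "\<kappa> \<in> par n" "diagram \<kappa> = S"
      unfolding \<kappa>_def using diagram_of_downset[OF v S down] by auto
    have "lam \<le> \<kappa>" "\<kappa> \<le> \<nu>"
      using diagram_subset_iff[OF l k(1)] diagram_subset_iff[OF k(1) v] k(2) S by (auto simp: S_def)
    moreover have "?Q \<kappa> R" using k(2) by (auto simp: S_def skew_diagram_def)
    ultimately show "R \<in> (\<Union>\<kappa>\<in>interval n lam \<nu>. ?A \<kappa>)" using R k(1) by (auto simp: interval_def)
  qed auto
  then have "card (rpps \<nu> lam \<alpha>) = card (\<Union>\<kappa>\<in>interval n lam \<nu>. ?A \<kappa>)" by (rule arg_cong)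
  also have "\<dots> = (\<Sum>\<kappa>\<in>interval n lam \<nu>. card (?A \<kappa>))"
  proof (intro card_UN_disjoint ballI impI)
    show "finite (interval n lam \<nu>)" by (rule finite_interval[OF v])
    show "finite (?A \<kappa>)" for \<kappa> using fin by simp
    fix \<kappa> \<eta> assume ke: "\<kappa> \<in> interval n lam \<nu>" "\<eta> \<in> interval n lam \<nu>" "\<kappa> \<noteq> \<eta>"
    have dk: "diagram \<xi> = diagram lam \<union> skew_diagram \<xi> lam" "skew_diagram \<xi> lam \<subseteq> skew_diagram \<nu> lam"
      if "\<xi> \<in> interval n lam \<nu>" for \<xi>
      using that diagram_subset_iff[OF l, of \<xi> n] diagram_subset_iff[OF _ v, of \<xi> n]
      by (auto simp: interval_def skew_diagram_def)
    show "?A \<kappa> \<inter> ?A \<eta> = {}"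
    proof (rule ccontr)
      assume "?A \<kappa> \<inter> ?A \<eta> \<noteq> {}"
      then obtain R where "?Q \<kappa> R" "?Q \<eta> R" by auto
      then have "skew_diagram \<kappa> lam = skew_diagram \<eta> lam"
        using dk(2)[OF ke(1)] dk(2)[OF ke(2)] by blast
      then have "diagram \<kappa> = diagram \<eta>" using dk(1)[OF ke(1)] dk(1)[OF ke(2)] by simp
      then show False using diagram_inj[of \<kappa> n \<eta>] ke by (auto simp: interval_def)
    qed
  qed
  also have "\<dots> = (\<Sum>\<kappa>\<in>interval n lam \<nu>. if ncols n \<kappa> \<nu> = \<alpha> (Suc N) then chain_count n N lam \<kappa> \<alpha> else 0)"
  proof (intro sum.cong refl)
    fix \<kappa> assume k: "\<kappa> \<in> interval n lam \<nu>"
    then have k': "\<kappa> \<in> par n" "lam \<le> \<kappa>" "\<kappa> \<le> \<nu>" by (auto simp: interval_def)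
    have "card (rpps \<kappa> lam (\<alpha>(Suc N := 0))) = chain_count n N lam \<kappa> (\<alpha>(Suc N := 0))"
      by (rule Suc.IH[OF k'(1,2)]) (use Suc.prems in auto)
    also have "\<dots> = chain_count n N lam \<kappa> \<alpha>" by (rule chain_count_cong) auto
    finally show "card (?A \<kappa>) = (if ncols n \<kappa> \<nu> = \<alpha> (Suc N) then chain_count n N lam \<kappa> \<alpha> else 0)"
      using rpps_fixed_subshape[OF v k'(1,2,3), of N \<alpha>] a by simp
  qed
  also have "\<dots> = chain_count n (Suc N) lam \<nu> \<alpha>"
    using finite_interval[OF v, of lam] by (simp add: sum.inter_filter)
  finally show ?case .
qed


section \<open>Linear independence of the functions g\<close>

text \<open>The rows up to i+1 contribute at most the difference of the partial sums of \<nu> and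
  \<kappa> up to i+1. The rows above contribute disjoint sets of columns within the first
  \<kappa>(i+1), which compensates the last term of the sum for \<kappa>.\<close>

lemma ncols_partial_sums:
  assumes n: "n \<ge> 1" and k: "\<kappa> \<in> par n" and v: "\<nu> \<in> par n" and le: "\<kappa> \<le> \<nu>"
  shows "ncols n \<kappa> \<nu> + (\<Sum>j=1..i. \<kappa> j) \<le> (\<Sum>j=1..Suc i. \<nu> j)"
proof -
  define u where "u = (\<lambda>j. if j = 1 then \<nu> 1 else min (\<kappa> (j - 1)) (\<nu> j))"
  define P where "P = (\<lambda>t. \<Sum>j=1..t. u j - \<kappa> j)"
  have ku: "\<kappa> j \<le> u j" if "1 \<le> j" for j
    using le_funD[OF le, of j] par_antimono[OF k, of "j - 1" j] that by (auto simp: u_def)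
  have "P (Suc i) + (\<Sum>j=1..Suc i. \<kappa> j) = (\<Sum>j=1..Suc i. u j)"
    unfolding P_def sum.distrib[symmetric] using ku by (intro sum.cong) auto
  also have "\<dots> \<le> (\<Sum>j=1..Suc i. \<nu> j)"
    by (intro sum_mono) (auto simp: u_def)
  finally have base: "P (Suc i) + (\<Sum>j=1..i. \<kappa> j) + \<kappa> (Suc i) \<le> (\<Sum>j=1..Suc i. \<nu> j)" by simp
  have up: "P t + (\<Sum>j=1..i. \<kappa> j) + \<kappa> t \<le> (\<Sum>j=1..Suc i. \<nu> j)" if "Suc i \<le> t" for t
    using that
  proof (induction t rule: dec_induct)
    case (step t)
    have "u (Suc t) \<le> \<kappa> t" using step by (simp add: u_def)
    moreover have "P (Suc t) = P t + (u (Suc t) - \<kappa> (Suc t))" by (simp add: P_def)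
    ultimately show ?case using step.IH ku[of "Suc t"] by simp
  qed (use base in simp)
  have "P n \<le> P (max n (Suc i))"
    unfolding P_def by (rule sum_mono2) auto
  then have "P n + (\<Sum>j=1..i. \<kappa> j) \<le> (\<Sum>j=1..Suc i. \<nu> j)"
    using up[of "max n (Suc i)"] by simp
  then show ?thesis by (simp add: ncols_def P_def u_def)
qed

text \<open>Dominance of the end shape over the weight: for i \<le> N by containment of the previous
  shape, and for the last step by \<open>ncols_partial_sums\<close>.\<close>

lemma chain_count_partial_sums:
  assumes n: "n \<ge> 1"
  shows "\<nu> \<in> par n \<Longrightarrow> chain_count n N (\<lambda>_. 0) \<nu> \<alpha> \<noteq> 0 \<Longrightarrow> i \<le> N \<Longrightarrow>
    (\<Sum>j=1..i. \<alpha> j) \<le> (\<Sum>j=1..i. \<nu> j)"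
proof (induction N arbitrary: \<nu> i)
  case 0
  then show ?case by simp
next
  case (Suc N)
  have "\<exists>\<kappa>\<in>{\<kappa>\<in>interval n (\<lambda>_. 0) \<nu>. ncols n \<kappa> \<nu> = \<alpha> (Suc N)}. chain_count n N (\<lambda>_. 0) \<kappa> \<alpha> \<noteq> 0"
  proof (rule ccontr)
    assume "\<not> ?thesis"
    then have "chain_count n (Suc N) (\<lambda>_. 0) \<nu> \<alpha> = 0" by (simp del: sum_eq_0_iff add: sum.neutral)
    then show False using Suc.prems by simp
  qed
  then obtain \<kappa> where k: "\<kappa> \<in> par n" "\<kappa> \<le> \<nu>" "ncols n \<kappa> \<nu> = \<alpha> (Suc N)" "chain_count n N (\<lambda>_. 0) \<kappa> \<alpha> \<noteq> 0"
    by (auto simp: interval_def)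
  show ?case
  proof (cases "i \<le> N")
    case True
    have "(\<Sum>j=1..i. \<alpha> j) \<le> (\<Sum>j=1..i. \<kappa> j)" by (rule Suc.IH[OF k(1,4) True])
    also have "\<dots> \<le> (\<Sum>j=1..i. \<nu> j)" by (intro sum_mono le_funD[OF k(2)])
    finally show ?thesis .
  next
    case False
    then have i: "i = Suc N" using Suc.prems by simp
    have "(\<Sum>j=1..N. \<alpha> j) \<le> (\<Sum>j=1..N. \<kappa> j)" by (rule Suc.IH[OF k(1,4)]) simp
    then show ?thesis using ncols_partial_sums[OF n k(1) Suc.prems(1) k(2), of N] k(3) by (simp add: i)
  qed
qed

text \<open>The witness chain adds one whole row of \<eta> at a time; row N has one cell in each of
  \<eta> N columns.\<close>

lemma chain_count_diagonal_pos:
  assumes e: "\<eta> \<in> par n"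
  shows "N \<le> n \<Longrightarrow> chain_count n N (\<lambda>_. 0) (\<lambda>r. if r \<le> N then \<eta> r else 0) \<eta> \<noteq> 0"
proof (induction N)
  case 0
  have "(\<lambda>r. if r \<le> 0 then \<eta> r else 0) = (\<lambda>_. 0)" using parD(1)[OF e] by auto
  then show ?case by simp
next
  case (Suc N)
  let ?t = "\<lambda>N r. if r \<le> N then \<eta> r else 0"
  have tp: "?t M \<in> par n" for M using e by (auto simp: par_def)
  have "ncols n (?t N) (?t (Suc N)) = (\<Sum>j=1..n. if j = Suc N then \<eta> j else 0)"
    unfolding ncols_def
  proof (intro sum.cong refl)
    fix j assume "j \<in> {1..n}"
    then show "(if j = 1 then ?t (Suc N) 1 else min (?t N (j - 1)) (?t (Suc N) j)) - ?t N j =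
        (if j = Suc N then \<eta> j else 0)"
      using par_antimono[OF e, of "j - 1" j] by (auto simp: One_nat_def)
  qed
  also have "\<dots> = \<eta> (Suc N)" using Suc.prems by (simp add: sum.delta)
  finally have mem: "?t N \<in> {\<kappa>\<in>interval n (\<lambda>_. 0) (?t (Suc N)). ncols n \<kappa> (?t (Suc N)) = \<eta> (Suc N)}"
    using tp by (auto simp: interval_def le_fun_def)
  have "finite (interval n (\<lambda>_. 0) (?t (Suc N)))" by (rule finite_interval[OF tp])
  then have "chain_count n N (\<lambda>_. 0) (?t N) \<eta> \<le> chain_count n (Suc N) (\<lambda>_. 0) (?t (Suc N)) \<eta>"
    unfolding chain_count.simps by (intro member_le_sum[OF mem]) auto
  then show ?case using Suc by simp
qed

lemma par_mono: "p \<in> par n \<Longrightarrow> n \<le> m \<Longrightarrow> p \<in> par m"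
  by (auto simp: par_def)

lemma is_partition_par: "is_partition p \<longleftrightarrow> (\<exists>n. p \<in> par n)"
proof
  assume p: "is_partition p"
  then have "finite {i. p i \<noteq> 0}" by (simp add: is_partition_def)
  then obtain n where "\<forall>i\<in>{i. p i \<noteq> 0}. i \<le> n" using finite_nat_set_iff_bounded_le by blast
  then have "\<forall>i>n. p i = 0" by (metis mem_Collect_eq not_le)
  then show "\<exists>n. p \<in> par n" using p
    by (intro exI[of _ n]) (simp add: par_def is_partition_def flip: Suc_eq_plus1)
next
  assume "\<exists>n. p \<in> par n"
  then obtain n where p: "p \<in> par n" by blast
  have "i \<le> n" if "p i \<noteq> 0" for i using parD(3)[OF p, of i] that by (cases "i \<le> n") auto
  then have "{i. p i \<noteq> 0} \<subseteq> {..n}" by auto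
  then have "finite {i. p i \<noteq> 0}" by (rule finite_subset) simp
  then show "is_partition p" using p by (simp add: par_def is_partition_def flip: Suc_eq_plus1)
qed

lemma finite_partitions_common_par:
  "finite T \<Longrightarrow> (\<And>p. p \<in> T \<Longrightarrow> is_partition p) \<Longrightarrow> \<exists>n\<ge>1. T \<subseteq> par n"
proof (induction T rule: finite_induct)
  case (insert p T)
  have "\<exists>n\<ge>1. T \<subseteq> par n" by (rule insert.IH) (use insert.prems in auto)
  then obtain n where n: "n \<ge> 1" "T \<subseteq> par n" by blast
  obtain m where m: "p \<in> par m" using insert.prems[of p] by (auto simp: is_partition_par)
  have "insert p T \<subseteq> par (max n m)" "max n m \<ge> 1"
    using n par_mono[OF m, of "max n m"] par_mono[of _ n "max n m"] by auto
  then show ?case by blast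
qed auto

lemma g_eq_chain_count:
  assumes "\<mu> \<in> par n" "\<alpha> 0 = 0" "\<And>i. i > N \<Longrightarrow> \<alpha> i = 0"
  shows "g \<mu> \<alpha> = int (chain_count n N (\<lambda>_. 0) \<mu> \<alpha>)"
proof -
  have "(\<lambda>_. 0) \<le> \<mu>" by (simp add: le_fun_def)
  then have "card (rpps \<mu> (\<lambda>_. 0) \<alpha>) = chain_count n N (\<lambda>_. 0) \<mu> \<alpha>"
    using card_rpps[of "\<lambda>_. 0" n \<mu> \<alpha> N] assms by simp
  then show ?thesis by (simp add: g_def g_skew_def rpps_def empty_partition_def)
qed

text \<open>A coefficient $g_\kappa[x^\eta]$ can only be nonzero when $\kappa$ dominates $\eta$ in all partial sums, so a
partition with maximal total of partial sums isolates its own coefficient.\<close>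

lemma g_independent:
  assumes fin: "finite T" and T: "\<And>\<eta>. \<eta> \<in> T \<Longrightarrow> is_partition \<eta>"
    and zero: "\<And>\<alpha>. (\<Sum>\<eta>\<in>T. d \<eta> * g \<eta> \<alpha>) = 0" and nz: "\<And>\<eta>. \<eta> \<in> T \<Longrightarrow> d \<eta> \<noteq> 0"
  shows "T = {}"
proof (rule ccontr)
  assume ne: "T \<noteq> {}"
  obtain n where n: "n \<ge> 1" "T \<subseteq> par n" using finite_partitions_common_par[OF fin T] by blast
  define S where "S = (\<lambda>\<eta> :: nat \<Rightarrow> nat. \<Sum>i=1..n. \<Sum>j=1..i. \<eta> j)"
  have "Max (S ` T) \<in> S ` T" using fin ne by (intro Max_in) auto
  then obtain \<eta> where e: "\<eta> \<in> T" "S \<eta> = Max (S ` T)" by force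
  have mx: "S \<kappa> \<le> S \<eta>" if "\<kappa> \<in> T" for \<kappa>
    unfolding e(2) using fin that by (intro Max_ge) auto
  have ep: "\<eta> \<in> par n" using e n by auto
  have gk: "g \<kappa> \<eta> = int (chain_count n n (\<lambda>_. 0) \<kappa> \<eta>)" if "\<kappa> \<in> T" for \<kappa>
    using g_eq_chain_count[of \<kappa> n \<eta> n] that n ep by (auto simp: par_def)
  have g0: "g \<kappa> \<eta> = 0" if k: "\<kappa> \<in> T" "\<kappa> \<noteq> \<eta>" for \<kappa>
  proof (rule ccontr)
    assume "g \<kappa> \<eta> \<noteq> 0"
    then have "chain_count n n (\<lambda>_. 0) \<kappa> \<eta> \<noteq> 0" using gk[OF k(1)] by simp
    then have ps: "(\<Sum>j=1..i. \<eta> j) \<le> (\<Sum>j=1..i. \<kappa> j)" if "i \<le> n" for i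
      using chain_count_partial_sums[OF n(1) _ _ that] k n by blast
    have "\<exists>i\<in>{1..n}. (\<Sum>j=1..i. \<eta> j) \<noteq> (\<Sum>j=1..i. \<kappa> j)"
    proof (rule ccontr)
      assume "\<not> ?thesis"
      then have eq: "(\<Sum>j=1..i. \<eta> j) = (\<Sum>j=1..i. \<kappa> j)" if "i \<le> n" for i
        using that by (cases "i = 0") auto
      have "\<eta> i = \<kappa> i" for i
      proof (cases "i \<in> {1..n}")
        case True
        then obtain i' where i': "i = Suc i'" by (cases i) auto
        then show ?thesis using eq[of i] eq[of i'] True by simp
      next
        case False
        have "\<kappa> \<in> par n" using k n by auto
        then show ?thesis using False ep by (cases "i = 0") (auto simp: par_def)
      qed
      then show False using k by auto
    qed
    then obtain i where "i \<in> {1..n}" "(\<Sum>j=1..i. \<eta> j) < (\<Sum>j=1..i. \<kappa> j)"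
      using ps by (metis atLeastAtMost_iff le_neq_implies_less)
    then have "\<exists>i\<in>{1..n}. (\<Sum>j=1..i. \<eta> j) < (\<Sum>j=1..i. \<kappa> j)" by blast
    then have "S \<eta> < S \<kappa>" unfolding S_def
      by (rule sum_strict_mono_ex1[rotated -1]) (use ps in simp_all)
    then show False using mx[OF k(1)] by simp
  qed
  have "(\<lambda>r. if r \<le> n then \<eta> r else 0) = \<eta>" using ep by (auto simp: par_def fun_eq_iff)
  then have "g \<eta> \<eta> \<noteq> 0" using gk[OF e(1)] chain_count_diagonal_pos[OF ep, of n] by simp
  moreover have "(\<Sum>\<kappa>\<in>T. d \<kappa> * g \<kappa> \<eta>) = (\<Sum>\<kappa>\<in>T. if \<kappa> = \<eta> then d \<eta> * g \<eta> \<eta> else 0)"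
    by (intro sum.cong refl) (auto simp: g0)
  ultimately show False using zero[of \<eta>] nz[OF e(1)] fin e(1) by (simp add: sum.delta)
qed

lemma g_expansion_unique:
  assumes a: "is_g_expansion F a" and b: "is_g_expansion F b"
  shows "a = b"
proof -
  let ?A = "{\<eta>. a \<eta> \<noteq> 0}" and ?B = "{\<eta>. b \<eta> \<noteq> 0}"
  let ?T = "{\<eta>. a \<eta> - b \<eta> \<noteq> 0}"
  have fin: "finite ?A" "finite ?B" using a b by (auto simp: is_g_expansion_def)
  have sub: "?T \<subseteq> ?A \<union> ?B" by auto
  have "(\<Sum>\<eta>\<in>?T. (a \<eta> - b \<eta>) * g \<eta> \<alpha>) = 0" for \<alpha>
  proof -
    have "(\<Sum>\<eta>\<in>?T. (a \<eta> - b \<eta>) * g \<eta> \<alpha>) = (\<Sum>\<eta>\<in>?A \<union> ?B. (a \<eta> - b \<eta>) * g \<eta> \<alpha>)"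
      by (rule sum.mono_neutral_left) (use fin in auto)
    also have "\<dots> = (\<Sum>\<eta>\<in>?A \<union> ?B. a \<eta> * g \<eta> \<alpha>) - (\<Sum>\<eta>\<in>?A \<union> ?B. b \<eta> * g \<eta> \<alpha>)"
      by (simp add: left_diff_distrib sum_subtractf)
    also have "(\<Sum>\<eta>\<in>?A \<union> ?B. a \<eta> * g \<eta> \<alpha>) = (\<Sum>\<eta>\<in>?A. a \<eta> * g \<eta> \<alpha>)"
      by (rule sum.mono_neutral_right) (use fin in auto)
    also have "(\<Sum>\<eta>\<in>?A \<union> ?B. b \<eta> * g \<eta> \<alpha>) = (\<Sum>\<eta>\<in>?B. b \<eta> * g \<eta> \<alpha>)"
      by (rule sum.mono_neutral_right) (use fin in auto)
    also have "(\<Sum>\<eta>\<in>?A. a \<eta> * g \<eta> \<alpha>) = F \<alpha>" using a by (auto simp: is_g_expansion_def)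
    also have "(\<Sum>\<eta>\<in>?B. b \<eta> * g \<eta> \<alpha>) = F \<alpha>" using b by (auto simp: is_g_expansion_def)
    finally show ?thesis by simp
  qed
  moreover have "is_partition \<eta>" if "\<eta> \<in> ?T" for \<eta>
    using a b sub that unfolding is_g_expansion_def by blast
  moreover have "finite ?T" using finite_subset[OF sub] fin by blast
  ultimately have "?T = {}" by (intro g_independent[where d = "\<lambda>\<eta>. a \<eta> - b \<eta>"]) auto
  then show ?thesis by (auto simp: fun_eq_iff)
qed

section \<open>Row form of the column Yamanouchi condition\<close>

text \<open>The definition quantifies over selections from all cells. Fixing the selection in two
  cells and choosing arbitrarily elsewhere extracts the pairwise conditions; \<open>svtI\<close> is
  the way back.\<close>

lemma svt_entries:
  assumes T: "is_set_valued_tableau \<mu> T" and xy: "x \<in> T p" "y \<in> T q" "p \<in> diagram \<mu>" "q \<in> diagram \<mu>" "p \<noteq> q"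
  shows "\<exists>f. is_semistandard \<mu> f \<and> f p = x \<and> f q = y"
proof -
  define f where "f = (\<lambda>z. if z = p then x else if z = q then y else (SOME w. w \<in> T z))"
  have "f z \<in> T z" if "z \<in> diagram \<mu>" for z
  proof -
    have "T z \<noteq> {}" using T that by (auto simp: is_set_valued_tableau_def)
    then have "(SOME w. w \<in> T z) \<in> T z" by (simp add: some_in_eq)
    then show ?thesis using xy by (auto simp: f_def)
  qed
  then have "is_semistandard \<mu> f" using T by (auto simp: is_set_valued_tableau_def)
  then show ?thesis using xy by (auto simp: f_def intro!: exI[of _ f])
qed

lemma svtI:
  assumes "\<And>r c. (r, c) \<in> diagram \<mu> \<Longrightarrow> finite (T (r, c)) \<and> T (r, c) \<noteq> {} \<and> (\<forall>i\<in>T (r, c). 1 \<le> i)"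
    and "\<And>r c. (r, c) \<notin> diagram \<mu> \<Longrightarrow> T (r, c) = {}"
    and "\<And>r c c' x y. x \<in> T (r, c) \<Longrightarrow> y \<in> T (r, c') \<Longrightarrow> c < c' \<Longrightarrow> x \<le> y"
    and "\<And>r r' c x y. x \<in> T (r, c) \<Longrightarrow> y \<in> T (r', c) \<Longrightarrow> r < r' \<Longrightarrow> x < y"
  shows "is_set_valued_tableau \<mu> T"
  unfolding is_set_valued_tableau_def
proof (intro conjI allI ballI impI)
  fix x assume "x \<in> diagram \<mu>"
  then show "finite (T x)" "T x \<noteq> {}" "\<And>i. i \<in> T x \<Longrightarrow> 1 \<le> i"
    using assms(1)[of "fst x" "snd x"] by auto
next
  fix x assume "x \<notin> diagram \<mu>"
  then show "T x = {}" using assms(2)[of "fst x" "snd x"] by simp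
next
  fix f assume f: "\<forall>x\<in>diagram \<mu>. f x \<in> T x"
  show "is_semistandard \<mu> f"
    unfolding is_semistandard_def
  proof (intro conjI allI ballI impI)
    fix x assume "x \<in> diagram \<mu>"
    then show "1 \<le> f x" using f assms(1)[of "fst x" "snd x"] by auto
  next
    fix r c c' assume "(r, c) \<in> diagram \<mu> \<and> (r, c') \<in> diagram \<mu> \<and> c < c'"
    then show "f (r, c) \<le> f (r, c')" using f by (intro assms(3)[of "f (r, c)" r c "f (r, c')" c']) simp_all
  next
    fix r r' c assume "(r, c) \<in> diagram \<mu> \<and> (r', c) \<in> diagram \<mu> \<and> r < r'"
    then show "f (r, c) < f (r', c)" using f by (intro assms(4)[of "f (r, c)" r c "f (r', c)" r']) simp_all
  qed
qed

locale svtab =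
  fixes m :: nat and \<mu> :: "nat \<Rightarrow> nat" and T :: "nat \<times> nat \<Rightarrow> nat set"
  assumes mu: "\<mu> \<in> par m" and svt: "is_set_valued_tableau \<mu> T"
begin

lemma mem: "x \<in> T (r, c) \<Longrightarrow> (r, c) \<in> diagram \<mu>"
  using svt unfolding is_set_valued_tableau_def by blast

lemma ne: "(r, c) \<in> diagram \<mu> \<Longrightarrow> \<exists>x. x \<in> T (r, c)"
  using svt unfolding is_set_valued_tableau_def by blast

lemma fin: "finite (T x)"
proof (cases "x \<in> diagram \<mu>")
  case True
  then show ?thesis using svt unfolding is_set_valued_tableau_def by blast
next
  case False
  then have "T x = {}" using svt unfolding is_set_valued_tableau_def by blast
  then show ?thesis by simp
qed

lemma pos: "x \<in> T (r, c) \<Longrightarrow> 1 \<le> x" "x \<in> T (r, c) \<Longrightarrow> 1 \<le> r" "x \<in> T (r, c) \<Longrightarrow> 1 \<le> c"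
proof -
  assume x: "x \<in> T (r, c)"
  then have d: "(r, c) \<in> diagram \<mu>" by (rule mem)
  then show "1 \<le> r" "1 \<le> c" by (auto simp: mem_diagram)
  show "1 \<le> x" using svt d x unfolding is_set_valued_tableau_def by blast
qed

lemma row:
  assumes "x \<in> T (r, c)" "y \<in> T (r, c')" "c < c'"
  shows "x \<le> y"
proof -
  have d: "(r, c) \<in> diagram \<mu>" "(r, c') \<in> diagram \<mu>" using assms mem by blast+
  obtain f where "is_semistandard \<mu> f" "f (r, c) = x" "f (r, c') = y"
    using svt_entries[OF svt assms(1,2) d] assms(3) by auto
  then show ?thesis using d assms(3) unfolding is_semistandard_def by metis
qed

lemma col:
  assumes "x \<in> T (r, c)" "y \<in> T (r', c)" "r < r'"
  shows "x < y"
proof -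
  have d: "(r, c) \<in> diagram \<mu>" "(r', c) \<in> diagram \<mu>" using assms mem by blast+
  obtain f where "is_semistandard \<mu> f" "f (r, c) = x" "f (r', c) = y"
    using svt_entries[OF svt assms(1,2) d] assms(3) by auto
  then show ?thesis using d assms(3) unfolding is_semistandard_def by metis
qed

lemma col_unique: "x \<in> T (r, c) \<Longrightarrow> x \<in> T (s, c) \<Longrightarrow> r = s"
  using col[of x r c x s] col[of x s c x r] by (cases r s rule: linorder_cases) auto

lemma down:
  assumes "x \<in> T (r, c)" "1 \<le> r'" "r' \<le> r" "1 \<le> c'" "c' \<le> c"
  shows "\<exists>y. y \<in> T (r', c')"
  using ne[OF diagram_par_down[OF mu mem[OF assms(1)] assms(2-5)]] .

lemma finite_cols: "finite {c. P c \<and> (\<exists>s. Q s \<and> x \<in> T (s, c))}"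
proof (rule finite_subset)
  show "{c. P c \<and> (\<exists>s. Q s \<and> x \<in> T (s, c))} \<subseteq> snd ` diagram \<mu>" using mem by force
qed (simp add: finite_diagram[OF mu])

text \<open>A letter occurs at most once in a column (\<open>col_unique\<close>), so counting
  columns counts occurrences. \<open>Col\<close> measures by rows, \<open>later\<close> by the
  columns that follow in the reading order.\<close>

definition Col :: "nat \<Rightarrow> nat \<Rightarrow> nat set" where
  "Col k r = {c. \<exists>s\<le>r. k \<in> T (s, c)}"

definition later :: "nat \<Rightarrow> nat \<Rightarrow> nat set" where
  "later k c = {c'. c < c' \<and> (\<exists>s. k \<in> T (s, c'))}"

lemma finite_Col: "finite (Col k r)"
  using finite_cols[of "\<lambda>_. True" "\<lambda>s. s \<le> r" k] by (simp add: Col_def)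

lemma finite_later: "finite (later k c)"
  using finite_cols[of "\<lambda>c'. c < c'" "\<lambda>s. True" k] by (simp add: later_def)

lemma card_Col: "card (Col k r) = (\<Sum>s=1..r. card {c. k \<in> T (s, c)})"
proof -
  have "Col k r = (\<Union>s\<in>{1..r}. {c. k \<in> T (s, c)})" using pos(2) by (force simp: Col_def)
  moreover have "card (\<Union>s\<in>{1..r}. {c. k \<in> T (s, c)}) = (\<Sum>s=1..r. card {c. k \<in> T (s, c)})"
  proof (rule card_UN_disjoint)
    show "\<forall>s\<in>{1..r}. finite {c. k \<in> T (s, c)}"
      using finite_cols[of "\<lambda>_. True" "\<lambda>s'. s' = s" k for s] by simp
  qed (use col_unique in auto)
  ultimately show ?thesis by simp
qed

text \<open>Entries increase to the right and upwards, so from the leftmost i+1 in row r on,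
  position by rows and position by columns agree: the letters i+1 up to row r are those in columns
  from j on, and all letters i to the right of column j lie below row r. Row counts thereby become
  counts in a suffix of the column word.\<close>

lemma leftmost:
  assumes r: "Suc i \<in> T (r, j)" and left: "\<And>c. c < j \<Longrightarrow> Suc i \<notin> T (r, c)"
  shows Col_left: "Col (Suc i) r = {c. j \<le> c \<and> (\<exists>s. Suc i \<in> T (s, c))}"
    and Col_left_prev: "Col i (r - 1) = {c. j \<le> c \<and> (\<exists>s<r. i \<in> T (s, c))}"
    and left_rows: "j < c \<Longrightarrow> i \<in> T (s, c) \<Longrightarrow> s < r"
proof -
  have r1: "1 \<le> r" "1 \<le> j" using pos[OF r] by auto
  show "Col (Suc i) r = {c. j \<le> c \<and> (\<exists>s. Suc i \<in> T (s, c))}"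
  proof (intro set_eqI iffI)
    fix c assume "c \<in> Col (Suc i) r"
    then obtain s where s: "s \<le> r" "Suc i \<in> T (s, c)" by (auto simp: Col_def)
    have "j \<le> c"
    proof (rule ccontr)
      assume c: "\<not> j \<le> c"
      then have "s < r" using s left[of c] by (cases "s = r") auto
      obtain y where y: "y \<in> T (s, j)" using down[OF r, of s j] pos(2)[OF s(2)] s r1 by auto
      have "y < Suc i" by (rule col[OF y r \<open>s < r\<close>])
      moreover have "Suc i \<le> y" by (rule row[OF s(2) y]) (use c in simp)
      ultimately show False by simp
    qed
    then show "c \<in> {c. j \<le> c \<and> (\<exists>s. Suc i \<in> T (s, c))}" using s by auto
  next
    fix c assume "c \<in> {c. j \<le> c \<and> (\<exists>s. Suc i \<in> T (s, c))}"
    then obtain s where c: "j \<le> c" and s: "Suc i \<in> T (s, c)" by auto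
    have "s \<le> r"
    proof (rule ccontr)
      assume "\<not> s \<le> r"
      then have "r < s" by simp
      obtain y where y: "y \<in> T (r, c)" using down[OF s, of r c] r1 c \<open>r < s\<close> by auto
      have "y < Suc i" by (rule col[OF y s \<open>r < s\<close>])
      moreover have "Suc i \<le> y" if "j < c" by (rule row[OF r y that])
      moreover have "j \<noteq> c" using col[OF r, of "Suc i" s] s \<open>r < s\<close> by auto
      ultimately show False using c by simp
    qed
    then show "c \<in> Col (Suc i) r" using s by (auto simp: Col_def)
  qed
  show "Col i (r - 1) = {c. j \<le> c \<and> (\<exists>s<r. i \<in> T (s, c))}"
  proof -
    have "j \<le> c" if s: "s < r" "i \<in> T (s, c)" for s c
    proof (rule ccontr)
      assume "\<not> j \<le> c"
      then have cj: "c < j" by simp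
      obtain z where z: "z \<in> T (r, c)" using down[OF r, of r c] pos[OF s(2)] r1 cj by auto
      have "i < z" by (rule col[OF s(2) z s(1)])
      moreover have "z \<le> Suc i" by (rule row[OF z r cj])
      ultimately have "z = Suc i" by simp
      then show False using z left[OF cj] by simp
    qed
    moreover have "s \<le> r - 1 \<longleftrightarrow> s < r" for s using r1 by auto
    ultimately show ?thesis by (auto simp: Col_def)
  qed
  show "s < r" if jc: "j < c" and ic: "i \<in> T (s, c)"
  proof (rule ccontr)
    assume "\<not> s < r"
    then have rs: "r \<le> s" by simp
    obtain y where y: "y \<in> T (r, c)" using down[OF ic, of r c] r1 jc rs by auto
    have "Suc i \<le> y" by (rule row[OF r y jc])
    moreover have "y < i" if "r < s" by (rule col[OF y ic that])
    moreover have "Suc i \<le> i" if "r = s" using row[OF r, of i c] ic jc that by simp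
    ultimately show False using rs by (cases "r = s") auto
  qed
qed

lemma between:
  assumes "Suc i \<in> T (r, j)" "Suc i \<in> T (r, c)" "j \<le> c'" "c' \<le> c"
  shows "Suc i \<in> T (r, c')"
proof -
  consider "c' = j" | "c' = c" | "j < c'" "c' < c" using assms by linarith
  then show ?thesis
  proof cases
    case 3
    obtain z where z: "z \<in> T (r, c')" using down[OF assms(2), of r c'] pos[OF assms(1)] assms by auto
    have "Suc i \<le> z" by (rule row[OF assms(1) z 3(1)])
    moreover have "z \<le> Suc i" by (rule row[OF z assms(2) 3(2)])
    ultimately show ?thesis using z by simp
  qed (use assms in auto)
qed

text \<open>In a row containing $i+1$, the leftmost occurrence gives the strongest of the column conditions, and
at that occurrence it coincides with the condition for the row.\<close>

lemma row_conditions_iff: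
  "(\<forall>r. card (Col (Suc i) r) + l' \<le> card (Col i (r - 1)) + l) \<longleftrightarrow>
   l' \<le> l \<and> (\<forall>r c. Suc i \<in> T (r, c) \<longrightarrow>
     1 + card (later (Suc i) c) + l' \<le> card (later i c) + of_bool (\<exists>s<r. i \<in> T (s, c)) + l)"
  (is "?R \<longleftrightarrow> _ \<and> ?C")
proof (intro iffI conjI)
  assume R: ?R
  have "Col k 0 = {}" for k using pos(2) by (force simp: Col_def)
  then show "l' \<le> l" using R[rule_format, of 0] by simp
  show ?C
  proof (intro allI impI)
    fix r c assume rc: "Suc i \<in> T (r, c)"
    define j where "j = (LEAST j. Suc i \<in> T (r, j))"
    have j: "Suc i \<in> T (r, j)" unfolding j_def by (rule LeastI[of _ c]) (rule rc)
    have left: "Suc i \<notin> T (r, c')" if "c' < j" for c' using that not_less_Least unfolding j_def by blast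
    have jc: "j \<le> c" using left[of c] rc by (cases "c < j") auto
    have E1: "Col (Suc i) r = {j..<c} \<union> insert c (later (Suc i) c)"
    proof -
      have "Col (Suc i) r = {c. j \<le> c \<and> (\<exists>s. Suc i \<in> T (s, c))}"
        by (rule Col_left[OF j]) (rule left)
      also have "\<dots> = {j..<c} \<union> insert c (later (Suc i) c)"
      proof (intro set_eqI iffI)
        fix c' assume "c' \<in> {j..<c} \<union> insert c (later (Suc i) c)"
        then show "c' \<in> {c. j \<le> c \<and> (\<exists>s. Suc i \<in> T (s, c))}"
          using between[OF j rc, of c'] jc by (cases "c' \<le> c") (auto simp: later_def)
      qed (auto simp: later_def not_less)
      finally show ?thesis .
    qed
    have E2: "card ({j..<c} \<union> insert c (later (Suc i) c)) = (c - j) + (1 + card (later (Suc i) c))"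
      by (subst card_Un_disjoint) (auto simp: later_def finite_later[unfolded later_def])
    \<comment> \<open>The columns from j up to c all contain i+1 and at most as many of them contain
      i. Dropping them from both counts turns the condition for the row into the one at column
      c.\<close>
    have E3: "card (Col i (r - 1)) \<le> (c - j) + (of_bool (\<exists>s<r. i \<in> T (s, c)) + card (later i c))"
    proof -
      let ?X = "if \<exists>s<r. i \<in> T (s, c) then {c} else {}"
      have "Col i (r - 1) \<subseteq> {j..<c} \<union> (?X \<union> later i c)"
      proof -
        have "Col i (r - 1) = {c. j \<le> c \<and> (\<exists>s<r. i \<in> T (s, c))}"
          by (rule Col_left_prev[OF j]) (rule left)
        moreover have "x \<in> {j..<c} \<union> (?X \<union> later i c)" if "j \<le> x" "\<exists>s<r. i \<in> T (s, x)" for x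
        proof (cases x c rule: linorder_cases)
          case less
          then show ?thesis using that by simp
        next
          case equal
          then show ?thesis using that by simp
        next
          case greater
          then show ?thesis using that by (auto simp: later_def)
        qed
        ultimately show ?thesis by blast
      qed
      then have "card (Col i (r - 1)) \<le> card ({j..<c} \<union> (?X \<union> later i c))"
        by (intro card_mono) (auto simp: finite_later)
      also have "\<dots> \<le> card {j..<c} + (card ?X + card (later i c))"
        by (intro order_trans[OF card_Un_le] add_left_mono card_Un_le)
      also have "card ?X = of_bool (\<exists>s<r. i \<in> T (s, c))" by simp
      finally show ?thesis by simp
    qed
    show "1 + card (later (Suc i) c) + l' \<le> card (later i c) + of_bool (\<exists>s<r. i \<in> T (s, c)) + l"
      using R[rule_format, of r] E3 unfolding E1 E2 by simp
  qed
next
  assume C: "l' \<le> l \<and> ?C"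
  show ?R
  proof
    fix r show "card (Col (Suc i) r) + l' \<le> card (Col i (r - 1)) + l"
    proof (induction r)
      case 0
      have "Col (Suc i) 0 = {}" using pos(2) by (force simp: Col_def)
      then show ?case using C by simp
    next
      case (Suc r)
      show ?case
      proof (cases "\<exists>c. Suc i \<in> T (Suc r, c)")
        case False
        \<comment> \<open>Without a letter i+1 in the new row, the left side stays and the right
          side can only grow.\<close>
        then have "Col (Suc i) (Suc r) = Col (Suc i) r" by (auto simp: Col_def le_Suc_eq)
        moreover have "card (Col i (r - 1)) \<le> card (Col i (Suc r - 1))"
        proof (rule card_mono[OF finite_Col], rule subsetI)
          fix c assume "c \<in> Col i (r - 1)"
          then obtain s where "s \<le> r - 1" "i \<in> T (s, c)" by (auto simp: Col_def)
          then show "c \<in> Col i (Suc r - 1)" by (auto simp: Col_def intro!: exI[of _ s])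
        qed
        ultimately show ?thesis using Suc.IH by simp
      next
        case True
        define j where "j = (LEAST j. Suc i \<in> T (Suc r, j))"
        have j: "Suc i \<in> T (Suc r, j)" unfolding j_def by (rule LeastI_ex[OF True])
        have left: "Suc i \<notin> T (Suc r, c')" if "c' < j" for c' using that not_less_Least unfolding j_def by blast
        have "Col (Suc i) (Suc r) = insert j (later (Suc i) j)"
        proof -
          have "Col (Suc i) (Suc r) = {c. j \<le> c \<and> (\<exists>s. Suc i \<in> T (s, c))}"
            by (rule Col_left[OF j]) (rule left)
          moreover have "j \<le> x \<longleftrightarrow> x = j \<or> j < x" for x by auto
          ultimately show ?thesis using j by (auto simp: later_def)
        qed
        then have 1: "card (Col (Suc i) (Suc r)) = 1 + card (later (Suc i) j)"
          by (simp add: finite_later card_insert_if) (simp add: later_def)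
        let ?X = "if \<exists>s<Suc r. i \<in> T (s, j) then {j} else {}"
        have "Col i (Suc r - 1) = ?X \<union> later i j"
        proof -
          have "Col i (Suc r - 1) = {c. j \<le> c \<and> (\<exists>s<Suc r. i \<in> T (s, c))}"
            by (rule Col_left_prev[OF j]) (rule left)
          moreover have "(\<exists>s<Suc r. i \<in> T (s, c)) \<longleftrightarrow> (\<exists>s. i \<in> T (s, c))" if "j < c" for c
          proof -
            have "s < Suc r" if "i \<in> T (s, c)" for s
              by (rule left_rows[OF j _ \<open>j < c\<close> that]) (rule left)
            then show ?thesis by blast
          qed
          ultimately have "x \<in> Col i (Suc r - 1) \<longleftrightarrow> x \<in> ?X \<union> later i j" for x
            by (cases x j rule: linorder_cases) (auto simp: later_def)
          then show ?thesis by blast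
        qed
        moreover have "card (?X \<union> later i j) = card ?X + card (later i j)"
          by (rule card_Un_disjoint) (auto simp: finite_later, auto simp: later_def)
        ultimately have "card (Col i (Suc r - 1)) = of_bool (\<exists>s<Suc r. i \<in> T (s, j)) + card (later i j)"
          by simp
        then show ?thesis using C j 1 by fastforce
      qed
    qed
  qed
qed

end

section \<open>Suffixes of the column word\<close>

text \<open>When a suffix is extended to the left, the inequality can only break at a letter i+1. So
  it suffices to test it at the occurrences of i+1 and for the empty suffix.\<close>

lemma yamanouchi_iff:
  "yamanouchi lam w \<longleftrightarrow> (\<forall>i\<ge>1. lam (Suc i) \<le> lam i \<and> (\<forall>v. (\<exists>u. w = u @ Suc i # v) \<longrightarrow>
     1 + count_list v (Suc i) + lam (Suc i) \<le> count_list v i + lam i))"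
  (is "_ \<longleftrightarrow> ?R")
proof
  assume Y: "yamanouchi lam w"
  have Y': "count_list v (Suc i) + lam (Suc i) \<le> count_list v i + lam i" if "w = u @ v" "i \<ge> 1" for u v i
    using Y that unfolding yamanouchi_def Suc_eq_plus1 by blast
  show ?R
  proof (intro allI impI conjI)
    fix i :: nat assume i: "i \<ge> 1"
    show "lam (Suc i) \<le> lam i" using Y'[of w "[]" i] i by simp
    fix v assume "\<exists>u. w = u @ Suc i # v"
    then obtain u where "w = u @ Suc i # v" by blast
    from Y'[OF this i] show "1 + count_list v (Suc i) + lam (Suc i) \<le> count_list v i + lam i" by simp
  qed
next
  assume R: ?R
  have "count_list v (Suc i) + lam (Suc i) \<le> count_list v i + lam i" if "w = u @ v" "i \<ge> 1" for u v i
    using that(1)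
  proof (induction v arbitrary: u)
    case Nil
    then show ?case using R that(2) by simp
  next
    case (Cons x v)
    have IH: "count_list v (Suc i) + lam (Suc i) \<le> count_list v i + lam i"
      by (rule Cons.IH[of "u @ [x]"]) (use Cons.prems in simp)
    show ?case
    proof (cases "x = Suc i")
      case True
      then show ?thesis using R that(2) Cons.prems by force
    next
      case False
      then show ?thesis using IH by simp
    qed
  qed
  then show "yamanouchi lam w" unfolding yamanouchi_def Suc_eq_plus1[symmetric] by blast
qed

lemma concat_map_split:
  "concat (map f xs) = u @ x # v \<longleftrightarrow>
    (\<exists>ys y zs u' v'. xs = ys @ y # zs \<and> f y = u' @ x # v' \<and> u = concat (map f ys) @ u' \<and> v = v' @ concat (map f zs))"
proof
  show "concat (map f xs) = u @ x # v \<Longrightarrow>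
    \<exists>ys y zs u' v'. xs = ys @ y # zs \<and> f y = u' @ x # v' \<and> u = concat (map f ys) @ u' \<and> v = v' @ concat (map f zs)"
  proof (induction xs arbitrary: u)
    case (Cons a xs)
    then have "f a @ concat (map f xs) = u @ x # v" by simp
    then consider t where "f a = u @ t" "t @ concat (map f xs) = x # v"
      | t where "u = f a @ t" "concat (map f xs) = t @ x # v"
      by (auto simp: append_eq_append_conv2)
    then show ?case
    proof cases
      case (1 t)
      show ?thesis
      proof (cases t)
        case Nil
        then have "concat (map f xs) = [] @ x # v" using 1 by simp
        from Cons.IH[OF this] obtain ys y zs u' v' where *: "xs = ys @ y # zs" "f y = u' @ x # v'"
          "[] = concat (map f ys) @ u'" "v = v' @ concat (map f zs)" by blast
        show ?thesis
          by (rule exI[of _ "a # ys"], rule exI[of _ y], rule exI[of _ zs], rule exI[of _ u'], rule exI[of _ v'])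
             (use * 1 Nil in auto)
      next
        case (Cons b t')
        show ?thesis
          by (rule exI[of _ "[]"], rule exI[of _ a], rule exI[of _ xs], rule exI[of _ u], rule exI[of _ t'])
             (use 1 Cons in auto)
      qed
    next
      case (2 t)
      from Cons.IH[OF 2(2)] obtain ys y zs u' v' where *: "xs = ys @ y # zs" "f y = u' @ x # v'"
          "t = concat (map f ys) @ u'" "v = v' @ concat (map f zs)" by blast
      show ?thesis
        by (rule exI[of _ "a # ys"], rule exI[of _ y], rule exI[of _ zs], rule exI[of _ u'], rule exI[of _ v'])
           (use * 2 in auto)
    qed
  qed simp
qed auto

lemma upt_split_iff: "[a..<b] = ys @ y # zs \<longleftrightarrow> a \<le> y \<and> y < b \<and> ys = [a..<y] \<and> zs = [Suc y..<b]"
proof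
  assume e: "[a..<b] = ys @ y # zs"
  have len: "length ys < b - a" using arg_cong[OF e, of length] by simp
  have "[a..<b] ! length ys = y" using e by simp
  then have y: "y = a + length ys" using len by (subst (asm) nth_upt) auto
  have "take (length ys) [a..<b] = ys" using e by simp
  moreover have "drop (Suc (length ys)) [a..<b] = zs" using e by simp
  ultimately show "a \<le> y \<and> y < b \<and> ys = [a..<y] \<and> zs = [Suc y..<b]"
    using y len by (auto simp: take_upt drop_upt)
next
  assume "a \<le> y \<and> y < b \<and> ys = [a..<y] \<and> zs = [Suc y..<b]"
  then show "[a..<b] = ys @ y # zs"
    using upt_add_eq_append[of a y "b - y"] upt_conv_Cons[of y b] by simp
qed

lemma rev_upt_split_iff: "rev [a..<b] = ys @ y # zs \<longleftrightarrow> a \<le> y \<and> y < b \<and> ys = rev [Suc y..<b] \<and> zs = rev [a..<y]"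
proof -
  have "rev [a..<b] = ys @ y # zs \<longleftrightarrow> [a..<b] = rev zs @ y # rev ys"
    by (metis rev_rev_ident rev_append rev.simps(2) append_assoc append_Cons append_Nil)
  also have "\<dots> \<longleftrightarrow> a \<le> y \<and> y < b \<and> ys = rev [Suc y..<b] \<and> zs = rev [a..<y]"
    unfolding upt_split_iff by (metis rev_rev_ident)
  finally show ?thesis .
qed

lemma count_list_distinct: "distinct xs \<Longrightarrow> count_list xs x = of_bool (x \<in> set xs)"
  by (induction xs) auto

lemma count_list_concat_map: "count_list (concat (map f xs)) k = (\<Sum>x\<leftarrow>xs. count_list (f x) k)"
  by (induction xs) auto

lemma count_concat_distinct:
  assumes "distinct xs" "\<And>x. x \<in> set xs \<Longrightarrow> count_list (f x) k = of_bool (P x)"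
  shows "count_list (concat (map f xs)) k = card {x \<in> set xs. P x}"
proof -
  have "count_list (concat (map f xs)) k = (\<Sum>x\<in>set xs. of_bool (P x))"
    unfolding count_list_concat_map sum_list_distinct_conv_sum_set[OF assms(1)]
    by (intro sum.cong refl assms(2))
  then show ?thesis by (simp add: Int_def)
qed

context svtab begin

lemma column_height_mem: "(r, c) \<in> diagram \<mu> \<longleftrightarrow> 1 \<le> c \<and> r \<in> {1..column_height \<mu> c}"
proof (cases "1 \<le> c")
  case True
  have "{r. (r, c) \<in> diagram \<mu>} = {1..card {r. (r, c) \<in> diagram \<mu>}}"
  proof (rule initial_segment_eq)
    show "finite {r. (r, c) \<in> diagram \<mu>}"
      by (rule finite_subset[of _ "fst ` diagram \<mu>"]) (use finite_diagram[OF mu] in force)+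
    show "r' \<in> {r. (r, c) \<in> diagram \<mu>}" if "r \<in> {r. (r, c) \<in> diagram \<mu>}" "1 \<le> r'" "r' \<le> r" for r r'
      using diagram_par_down[OF mu, of r c r' c] that True by simp
  qed (simp add: mem_diagram)
  then show ?thesis using True unfolding column_height_def by blast
next
  case False
  then show ?thesis by (simp add: mem_diagram)
qed

abbreviation cell_word :: "nat \<Rightarrow> nat \<Rightarrow> nat list" where
  "cell_word c r \<equiv> sorted_list_of_set (T (r, c))"

abbreviation col_word :: "nat \<Rightarrow> nat list" where
  "col_word c \<equiv> concat (map (cell_word c) (rev [1..<Suc (column_height \<mu> c)]))"

lemma count_cell: "count_list (cell_word c r) k = of_bool (k \<in> T (r, c))"
  using count_list_distinct[of "cell_word c r" k] fin by simp

lemma card_rows: "card {r \<in> A. k \<in> T (r, c)} = of_bool (\<exists>r\<in>A. k \<in> T (r, c))"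
proof (cases "\<exists>r\<in>A. k \<in> T (r, c)")
  case True
  then obtain r where "r \<in> A" "k \<in> T (r, c)" by blast
  then have "{r \<in> A. k \<in> T (r, c)} = {r}" using col_unique by blast
  then show ?thesis using True by simp
next
  case False
  then have "{r \<in> A. k \<in> T (r, c)} = {}" by blast
  then show ?thesis using False by (simp only: card.empty) simp
qed

lemma count_col: "count_list (col_word c) k = of_bool (\<exists>r. k \<in> T (r, c))"
proof -
  have "count_list (col_word c) k = card {r \<in> set (rev [1..<Suc (column_height \<mu> c)]). k \<in> T (r, c)}"
    by (rule count_concat_distinct) (simp_all only: count_cell distinct_rev distinct_upt)
  also have "\<dots> = of_bool (\<exists>r\<in>set (rev [1..<Suc (column_height \<mu> c)]). k \<in> T (r, c))" by (rule card_rows)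
  also have "(\<exists>r\<in>set (rev [1..<Suc (column_height \<mu> c)]). k \<in> T (r, c)) \<longleftrightarrow> (\<exists>r. k \<in> T (r, c))"
    using mem column_height_mem by (metis atLeastAtMost_upt set_rev)
  finally show ?thesis .
qed

text \<open>Behind a letter come the larger letters of its cell, the cells below it in its column,
  and the columns to the right.\<close>

lemma column_word_occurrence:
  "(\<exists>u. column_word \<mu> T = u @ x # v) \<longleftrightarrow>
    (\<exists>r c u' v'. x \<in> T (r, c) \<and> cell_word c r = u' @ x # v' \<and>
      v = v' @ concat (map (cell_word c) (rev [1..<r])) @ concat (map col_word [Suc c..<Suc (\<mu> 1)]))"
proof
  assume "\<exists>u. column_word \<mu> T = u @ x # v"
  then obtain u where "concat (map col_word [1..<Suc (\<mu> 1)]) = u @ x # v" by (auto simp: column_word_def)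
  then obtain ys c zs u1 v1 where 1: "[1..<Suc (\<mu> 1)] = ys @ c # zs" "col_word c = u1 @ x # v1"
    "v = v1 @ concat (map col_word zs)" unfolding concat_map_split by blast
  from 1(2) obtain ys' r zs' u2 v2 where 2: "rev [1..<Suc (column_height \<mu> c)] = ys' @ r # zs'"
    "cell_word c r = u2 @ x # v2" "v1 = v2 @ concat (map (cell_word c) zs')" unfolding concat_map_split by blast
  have "x \<in> T (r, c)"
  proof -
    have "x \<in> set (cell_word c r)" unfolding 2(2) by simp
    then show ?thesis using fin by simp
  qed
  moreover have "zs = [Suc c..<Suc (\<mu> 1)]" using 1(1) unfolding upt_split_iff by blast
  moreover have "zs' = rev [1..<r]" using 2(1) unfolding rev_upt_split_iff by blast
  ultimately have "x \<in> T (r, c) \<and> cell_word c r = u2 @ x # v2 \<and>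
      v = v2 @ concat (map (cell_word c) (rev [1..<r])) @ concat (map col_word [Suc c..<Suc (\<mu> 1)])"
    using 1(3) 2(2,3) by (simp only: append.assoc simp_thms)
  then show "\<exists>r c u' v'. x \<in> T (r, c) \<and> cell_word c r = u' @ x # v' \<and>
      v = v' @ concat (map (cell_word c) (rev [1..<r])) @ concat (map col_word [Suc c..<Suc (\<mu> 1)])"
    by blast
next
  assume "\<exists>r c u' v'. x \<in> T (r, c) \<and> cell_word c r = u' @ x # v' \<and>
      v = v' @ concat (map (cell_word c) (rev [1..<r])) @ concat (map col_word [Suc c..<Suc (\<mu> 1)])"
  then obtain r c u' v' where x: "x \<in> T (r, c)" and w: "cell_word c r = u' @ x # v'"
    and v: "v = v' @ concat (map (cell_word c) (rev [1..<r])) @ concat (map col_word [Suc c..<Suc (\<mu> 1)])" by blast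
  have d: "(r, c) \<in> diagram \<mu>" by (rule mem[OF x])
  have r: "1 \<le> r" "r \<le> column_height \<mu> c" using column_height_mem[of r c] d by auto
  have "c \<le> \<mu> 1" using d par_antimono[OF mu, of 1 r] by (auto simp: mem_diagram)
  then have c: "[1..<Suc (\<mu> 1)] = [1..<c] @ c # [Suc c..<Suc (\<mu> 1)]"
    unfolding upt_split_iff using pos(3)[OF x] by simp
  have r': "rev [1..<Suc (column_height \<mu> c)] = rev [Suc r..<Suc (column_height \<mu> c)] @ r # rev [1..<r]"
    unfolding rev_upt_split_iff using r by simp
  have "col_word c = (concat (map (cell_word c) (rev [Suc r..<Suc (column_height \<mu> c)])) @ u') @ x # v' @ concat (map (cell_word c) (rev [1..<r]))"
    unfolding r' by (simp add: w)
  then have "column_word \<mu> T = (concat (map col_word [1..<c]) @ concat (map (cell_word c) (rev [Suc r..<Suc (column_height \<mu> c)])) @ u') @ x # v"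
    unfolding column_word_def c v map_append concat_append list.map concat.simps
    by (simp only: append.assoc append_Cons)
  then show "\<exists>u. column_word \<mu> T = u @ x # v" by blast
qed

text \<open>A cell is read in increasing order, so the rest of the cell contains neither i nor i+1.
  A letter i in the same cell precedes i+1 and is not counted, which is why only rows s < r
  appear.\<close>

lemma count_after:
  assumes x: "Suc i \<in> T (r, c)" and w: "cell_word c r = u' @ Suc i # v'"
    and v: "v = v' @ concat (map (cell_word c) (rev [1..<r])) @ concat (map col_word [Suc c..<Suc (\<mu> 1)])"
  shows "count_list v (Suc i) = card (later (Suc i) c)"
    "count_list v i = card (later i c) + of_bool (\<exists>s<r. i \<in> T (s, c))"
proof -
  have "sorted (cell_word c r)" "distinct (cell_word c r)" by auto
  then have v': "k \<notin> set v'" if "k \<le> Suc i" for k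
    using that unfolding w by (auto simp: sorted_append)
  have c1: "count_list v' k = 0" if "k \<le> Suc i" for k
    using v'[OF that] by (simp add: count_list_0_iff)
  have c2: "count_list (concat (map (cell_word c) (rev [1..<r]))) k = of_bool (\<exists>s<r. k \<in> T (s, c))" for k
  proof -
    have "count_list (concat (map (cell_word c) (rev [1..<r]))) k = card {s \<in> set (rev [1..<r]). k \<in> T (s, c)}"
      by (rule count_concat_distinct) (simp_all only: count_cell distinct_rev distinct_upt)
    also have "\<dots> = of_bool (\<exists>s\<in>set (rev [1..<r]). k \<in> T (s, c))" by (rule card_rows)
    also have "(\<exists>s\<in>set (rev [1..<r]). k \<in> T (s, c)) \<longleftrightarrow> (\<exists>s<r. k \<in> T (s, c))"
      using pos(2) by (metis atLeastLessThan_iff atLeastLessThan_upt set_rev)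
    finally show ?thesis .
  qed
  have c3: "count_list (concat (map col_word [Suc c..<Suc (\<mu> 1)])) k = card (later k c)" for k
  proof -
    have "count_list (concat (map col_word [Suc c..<Suc (\<mu> 1)])) k =
        card {c' \<in> set [Suc c..<Suc (\<mu> 1)]. \<exists>s. k \<in> T (s, c')}"
      by (rule count_concat_distinct) (simp_all only: count_col distinct_upt)
    also have "{c' \<in> set [Suc c..<Suc (\<mu> 1)]. \<exists>s. k \<in> T (s, c')} = later k c"
    proof -
      have "c' \<le> \<mu> 1" if "k \<in> T (s, c')" for s c'
        using mem[OF that] par_antimono[OF mu, of 1 s] by (auto simp: mem_diagram)
      moreover have "set [Suc c..<Suc (\<mu> 1)] = {c'. c < c' \<and> c' \<le> \<mu> 1}" by auto
      ultimately show ?thesis by (simp only:) (auto simp: later_def)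
    qed
    finally show ?thesis .
  qed
  have "\<not> (\<exists>s<r. Suc i \<in> T (s, c))" using col_unique[OF x] by blast
  then show "count_list v (Suc i) = card (later (Suc i) c)"
    unfolding v count_list_append c2 c3 using c1[of "Suc i"] by simp
  show "count_list v i = card (later i c) + of_bool (\<exists>s<r. i \<in> T (s, c))"
    unfolding v count_list_append c2 c3 using c1[of i] by simp
qed

lemma column_yamanouchi_iff:
  "column_yamanouchi lam \<mu> T \<longleftrightarrow>
    (\<forall>i\<ge>1. \<forall>r. card (Col (Suc i) r) + lam (Suc i) \<le> card (Col i (r - 1)) + lam i)"
  unfolding column_yamanouchi_def yamanouchi_iff row_conditions_iff
proof (intro all_cong1 imp_cong conj_cong refl)
  fix i :: nat
  show "(\<forall>v. (\<exists>u. column_word \<mu> T = u @ Suc i # v) \<longrightarrow>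
         1 + count_list v (Suc i) + lam (Suc i) \<le> count_list v i + lam i) \<longleftrightarrow>
    (\<forall>r c. Suc i \<in> T (r, c) \<longrightarrow> 1 + card (later (Suc i) c) + lam (Suc i)
           \<le> card (later i c) + of_bool (\<exists>s<r. i \<in> T (s, c)) + lam i)" (is "?L \<longleftrightarrow> ?R")
  proof
    assume L: ?L
    show ?R
    proof (intro allI impI)
      fix r c assume x: "Suc i \<in> T (r, c)"
      then have "Suc i \<in> set (cell_word c r)" using fin by simp
      then obtain u' v' where w: "cell_word c r = u' @ Suc i # v'" by (meson split_list)
      define v where "v = v' @ concat (map (cell_word c) (rev [1..<r])) @ concat (map col_word [Suc c..<Suc (\<mu> 1)])"
      have "\<exists>u. column_word \<mu> T = u @ Suc i # v"
        unfolding column_word_occurrence using x w v_def by blast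
      from L[rule_format, OF this]
      show "1 + card (later (Suc i) c) + lam (Suc i) \<le> card (later i c) + of_bool (\<exists>s<r. i \<in> T (s, c)) + lam i"
        unfolding count_after[OF x w v_def] .
    qed
  next
    assume R: ?R
    show ?L
    proof (intro allI impI)
      fix v assume "\<exists>u. column_word \<mu> T = u @ Suc i # v"
      then obtain r c u' v' where x: "Suc i \<in> T (r, c)" and w: "cell_word c r = u' @ Suc i # v'"
        and v: "v = v' @ concat (map (cell_word c) (rev [1..<r])) @ concat (map col_word [Suc c..<Suc (\<mu> 1)])"
        unfolding column_word_occurrence by blast
      show "1 + count_list v (Suc i) + lam (Suc i) \<le> count_list v i + lam i"
        unfolding count_after[OF x w v] using R x by blast
    qed
  qed
qed

end

section \<open>Set-valued tableaux and patterns correspond\<close>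

definition tableau_of :: "nat \<Rightarrow> pattern \<Rightarrow> nat \<times> nat \<Rightarrow> nat set" where
  "tableau_of n D = (\<lambda>(r, c). {k. 1 \<le> k \<and> k \<le> n \<and> 1 \<le> r \<and> 1 \<le> c \<and>
     (fst D (k - 1) r < c \<and> c \<le> fst D k r \<or> c = fst D (k - 1) r \<and> snd D k r = 1)})"

definition pattern_of :: "nat \<Rightarrow> (nat \<Rightarrow> nat) \<Rightarrow> (nat \<times> nat \<Rightarrow> nat set) \<Rightarrow> pattern" where
  "pattern_of n \<mu> T =
    (\<lambda>k r. if k \<le> n then card {c. (r, c) \<in> diagram \<mu> \<and> (\<exists>x\<in>T (r, c). x \<le> k)} else 0,
     \<lambda>k r. of_bool (\<exists>c. k \<in> T (r, c) \<and> (\<exists>x\<in>T (r, c). x < k)))"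

lemma mem_tableau_of: "k \<in> tableau_of n (\<rho>, \<epsilon>) (r, c) \<longleftrightarrow> 1 \<le> k \<and> k \<le> n \<and> 1 \<le> r \<and> 1 \<le> c \<and>
     (\<rho> (k - 1) r < c \<and> c \<le> \<rho> k r \<or> c = \<rho> (k - 1) r \<and> \<epsilon> k r = 1)"
  by (simp add: tableau_of_def)

lemma pat_mono_le:
  assumes D: "(\<rho>, \<epsilon>) \<in> pat n \<mu>" and "j \<le> k" "k \<le> n"
  shows "\<rho> j r \<le> \<rho> k r"
  using assms(2,3)
proof (induction k rule: dec_induct)
  case (step k)
  then show ?case using pat_mono[OF D, of k r] by simp
qed simp

lemma pat_shift:
  assumes D: "(\<rho>, \<epsilon>) \<in> pat n \<mu>" and "1 \<le> k" "k \<le> n" "1 \<le> r"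
  shows "\<rho> k (Suc r) \<le> \<rho> (k - 1) r"
  using patD(5)[OF D, of "k - 1" r] assms by simp

lemma pat_antimono:
  assumes D: "(\<rho>, \<epsilon>) \<in> pat n \<mu>" and k: "k \<le> n" and "1 \<le> r" "r \<le> s"
  shows "\<rho> k s \<le> \<rho> k r"
  using assms(4)
proof (induction s rule: dec_induct)
  case (step s)
  have "\<rho> k (Suc s) \<le> \<rho> k s"
  proof (cases "k = 0")
    case True
    then show ?thesis using patD(1)[OF D] by simp
  next
    case False
    then show ?thesis using pat_shift[OF D, of k s] pat_mono_le[OF D, of "k - 1" k s] k step assms(3) by simp
  qed
  then show ?case using step.IH by simp
qed simp

lemma pat_shape_par:
  assumes D: "D \<in> pat n \<mu>"
  shows "\<mu> \<in> par n"
proof -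
  obtain \<rho> \<epsilon> where De: "D = (\<rho>, \<epsilon>)" by force
  note P = D[unfolded De]
  have m: "\<rho> n = \<mu>" by (rule patD(2)[OF P])
  then show ?thesis
    using patD(4)[OF P, of n] pat_antimono[OF P order_refl] pat_row_0[OF P, of n] by (auto simp: par_def)
qed

text \<open>Recovers \<rho> k from the tableau through least letters, as needed to invert the
  encoding.\<close>

lemma tableau_of_threshold:
  assumes D: "(\<rho>, \<epsilon>) \<in> pat n \<mu>" and rc: "1 \<le> r" "1 \<le> c" "k \<le> n"
  shows "(\<exists>x\<in>tableau_of n (\<rho>, \<epsilon>) (r, c). x \<le> k) \<longleftrightarrow> c \<le> \<rho> k r"
proof
  assume "\<exists>x\<in>tableau_of n (\<rho>, \<epsilon>) (r, c). x \<le> k"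
  then obtain x where x: "x \<in> tableau_of n (\<rho>, \<epsilon>) (r, c)" "x \<le> k" by blast
  have "c \<le> \<rho> x r"
    using x pat_mono_le[OF D, of "x - 1" x r] unfolding mem_tableau_of by auto
  then show "c \<le> \<rho> k r" using pat_mono_le[OF D x(2) rc(3), of r] by simp
next
  assume c: "c \<le> \<rho> k r"
  define x where "x = (LEAST x. c \<le> \<rho> x r)"
  have x: "c \<le> \<rho> x r" unfolding x_def by (rule LeastI) (rule c)
  have xk: "x \<le> k" unfolding x_def by (rule Least_le) (rule c)
  have x1: "1 \<le> x" using x rc patD(1)[OF D, of r] by (cases "x = 0") auto
  have "\<not> c \<le> \<rho> (x - 1) r" unfolding x_def by (rule not_less_Least) (use x1 in \<open>simp add: x_def\<close>)
  then have "x \<in> tableau_of n (\<rho>, \<epsilon>) (r, c)" using x x1 xk rc by (simp add: mem_tableau_of)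
  then show "\<exists>x\<in>tableau_of n (\<rho>, \<epsilon>) (r, c). x \<le> k" using xk by blast
qed

lemma tableau_of_bounds:
  assumes D: "(\<rho>, \<epsilon>) \<in> pat n \<mu>" and x: "x \<in> tableau_of n (\<rho>, \<epsilon>) (r, c)"
  shows "c \<le> \<rho> x r" "\<rho> (x - 1) r \<le> c"
  using x pat_mono_le[OF D, of "x - 1" x r] unfolding mem_tableau_of by auto

lemma tableau_of_svt:
  assumes D: "(\<rho>, \<epsilon>) \<in> pat n \<mu>"
  shows "is_set_valued_tableau \<mu> (tableau_of n (\<rho>, \<epsilon>))"
proof (rule svtI)
  let ?T = "tableau_of n (\<rho>, \<epsilon>)"
  have mu: "\<rho> n = \<mu>" by (rule patD(2)[OF D])
  show "finite (?T (r, c)) \<and> ?T (r, c) \<noteq> {} \<and> (\<forall>i\<in>?T (r, c). 1 \<le> i)" if rc: "(r, c) \<in> diagram \<mu>" for r c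
  proof -
    have "finite (?T (r, c))" by (rule finite_subset[of _ "{..n}"]) (auto simp: mem_tableau_of)
    moreover have "?T (r, c) \<noteq> {}"
      using tableau_of_threshold[OF D, of r c n] rc mu by (auto simp: mem_diagram)
    ultimately show ?thesis by (auto simp: mem_tableau_of)
  qed
  show "?T (r, c) = {}" if rc: "(r, c) \<notin> diagram \<mu>" for r c
  proof (rule ccontr)
    assume "?T (r, c) \<noteq> {}"
    then obtain x where x: "x \<in> ?T (r, c)" by blast
    then have "c \<le> \<mu> r" "1 \<le> r" "1 \<le> c"
      using tableau_of_bounds(1)[OF D x] pat_le_shape[OF D, of x r] by (auto simp: mem_tableau_of)
    then show False using rc by (simp add: mem_diagram)
  qed
  show "x \<le> y" if xy: "x \<in> ?T (r, c)" "y \<in> ?T (r, c')" "c < c'" for r c c' x y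
  proof (rule ccontr)
    assume "\<not> x \<le> y"
    then have "\<rho> y r \<le> \<rho> (x - 1) r" using xy by (intro pat_mono_le[OF D]) (auto simp: mem_tableau_of)
    then show False using tableau_of_bounds(1)[OF D xy(2)] tableau_of_bounds(2)[OF D xy(1)] xy(3) by simp
  qed
  show "x < y" if xy: "x \<in> ?T (r, c)" "y \<in> ?T (r', c)" "r < r'" for r r' c x y
  proof (rule ccontr)
    assume "\<not> x < y"
    have x: "1 \<le> x" "x \<le> n" "1 \<le> r" using xy(1) by (auto simp: mem_tableau_of)
    have "c \<le> \<rho> y r'" by (rule tableau_of_bounds(1)[OF D xy(2)])
    also have "\<dots> \<le> \<rho> x r'" using \<open>\<not> x < y\<close> x by (intro pat_mono_le[OF D]) auto
    also have "\<dots> \<le> \<rho> x (Suc r)" by (rule pat_antimono[OF D]) (use x xy in auto)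
    finally have c: "c \<le> \<rho> x (Suc r)" .
    also have "\<dots> \<le> \<rho> (x - 1) r" by (rule pat_shift[OF D]) (use x in auto)
    \<comment> \<open>The inequalities leave only the case that x is an extra letter of its cell;
      its admissibility forbids a cell of \<rho> x above, yet (r+1, c) is one.\<close>
    finally have "c = \<rho> (x - 1) r" "\<epsilon> x r = 1" using xy(1) by (auto simp: mem_tableau_of)
    then show False using c patD(7)[OF D, of x r] by (auto simp: of_bool_def split: if_splits)
  qed
qed

lemma pattern_of_tableau_of:
  assumes D: "(\<rho>, \<epsilon>) \<in> pat n \<mu>"
  shows "pattern_of n \<mu> (tableau_of n (\<rho>, \<epsilon>)) = (\<rho>, \<epsilon>)"
proof -
  let ?T = "tableau_of n (\<rho>, \<epsilon>)"
  have r: "(if k \<le> n then card {c. (r, c) \<in> diagram \<mu> \<and> (\<exists>x\<in>?T (r, c). x \<le> k)} else 0) = \<rho> k r" for k r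
  proof (cases "k \<le> n \<and> 1 \<le> r")
    case True
    have "{c. (r, c) \<in> diagram \<mu> \<and> (\<exists>x\<in>?T (r, c). x \<le> k)} = {1..\<rho> k r}"
    proof (intro set_eqI)
      fix c
      show "c \<in> {c. (r, c) \<in> diagram \<mu> \<and> (\<exists>x\<in>?T (r, c). x \<le> k)} \<longleftrightarrow> c \<in> {1..\<rho> k r}"
      proof (cases "1 \<le> c")
        case c: True
        have "(r, c) \<in> diagram \<mu>" if "c \<le> \<rho> k r"
          using that c True pat_le_shape[OF D, of k r] by (simp add: mem_diagram)
        then show ?thesis using tableau_of_threshold[OF D _ c, of r k] True c by auto
      qed (auto simp: mem_tableau_of)
    qed
    then show ?thesis using True by simp
  next
    case False
    have "{c. (0, c) \<in> diagram \<mu> \<and> (\<exists>x\<in>?T (0, c). x \<le> k)} = {}" by (auto simp: mem_diagram)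
    then have "card {c. (0, c) \<in> diagram \<mu> \<and> (\<exists>x\<in>?T (0, c). x \<le> k)} = 0" by (simp only: card.empty)
    then show ?thesis using False patD(3,4)[OF D] by (cases "r = 0") auto
  qed
  have e: "of_bool (\<exists>c. k \<in> ?T (r, c) \<and> (\<exists>x\<in>?T (r, c). x < k)) = \<epsilon> k r" for k r
  proof (cases "\<epsilon> k r = 1")
    case True
    then have k: "1 \<le> k" "k \<le> n" "1 \<le> r" "\<rho> k (Suc r) < \<rho> (k - 1) r"
      using patD(7)[OF D, of k r] by (auto simp: of_bool_def split: if_splits)
    define c where "c = \<rho> (k - 1) r"
    have c: "1 \<le> c" using k by (simp add: c_def)
    have "k \<in> ?T (r, c)" using True k c by (simp add: mem_tableau_of c_def)
    moreover have "\<exists>x\<in>?T (r, c). x \<le> k - 1"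
      using tableau_of_threshold[OF D k(3) c, of "k - 1"] k by (simp add: c_def)
    then have "\<exists>x\<in>?T (r, c). x < k" using k(1) by (meson diff_less le_trans less_one linorder_not_less not_less_eq_eq nat_less_le order.strict_trans1 zero_less_one)
    ultimately show ?thesis using True by auto
  next
    case False
    then have "\<epsilon> k r = 0" using patD(7)[OF D, of k r] by (auto simp: of_bool_def split: if_splits)
    moreover have "\<not> (k \<in> ?T (r, c) \<and> (\<exists>x\<in>?T (r, c). x < k))" for c
    proof
      assume "k \<in> ?T (r, c) \<and> (\<exists>x\<in>?T (r, c). x < k)"
      then obtain x where k: "k \<in> ?T (r, c)" and x: "x \<in> ?T (r, c)" "x < k" by blast
      have "\<rho> x r \<le> \<rho> (k - 1) r" using k x by (intro pat_mono_le[OF D]) (auto simp: mem_tableau_of)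
      then have "c \<le> \<rho> (k - 1) r" using tableau_of_bounds(1)[OF D x(1)] by simp
      then show False using k False by (auto simp: mem_tableau_of)
    qed
    ultimately show ?thesis by simp
  qed
  show ?thesis unfolding pattern_of_def by (simp only: r e)
qed

context svtab begin

text \<open>The cells with a letter at most k are closed under moving left and down, so they form a
  partition and are determined by the row lengths stored in the pattern.\<close>

lemma pattern_of_threshold:
  assumes rc: "1 \<le> r" "1 \<le> c" "k \<le> n"
  shows "c \<le> fst (pattern_of n \<mu> T) k r \<longleftrightarrow> (\<exists>x\<in>T (r, c). x \<le> k)"
proof -
  define S where "S = {(r, c). (r, c) \<in> diagram \<mu> \<and> (\<exists>x\<in>T (r, c). x \<le> k)}"
  have sub: "S \<subseteq> diagram \<mu>" by (auto simp: S_def)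
  have dn: "(r', c') \<in> S" if h: "(r, c) \<in> S" "1 \<le> r'" "r' \<le> r" "1 \<le> c'" "c' \<le> c" for r c r' c'
  proof -
    obtain x where x: "x \<in> T (r, c)" "x \<le> k" using h(1) by (auto simp: S_def)
    have c1: "1 \<le> c" by (rule pos(3)[OF x(1)])
    obtain w where w: "w \<in> T (r', c)" "w \<le> x"
    proof (cases "r' = r")
      case True
      then show ?thesis using that x by auto
    next
      case False
      obtain w where "w \<in> T (r', c)" using down[OF x(1) h(2,3) c1] by auto
      moreover from this have "w < x" by (rule col[OF _ x(1)]) (use False h in simp)
      ultimately show ?thesis using that by auto
    qed
    obtain y where y: "y \<in> T (r', c')" "y \<le> w"
    proof (cases "c' = c")
      case True
      then show ?thesis using that w by auto
    next
      case False
      obtain y where "y \<in> T (r', c')" using down[OF w(1) h(2) order_refl h(4,5)] by auto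
      moreover from this have "y \<le> w" by (rule row[OF _ w(1)]) (use False h in simp)
      ultimately show ?thesis using that by auto
    qed
    then show ?thesis using mem[OF y(1)] x w by (auto simp: S_def intro!: bexI[of _ y])
  qed
  have eq: "fst (pattern_of n \<mu> T) k = (\<lambda>r. card {c. (r, c) \<in> S})"
    using rc(3) by (simp add: pattern_of_def S_def)
  have dd: "diagram (\<lambda>r. card {c. (r, c) \<in> S}) = S"
    using diagram_of_downset(2)[OF mu sub dn] .
  have "(r, c) \<in> diagram (\<lambda>r. card {c. (r, c) \<in> S}) \<longleftrightarrow> (r, c) \<in> S" using dd by simp
  then show "c \<le> fst (pattern_of n \<mu> T) k r \<longleftrightarrow> (\<exists>x\<in>T (r, c). x \<le> k)"
    using rc mem unfolding eq by (auto simp: S_def mem_diagram)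
qed

text \<open>A cell of \<rho> (k-1) further right in the row would hold a letter below k, against the
  row condition; a cell of \<rho> k above would hold a letter at most k, against column strictness.
  So the place of an extra letter is determined, and one indicator per letter and row
  suffices.\<close>

lemma pattern_of_eps:
  assumes x: "x \<in> T (r, c)" "x < k" and k: "k \<in> T (r, c)" "k \<le> n"
  shows "c = fst (pattern_of n \<mu> T) (k - 1) r" "fst (pattern_of n \<mu> T) k (Suc r) < c"
proof -
  let ?\<rho> = "fst (pattern_of n \<mu> T)"
  have rc: "1 \<le> r" "1 \<le> c" using pos[OF x(1)] by auto
  have "\<exists>x\<in>T (r, c). x \<le> k - 1" using x by (intro bexI[of _ x]) auto
  then have 1: "c \<le> ?\<rho> (k - 1) r" using pattern_of_threshold[OF rc, of "k - 1"] k by simp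
  show "c = ?\<rho> (k - 1) r"
  proof (rule ccontr)
    assume "c \<noteq> ?\<rho> (k - 1) r"
    define d where "d = ?\<rho> (k - 1) r"
    have d: "c < d" using 1 \<open>c \<noteq> ?\<rho> (k - 1) r\<close> by (simp add: d_def)
    then have "1 \<le> d" "k - 1 \<le> n" using k rc by auto
    from pattern_of_threshold(1)[OF rc(1) this] have "\<exists>y\<in>T (r, d). y \<le> k - 1" unfolding d_def by blast
    then obtain y where y: "y \<in> T (r, d)" "y \<le> k - 1" by blast
    have "k \<le> y" by (rule row[OF k(1) y(1) d])
    then show False using y x by simp
  qed
  show "?\<rho> k (Suc r) < c"
  proof (rule ccontr)
    assume "\<not> ?\<rho> k (Suc r) < c"
    then have "\<exists>y\<in>T (Suc r, c). y \<le> k" using pattern_of_threshold[of "Suc r" c k n] k rc by simp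
    then obtain y where y: "y \<in> T (Suc r, c)" "y \<le> k" by blast
    have "k < y" by (rule col[OF k(1) y(1)]) simp
    then show False using y by simp
  qed
qed

lemma pattern_of_in_pat:
  assumes n: "\<And>x. T x \<subseteq> {1..n}"
  shows "pattern_of n \<mu> T \<in> pat n \<mu>"
proof -
  let ?\<rho> = "fst (pattern_of n \<mu> T)" and ?\<epsilon> = "snd (pattern_of n \<mu> T)"
  have r0: "?\<rho> k 0 = 0" for k by (simp add: pattern_of_def mem_diagram)
  have leI: "?\<rho> k s \<le> ?\<rho> k' r" if "1 \<le> r" "k' \<le> n" "\<And>c. 1 \<le> c \<Longrightarrow> c \<le> ?\<rho> k s \<Longrightarrow> \<exists>x\<in>T (r, c). x \<le> k'" for k k' r s
  proof (cases "?\<rho> k s = 0")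
    case False
    then have "\<exists>x\<in>T (r, ?\<rho> k s). x \<le> k'" using that(3)[of "?\<rho> k s"] by simp
    then show ?thesis using pattern_of_threshold[OF that(1) _ that(2), of "?\<rho> k s"] False by simp
  qed simp
  have a: "?\<rho> 0 = (\<lambda>_. 0)"
  proof
    fix r show "?\<rho> 0 r = 0"
    proof (cases "1 \<le> r")
      case True
      have "\<not> 1 \<le> ?\<rho> 0 r" using pattern_of_threshold[OF True, of 1 0 n] pos(1) by fastforce
      then show ?thesis by simp
    qed (use r0 in \<open>auto simp: not_le\<close>)
  qed
  have b: "?\<rho> n = \<mu>"
  proof
    fix r show "?\<rho> n r = \<mu> r"
    proof (cases "1 \<le> r")
      case True
      have "c \<le> ?\<rho> n r \<longleftrightarrow> c \<le> \<mu> r" if "1 \<le> c" for c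
      proof -
        have "(\<exists>x\<in>T (r, c). x \<le> n) \<longleftrightarrow> (r, c) \<in> diagram \<mu>" using ne mem n by fastforce
        then show ?thesis using pattern_of_threshold[OF True that order_refl] that True by (simp add: mem_diagram)
      qed
      from this[of "?\<rho> n r"] this[of "\<mu> r"] show ?thesis by (cases "?\<rho> n r"; cases "\<mu> r") auto
    next
      case False
      then have "r = 0" by simp
      then show ?thesis using r0 parD(1)[OF mu] by simp
    qed
  qed
  have c: "?\<rho> (Suc k) (Suc r) \<le> ?\<rho> k r \<and> ?\<rho> k r \<le> ?\<rho> (Suc k) r" if k: "k < n" "1 \<le> r" for k r
  proof
    show "?\<rho> (Suc k) (Suc r) \<le> ?\<rho> k r"
    proof (rule leI)
      fix c assume c: "1 \<le> c" "c \<le> ?\<rho> (Suc k) (Suc r)"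
      then obtain x where x: "x \<in> T (Suc r, c)" "x \<le> Suc k"
        using pattern_of_threshold[of "Suc r" c "Suc k" n] k by auto
      obtain y where y: "y \<in> T (r, c)" using down[OF x(1), of r c] k c by auto
      have "y < x" by (rule col[OF y x(1)]) simp
      then show "\<exists>x\<in>T (r, c). x \<le> k" using y x by (intro bexI[of _ y]) auto
    qed (use k in auto)
    show "?\<rho> k r \<le> ?\<rho> (Suc k) r"
    proof (rule leI)
      fix c assume c: "1 \<le> c" "c \<le> ?\<rho> k r"
      then show "\<exists>x\<in>T (r, c). x \<le> Suc k"
        using pattern_of_threshold[of r c k n] k by (auto intro: le_SucI)
    qed (use k in auto)
  qed
  have d: "?\<epsilon> k r \<le> of_bool (1 \<le> k \<and> k \<le> n \<and> 1 \<le> r \<and> ?\<rho> k (Suc r) < ?\<rho> (k - 1) r)" for k r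
  proof (cases "?\<epsilon> k r = 0")
    case False
    then obtain c x where x: "k \<in> T (r, c)" "x \<in> T (r, c)" "x < k" by (auto simp: pattern_of_def split: if_splits)
    have kn: "1 \<le> k" "k \<le> n" "1 \<le> r" using n[of "(r, c)"] x(1) pos[OF x(1)] by auto
    from pattern_of_eps[OF x(2,3,1) kn(2)] have "?\<rho> k (Suc r) < ?\<rho> (k - 1) r" by simp
    then show ?thesis using kn by (simp add: pattern_of_def)
  qed simp
  have tail: "\<forall>k>n. ?\<rho> k = (\<lambda>_. 0)" by (simp add: pattern_of_def)
  have "(?\<rho>, ?\<epsilon>) \<in> pat n \<mu>"
    unfolding pat_def mem_Collect_eq prod.case using a b c d r0 tail by blast
  then show ?thesis by simp
qed

lemma tableau_of_pattern_of:
  assumes n: "\<And>x. T x \<subseteq> {1..n}"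
  shows "tableau_of n (pattern_of n \<mu> T) = T"
proof (intro ext set_eqI)
  fix z :: "nat \<times> nat" and k :: nat
  obtain r c where z: "z = (r, c)" by force
  let ?\<rho> = "fst (pattern_of n \<mu> T)" and ?\<epsilon> = "snd (pattern_of n \<mu> T)"
  have m: "k \<in> tableau_of n (pattern_of n \<mu> T) (r, c) \<longleftrightarrow> 1 \<le> k \<and> k \<le> n \<and> 1 \<le> r \<and> 1 \<le> c \<and>
     (?\<rho> (k - 1) r < c \<and> c \<le> ?\<rho> k r \<or> c = ?\<rho> (k - 1) r \<and> ?\<epsilon> k r = 1)" by (simp add: tableau_of_def)
  have "k \<in> tableau_of n (pattern_of n \<mu> T) (r, c) \<longleftrightarrow> k \<in> T (r, c)"
  proof
    assume k: "k \<in> T (r, c)"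
    then have b: "1 \<le> k" "k \<le> n" "1 \<le> r" "1 \<le> c" using n[of "(r, c)"] k pos[OF k] by auto
    have "c \<le> ?\<rho> k r" using pattern_of_threshold[OF b(3,4,2)] k by auto
    show "k \<in> tableau_of n (pattern_of n \<mu> T) (r, c)"
    proof (cases "?\<rho> (k - 1) r < c")
      case True
      then show ?thesis using m b \<open>c \<le> ?\<rho> k r\<close> by simp
    next
      case False
      have "k - 1 \<le> n" using b by linarith
      then obtain x where x: "x \<in> T (r, c)" "x \<le> k - 1"
        using False pattern_of_threshold(1)[OF b(3,4), of "k - 1" n] by auto
      then have "x < k" using b by simp
      have "c = ?\<rho> (k - 1) r" by (rule pattern_of_eps[OF x(1) \<open>x < k\<close> k b(2)])
      moreover have "?\<epsilon> k r = 1" using k x \<open>x < k\<close> by (auto simp: pattern_of_def)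
      ultimately show ?thesis using m b by simp
    qed
  next
    assume "k \<in> tableau_of n (pattern_of n \<mu> T) (r, c)"
    then have b: "1 \<le> k" "k \<le> n" "1 \<le> r" "1 \<le> c"
      and "?\<rho> (k - 1) r < c \<and> c \<le> ?\<rho> k r \<or> c = ?\<rho> (k - 1) r \<and> ?\<epsilon> k r = 1" using m by auto
    then consider "?\<rho> (k - 1) r < c" "c \<le> ?\<rho> k r" | "c = ?\<rho> (k - 1) r" "?\<epsilon> k r = 1" by blast
    then show "k \<in> T (r, c)"
    proof cases
      case 1
      then obtain x where x: "x \<in> T (r, c)" "x \<le> k" using pattern_of_threshold[OF b(3,4,2)] by auto
      have "k - 1 \<le> n" using b by linarith
      then have "\<not> x \<le> k - 1" using pattern_of_threshold(1)[OF b(3,4), of "k - 1" n] 1 x by fastforce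
      then have "x = k" using x by simp
      then show ?thesis using x by simp
    next
      case 2
      then obtain c' x where x: "k \<in> T (r, c')" "x \<in> T (r, c')" "x < k" by (auto simp: pattern_of_def split: if_splits)
      from pattern_of_eps(1)[OF x(2,3,1) b(2)] show ?thesis using x(1) 2 by simp
    qed
  qed
  then show "k \<in> tableau_of n (pattern_of n \<mu> T) z \<longleftrightarrow> k \<in> T z" by (simp add: z)
qed

end

lemma bij_betw_tableau_of:
  assumes mu: "\<mu> \<in> par m"
  shows "bij_betw (tableau_of n) (pat n \<mu>) {T. is_set_valued_tableau \<mu> T \<and> (\<forall>x. T x \<subseteq> {1..n})}"
proof (rule bij_betw_byWitness[where f' = "pattern_of n \<mu>"])
  show "\<forall>D\<in>pat n \<mu>. pattern_of n \<mu> (tableau_of n D) = D" using pattern_of_tableau_of by auto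
  show "\<forall>T\<in>{T. is_set_valued_tableau \<mu> T \<and> (\<forall>x. T x \<subseteq> {1..n})}. tableau_of n (pattern_of n \<mu> T) = T"
  proof
    fix T assume T: "T \<in> {T. is_set_valued_tableau \<mu> T \<and> (\<forall>x. T x \<subseteq> {1..n})}"
    then interpret svtab m \<mu> T using mu by unfold_locales auto
    show "tableau_of n (pattern_of n \<mu> T) = T" by (rule tableau_of_pattern_of) (use T in blast)
  qed
  show "tableau_of n ` pat n \<mu> \<subseteq> {T. is_set_valued_tableau \<mu> T \<and> (\<forall>x. T x \<subseteq> {1..n})}"
    using tableau_of_svt by (force simp: tableau_of_def)
  show "pattern_of n \<mu> ` {T. is_set_valued_tableau \<mu> T \<and> (\<forall>x. T x \<subseteq> {1..n})} \<subseteq> pat n \<mu>"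
  proof (rule image_subsetI)
    fix T assume T: "T \<in> {T. is_set_valued_tableau \<mu> T \<and> (\<forall>x. T x \<subseteq> {1..n})}"
    then interpret svtab m \<mu> T using mu by unfold_locales auto
    show "pattern_of n \<mu> T \<in> pat n \<mu>" by (rule pattern_of_in_pat) (use T in blast)
  qed
qed

lemma card_tableau_of:
  assumes D: "D \<in> pat n \<mu>" and k: "1 \<le> k" and r: "1 \<le> r"
  shows "card {c. k \<in> tableau_of n D (r, c)} = row_count D k r"
proof (cases "k \<le> n")
  case False
  then have "{c. k \<in> tableau_of n D (r, c)} = {}" by (simp add: tableau_of_def)
  then have "card {c. k \<in> tableau_of n D (r, c)} = 0" by (simp only: card.empty)
  then show ?thesis using row_count_outside[OF D, of k r] False by simp
next
  case True
  obtain \<rho> \<epsilon> where De: "D = (\<rho>, \<epsilon>)" by force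
  note P = D[unfolded De]
  have e: "\<epsilon> k r \<le> of_bool (\<rho> k (Suc r) < \<rho> (k - 1) r)"
    using patD(7)[OF P, of k r] by (auto simp: of_bool_def split: if_splits)
  let ?X = "if \<epsilon> k r = 1 then {\<rho> (k - 1) r} else {}"
  have "{c. k \<in> tableau_of n D (r, c)} = {\<rho> (k - 1) r<..\<rho> k r} \<union> ?X"
    using e k r True unfolding De by (auto simp: mem_tableau_of of_bool_def split: if_splits)
  also have "card \<dots> = card {\<rho> (k - 1) r<..\<rho> k r} + card ?X"
    by (rule card_Un_disjoint) auto
  also have "card ?X = \<epsilon> k r" using e by (auto simp: of_bool_def split: if_splits)
  finally show ?thesis by (simp add: row_count_def De)
qed

lemma svt_weight_tableau_of:
  assumes D: "D \<in> pat n \<mu>"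
  shows "svt_weight \<mu> (tableau_of n D) k = pat_weight n D k"
proof (cases "1 \<le> k")
  case False
  then have "k = 0" by simp
  then have "{x \<in> diagram \<mu>. k \<in> tableau_of n D x} = {}" by (auto simp: tableau_of_def)
  then have "svt_weight \<mu> (tableau_of n D) k = 0" unfolding svt_weight_def by (simp only: card.empty)
  then show ?thesis using row_count_outside[OF D, of k] \<open>k = 0\<close> by (simp add: pat_weight_def)
next
  case True
  obtain \<rho> \<epsilon> where De: "D = (\<rho>, \<epsilon>)" by force
  note P = D[unfolded De]
  interpret svtab n \<mu> "tableau_of n D"
    by unfold_locales (use pat_shape_par[OF D] tableau_of_svt[OF P] De in auto)
  have "{x \<in> diagram \<mu>. k \<in> tableau_of n D x} = Sigma {1..n} (\<lambda>r. {c. k \<in> tableau_of n D (r, c)})"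
  proof (intro set_eqI)
    fix x :: "nat \<times> nat"
    obtain r c where x: "x = (r, c)" by force
    have "r \<in> {1..n}" if "(r, c) \<in> diagram \<mu>"
      using that parD(3)[OF mu, of r] by (cases "r \<le> n") (auto simp: mem_diagram)
    then show "x \<in> {x \<in> diagram \<mu>. k \<in> tableau_of n D x} \<longleftrightarrow> x \<in> Sigma {1..n} (\<lambda>r. {c. k \<in> tableau_of n D (r, c)})"
      using mem by (auto simp: x)
  qed
  moreover have "finite {c. k \<in> tableau_of n D (r, c)}" for r
    using finite_cols[of "\<lambda>_. True" "\<lambda>s. s = r" k] by simp
  ultimately have "svt_weight \<mu> (tableau_of n D) k = (\<Sum>r=1..n. card {c. k \<in> tableau_of n D (r, c)})"
    unfolding svt_weight_def by (simp add: card_SigmaI)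
  then show ?thesis unfolding pat_weight_def by (simp add: card_tableau_of[OF D True])
qed

lemma row_count_high_row:
  assumes D: "D \<in> pat n \<mu>" and "r > n"
  shows "row_count D k r = 0"
proof -
  obtain \<rho> \<epsilon> where De: "D = (\<rho>, \<epsilon>)" by force
  note P = D[unfolded De]
  show ?thesis
  proof (cases "k \<le> n")
    case True
    then show ?thesis using pat_row_0[OF P, of k r] pat_eps_0[OF P, of k r] assms(2) by (simp add: row_count_def De)
  qed (simp add: row_count_outside[OF D])
qed

lemma good_iff_column_yamanouchi:
  assumes D: "D \<in> pat n \<mu>" and lam: "lam \<in> par n"
  shows "column_yamanouchi lam \<mu> (tableau_of n D) \<longleftrightarrow> good n lam D"
proof -
  obtain \<rho> \<epsilon> where De: "D = (\<rho>, \<epsilon>)" by force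
  note P = D[unfolded De]
  interpret svtab n \<mu> "tableau_of n D"
    by unfold_locales (use pat_shape_par[OF D] tableau_of_svt[OF P] De in auto)
  have cc: "card (Col k r) = (\<Sum>s=1..r. row_count D k s)" if "1 \<le> k" for k r
    unfolding card_Col by (intro sum.cong refl) (simp add: card_tableau_of[OF D that])
  have v: "violation lam D i r \<longleftrightarrow> \<not> card (Col (Suc i) r) + lam (Suc i) \<le> card (Col i (r - 1)) + lam i"
    if "1 \<le> i" "1 \<le> r" for i r
  proof -
    have "{1..<r} = {1..r - 1}" using that by auto
    then show ?thesis using that by (simp add: violation_def cc add.commute not_le)
  qed
  show ?thesis unfolding column_yamanouchi_iff
  proof
    assume "\<forall>i\<ge>1. \<forall>r. card (Col (Suc i) r) + lam (Suc i) \<le> card (Col i (r - 1)) + lam i"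
    then show "good n lam D" using v by (auto simp: good_def)
  next
    assume g: "good n lam D"
    show "\<forall>i\<ge>1. \<forall>r. card (Col (Suc i) r) + lam (Suc i) \<le> card (Col i (r - 1)) + lam i"
    proof (intro allI impI)
      fix i r :: nat assume i: "1 \<le> i"
      have l: "lam (Suc i) \<le> lam i" by (rule parD(2)[OF lam i])
      have z: "card (Col (Suc i) r) = 0" if "r = 0 \<or> n \<le> i"
        using that row_count_outside[OF D, of "Suc i"] by (auto simp: cc)
      \<comment> \<open>\<open>good\<close> tests only i < n and r \<le> n. Letters above n do not
        occur and rows above n are empty, so the other cases follow from lam being a partition or
        from row n.\<close>
      consider "r = 0 \<or> n \<le> i" | "i < n" "1 \<le> r" "r \<le> n" | "i < n" "n < r" by linarith
      then show "card (Col (Suc i) r) + lam (Suc i) \<le> card (Col i (r - 1)) + lam i"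
      proof cases
        case 1
        then show ?thesis using l z by simp
      next
        case 2
        then have "\<not> violation lam D i r" using g i by (simp add: good_def)
        then show ?thesis using v[OF i 2(2)] by simp
      next
        case 3
        then have "\<not> violation lam D i n" using g i by (simp add: good_def)
        then have "card (Col (Suc i) n) + lam (Suc i) \<le> card (Col i (n - 1)) + lam i" using v[OF i, of n] 3 i by simp
        moreover have "card (Col (Suc i) r) = card (Col (Suc i) n)"
        proof -
          have "(\<Sum>s=1..n. row_count D (Suc i) s) = (\<Sum>s=1..r. row_count D (Suc i) s)"
            by (rule sum.mono_neutral_left) (use 3 row_count_high_row[OF D] in auto)
          then show ?thesis by (simp add: cc)
        qed
        moreover have "card (Col i (n - 1)) \<le> card (Col i (r - 1))"
          unfolding cc[OF i] by (rule sum_mono2) (use 3 in auto)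
        ultimately show ?thesis by simp
      qed
    qed
  qed
qed

text \<open>The weight is zero beyond n, so all letters are at most n and \<open>tableau_of\<close>
  reaches every tableau counted. If \<mu> has more than n rows, both sets are empty.\<close>

lemma card_svt_eq_card_pat:
  assumes lam: "lam \<in> par n" and nu: "\<nu> \<in> par n" and le: "lam \<le> \<nu>" and mu: "\<mu> \<in> par m"
  shows "card {T. is_set_valued_tableau \<mu> T \<and> column_yamanouchi lam \<mu> T \<and> svt_weight \<mu> T = (\<lambda>i. \<nu> i - lam i)} =
    card {D\<in>pat n \<mu>. good n lam D \<and> (\<lambda>j. lam j + pat_weight n D j) = \<nu>}"
proof -
  let ?V = "{T. is_set_valued_tableau \<mu> T \<and> (\<forall>x. T x \<subseteq> {1..n})}"
  let ?Q = "\<lambda>T. column_yamanouchi lam \<mu> T \<and> svt_weight \<mu> T = (\<lambda>i. \<nu> i - lam i)"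
  have letters: "\<forall>x. T x \<subseteq> {1..n}" if T: "is_set_valued_tableau \<mu> T" and w: "svt_weight \<mu> T = (\<lambda>i. \<nu> i - lam i)" for T
  proof (intro allI subsetI)
    interpret svtab m \<mu> T using mu T by unfold_locales
    fix x k assume k: "k \<in> T x"
    obtain r c where x: "x = (r, c)" by force
    have d: "x \<in> diagram \<mu>" using mem k x by auto
    have "{x \<in> diagram \<mu>. k \<in> T x} \<noteq> {}" using d k by blast
    then have "svt_weight \<mu> T k \<noteq> 0"
      unfolding svt_weight_def using finite_diagram[OF mu] by (simp only: card_eq_0_iff) simp
    then have "\<nu> k \<noteq> 0" using w by simp
    then have "k \<le> n" using parD(3)[OF nu, of k] by (cases "k \<le> n") auto
    then show "k \<in> {1..n}" using pos(1)[of k r c] k x by simp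
  qed
  have Q: "?Q (tableau_of n D) \<longleftrightarrow> good n lam D \<and> (\<lambda>j. lam j + pat_weight n D j) = \<nu>" if D: "D \<in> pat n \<mu>" for D
  proof -
    have "svt_weight \<mu> (tableau_of n D) = pat_weight n D" using svt_weight_tableau_of[OF D] by auto
    moreover have "pat_weight n D = (\<lambda>i. \<nu> i - lam i) \<longleftrightarrow> (\<lambda>j. lam j + pat_weight n D j) = \<nu>"
    proof
      assume "pat_weight n D = (\<lambda>i. \<nu> i - lam i)"
      then show "(\<lambda>j. lam j + pat_weight n D j) = \<nu>" using le by (simp add: le_fun_def)
    next
      assume e: "(\<lambda>j. lam j + pat_weight n D j) = \<nu>"
      show "pat_weight n D = (\<lambda>i. \<nu> i - lam i)" unfolding e[symmetric] by simp
    qed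
    ultimately show ?thesis using good_iff_column_yamanouchi[OF D lam] by simp
  qed
  have "bij_betw (tableau_of n) {D\<in>pat n \<mu>. ?Q (tableau_of n D)} {T\<in>?V. ?Q T}"
    by (rule bij_betw_filter[OF bij_betw_tableau_of[OF mu]])
  moreover have "{D\<in>pat n \<mu>. ?Q (tableau_of n D)} = {D\<in>pat n \<mu>. good n lam D \<and> (\<lambda>j. lam j + pat_weight n D j) = \<nu>}"
    using Q by blast
  moreover have "{T\<in>?V. ?Q T} = {T. is_set_valued_tableau \<mu> T \<and> ?Q T}"
    using letters by blast
  ultimately show ?thesis by (simp add: bij_betw_same_card)
qed

section \<open>Sizes, signs and the final expansion\<close>

lemma psize_par:
  assumes "p \<in> par n"
  shows "psize p = (\<Sum>i=1..n. p i)"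
  unfolding psize_def
proof (rule sum.mono_neutral_left)
  show "{i. p i \<noteq> 0} \<subseteq> {1..n}"
  proof
    fix i assume "i \<in> {i. p i \<noteq> 0}"
    then show "i \<in> {1..n}" using parD(1)[OF assms] parD(3)[OF assms, of i] by (cases "i = 0"; cases "i \<le> n") auto
  qed
qed auto

text \<open>Summed over k, the growth of each row telescopes to \<mu> r; what remains are the extra
  letters.\<close>

lemma sum_pat_weight:
  assumes D: "D \<in> pat n \<mu>"
  shows "(\<Sum>k=1..n. pat_weight n D k) = (\<Sum>r=1..n. \<mu> r) + num_extra n D"
proof -
  obtain \<rho> \<epsilon> where De: "D = (\<rho>, \<epsilon>)" by force
  note P = D[unfolded De]
  have tel: "k \<le> n \<Longrightarrow> (\<Sum>i=1..k. \<rho> i r - \<rho> (i - 1) r) = \<rho> k r" for k r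
  proof (induction k)
    case 0
    then show ?case using patD(1)[OF P] by simp
  next
    case (Suc k)
    then show ?case using pat_mono[OF P, of k r] by simp
  qed
  have "(\<Sum>k=1..n. pat_weight n D k) = (\<Sum>k=1..n. \<Sum>r=1..n. \<rho> k r - \<rho> (k - 1) r) + num_extra n D"
    by (simp add: pat_weight_def row_count_def De num_extra_def sum.distrib)
  also have "(\<Sum>k=1..n. \<Sum>r=1..n. \<rho> k r - \<rho> (k - 1) r) = (\<Sum>r=1..n. \<Sum>k=1..n. \<rho> k r - \<rho> (k - 1) r)"
    by (rule sum.swap)
  also have "\<dots> = (\<Sum>r=1..n. \<mu> r)" using tel[OF order_refl] patD(2)[OF P] by simp
  finally show ?thesis .
qed

lemma psize_pattern:
  assumes lam: "lam \<in> par n" and nu: "\<nu> \<in> par n" and D: "D \<in> pat n \<mu>" and w: "(\<lambda>j. lam j + pat_weight n D j) = \<nu>"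
  shows "psize \<nu> = psize lam + psize \<mu> + num_extra n D"
proof -
  have "psize \<nu> = (\<Sum>j=1..n. lam j + pat_weight n D j)"
    unfolding psize_par[OF nu] using w by auto
  then show ?thesis
    using sum_pat_weight[OF D] by (simp add: sum.distrib psize_par[OF lam] psize_par[OF pat_shape_par[OF D]])
qed

text \<open>All patterns counted have the same number of extra letters, namely |\<nu>| - |lam| -
  |\<mu>|, so the sign leaves the sum without cancellation. If there is no such pattern, both sides
  are 0.\<close>

lemma signed_good_count_eq:
  assumes lam: "lam \<in> par n" and nu: "\<nu> \<in> par n" and le: "lam \<le> \<nu>" and mu: "\<mu> \<in> par m"
  shows "signed_good_count n lam \<nu> \<mu> = (-1) ^ nat \<bar>int (psize \<nu>) - int (psize lam) - int (psize \<mu>)\<bar> *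
    int (card {T. is_set_valued_tableau \<mu> T \<and> column_yamanouchi lam \<mu> T \<and> svt_weight \<mu> T = (\<lambda>i. \<nu> i - lam i)})"
proof -
  have "signed_good_count n lam \<nu> \<mu> = (\<Sum>D\<in>{D\<in>pat n \<mu>. good n lam D \<and> (\<lambda>j. lam j + pat_weight n D j) = \<nu>}.
      (-1) ^ nat \<bar>int (psize \<nu>) - int (psize lam) - int (psize \<mu>)\<bar>)"
    unfolding signed_good_count_def
  proof (intro sum.cong refl)
    fix D assume "D \<in> {D\<in>pat n \<mu>. good n lam D \<and> (\<lambda>j. lam j + pat_weight n D j) = \<nu>}"
    then have "psize \<nu> = psize lam + psize \<mu> + num_extra n D" by (intro psize_pattern[OF lam nu]) auto
    then show "(-1) ^ num_extra n D = (-1 :: int) ^ nat \<bar>int (psize \<nu>) - int (psize lam) - int (psize \<mu>)\<bar>" by simp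
  qed
  then show ?thesis unfolding card_svt_eq_card_pat[OF lam nu le mu] by simp
qed

text \<open>A counted pattern forces |\<mu>| \<le> |\<nu>|, which bounds the first part of \<mu> and
  makes the expansion finite.\<close>

lemma signed_good_count_nonzero:
  assumes lam: "lam \<in> par n" and nu: "\<nu> \<in> par n" and nz: "signed_good_count n lam \<nu> \<mu> \<noteq> 0"
  shows "\<mu> \<in> box n (psize \<nu>)"
proof -
  have "{D\<in>pat n \<mu>. good n lam D \<and> (\<lambda>j. lam j + pat_weight n D j) = \<nu>} \<noteq> {}"
    using nz unfolding signed_good_count_def by (metis (no_types, lifting) sum.empty)
  then obtain D where D: "D \<in> pat n \<mu>" "(\<lambda>j. lam j + pat_weight n D j) = \<nu>" by auto
  have m: "\<mu> \<in> par n" by (rule pat_shape_par[OF D(1)])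
  have "\<mu> 1 \<le> psize \<mu>"
  proof (cases "1 \<le> n")
    case True
    then show ?thesis unfolding psize_par[OF m] using member_le_sum[of 1 "{1..n}" \<mu>] by simp
  qed (use parD(3)[OF m, of 1] in simp)
  then show ?thesis using psize_pattern[OF lam nu D] m by (simp add: box_def)
qed

text \<open>A series is a function on all vectors, so the expansion has to be checked also at those
  that are not exponents of monomials in x_1, x_2 and so on.\<close>

lemma g_skew_eq_0:
  assumes v: "\<nu> \<in> par n" and a: "\<not> (\<alpha> 0 = 0 \<and> finite {i. \<alpha> i \<noteq> 0})"
  shows "g_skew \<nu> lam \<alpha> = 0"
proof -
  have "rpp_weight \<nu> lam R \<noteq> \<alpha>" if R: "is_rpp \<nu> lam R" for R
  proof
    assume w: "rpp_weight \<nu> lam R = \<alpha>"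
    have "1 \<le> R x" if "x \<in> skew_diagram \<nu> lam" for x using R that unfolding is_rpp_def by blast
    then have "{c. \<exists>r. (r, c) \<in> skew_diagram \<nu> lam \<and> R (r, c) = 0} = {}" by fastforce
    then have "card {c. \<exists>r. (r, c) \<in> skew_diagram \<nu> lam \<and> R (r, c) = 0} = 0" by (simp only: card.empty)
    then have "\<alpha> 0 = 0" using w by (auto simp: rpp_weight_def)
    moreover have "finite {i. \<alpha> i \<noteq> 0}"
    proof (rule finite_subset)
      show "{i. \<alpha> i \<noteq> 0} \<subseteq> R ` skew_diagram \<nu> lam"
      proof
        fix i assume "i \<in> {i. \<alpha> i \<noteq> 0}"
        then have "card {c. \<exists>r. (r, c) \<in> skew_diagram \<nu> lam \<and> R (r, c) = i} \<noteq> 0"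
          using w by (auto simp: rpp_weight_def)
        then have "{c. \<exists>r. (r, c) \<in> skew_diagram \<nu> lam \<and> R (r, c) = i} \<noteq> {}" by (metis card.empty)
        then show "i \<in> R ` skew_diagram \<nu> lam" by blast
      qed
      show "finite (R ` skew_diagram \<nu> lam)" using finite_diagram[OF v] by (simp add: skew_diagram_def)
    qed
    ultimately show False using a by simp
  qed
  then have "{R. is_rpp \<nu> lam R \<and> rpp_weight \<nu> lam R = \<alpha>} = {}" by blast
  then have "card {R. is_rpp \<nu> lam R \<and> rpp_weight \<nu> lam R = \<alpha>} = 0" by (simp only: card.empty)
  then show ?thesis by (simp add: g_skew_def)
qed

lemma g_skew_expansion:
  assumes n: "n \<ge> 1" and lam: "lam \<in> par n" and nu: "\<nu> \<in> par n" and le: "lam \<le> \<nu>"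
  shows "is_g_expansion (g_skew \<nu> lam) (signed_good_count n lam \<nu>)"
  unfolding is_g_expansion_def
proof (intro conjI allI impI ext)
  have sub: "{\<eta>. signed_good_count n lam \<nu> \<eta> \<noteq> 0} \<subseteq> box n (psize \<nu>)" using signed_good_count_nonzero[OF lam nu] by blast
  show "finite {\<eta>. signed_good_count n lam \<nu> \<eta> \<noteq> 0}" by (rule finite_subset[OF sub]) simp
  show "is_partition \<eta>" if "signed_good_count n lam \<nu> \<eta> \<noteq> 0" for \<eta>
    using signed_good_count_nonzero[OF lam nu that] by (auto simp: is_partition_par box_def)
  fix \<alpha>
  show "g_skew \<nu> lam \<alpha> = (\<Sum>\<eta> | signed_good_count n lam \<nu> \<eta> \<noteq> 0. signed_good_count n lam \<nu> \<eta> * g \<eta> \<alpha>)"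
  proof (cases "\<alpha> 0 = 0 \<and> finite {i. \<alpha> i \<noteq> 0}")
    case False
    have "g \<eta> \<alpha> = 0" if "signed_good_count n lam \<nu> \<eta> \<noteq> 0" for \<eta>
      using g_skew_eq_0[of \<eta> n \<alpha>] False signed_good_count_nonzero[OF lam nu that] by (simp add: g_def box_def)
    then show ?thesis using g_skew_eq_0[OF nu False] by simp
  next
    case True
    then obtain N where "\<forall>i\<in>{i. \<alpha> i \<noteq> 0}. i \<le> N" using finite_nat_set_iff_bounded_le by blast
    then have N: "\<alpha> i = 0" if "i > N" for i using that by (metis mem_Collect_eq not_le)
    \<comment> \<open>The first bound covers the support of the coefficients, the second is what
      \<open>chain_count_eq_sum\<close> requires.\<close>
    define M where "M = max (psize \<nu>) (\<Sum>i=1..N. \<alpha> i)"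
    have "g_skew \<nu> lam \<alpha> = int (chain_count n N lam \<nu> \<alpha>)"
      using card_rpps[OF lam nu le, of \<alpha> N] True N by (simp add: g_skew_def rpps_def)
    also have "\<dots> = (\<Sum>\<mu>\<in>box n M. int (chain_count n N (\<lambda>_. 0) \<mu> \<alpha>) * signed_good_count n lam \<nu> \<mu>)"
      by (rule chain_count_eq_sum[OF n lam nu]) (simp add: M_def)
    also have "\<dots> = (\<Sum>\<mu>\<in>box n M. signed_good_count n lam \<nu> \<mu> * g \<mu> \<alpha>)"
      using g_eq_chain_count[of _ n \<alpha> N] True N by (intro sum.cong refl) (simp add: box_def)
    also have "\<dots> = (\<Sum>\<eta> | signed_good_count n lam \<nu> \<eta> \<noteq> 0. signed_good_count n lam \<nu> \<eta> * g \<eta> \<alpha>)"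
    proof (rule sum.mono_neutral_right)
      show "{\<eta>. signed_good_count n lam \<nu> \<eta> \<noteq> 0} \<subseteq> box n M" using sub by (auto simp: box_def M_def)
    qed auto
    finally show ?thesis .
  qed
qed

theorem mainTheorem1:
  fixes lam \<nu> \<mu> :: "nat \<Rightarrow> nat"
  assumes "is_partition lam" and "is_partition \<nu>" and "is_partition \<mu>"
    and "diagram lam \<subseteq> diagram \<nu>"
  shows "(\<exists>!a. is_g_expansion (g_skew \<nu> lam) a) \<and>
         (\<forall>a. is_g_expansion (g_skew \<nu> lam) a \<longrightarrow>
            a \<mu> = (-1) ^ nat \<bar>int (psize \<nu>) - int (psize lam) - int (psize \<mu>)\<bar> *
                  int (card {T. is_set_valued_tableau \<mu> T \<and> column_yamanouchi lam \<mu> T \<and>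
                                svt_weight \<mu> T = (\<lambda>i. \<nu> i - lam i)}))"
proof -
  have "\<exists>n\<ge>1. {lam, \<nu>} \<subseteq> par n"
    by (rule finite_partitions_common_par) (use assms in auto)
  then obtain n where n: "n \<ge> 1" and lam: "lam \<in> par n" and nu: "\<nu> \<in> par n" by auto
  \<comment> \<open>A separate bound, since \<mu> may have more rows than \<nu>.\<close>
  obtain m where mu: "\<mu> \<in> par m" using assms(3) by (auto simp: is_partition_par)
  have le: "lam \<le> \<nu>" using diagram_subset_iff[OF lam nu] assms(4) by simp
  have E: "is_g_expansion (g_skew \<nu> lam) (signed_good_count n lam \<nu>)" by (rule g_skew_expansion[OF n lam nu le])
  have "a = signed_good_count n lam \<nu>" if "is_g_expansion (g_skew \<nu> lam) a" for a
    by (rule g_expansion_unique[OF that E])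
  then show ?thesis using E signed_good_count_eq[OF lam nu le mu] by blast
qed

end
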